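(* Let $s\in(0,1)$ and $0<\alpha<2s<n$, put $2^*_s(\alpha)=\frac{2(n-\alpha)}{n-2s}$ and $r=\frac{\alpha}{2^*_s(\alpha)}$. Then for any $p\in[1,2^*_s(\alpha))$ there are continuous embeddings $$\dot H^s(\mathbb{R}^n)\hookrightarrow L^{2^*_s(\alpha)}(\mathbb{R}^n,|y|^{-\alpha})\hookrightarrow L^{p,\frac{n-2s}{2}p+pr}(\mathbb{R}^n,|y|^{-pr}),$$ and the norms of these three spaces share the same dilation invariance: each is invariant under $u\mapsto t^{\frac{n-2s}{2}}u(t\,\cdot)$ for every $t>0$.
   Context: $\dot H^s(\mathbb{R}^n)=\{u\in L^{2n/(n-2s)}(\mathbb{R}^n): |\xi|^s\hat u(\xi)\in L^2(\mathbb{R}^n)\}$ with norm $\|u\|_{\dot H^s}^2=\int|\xi|^{2s}|\hat u(\xi)|^2d\xi$. $L^q(\mathbb{R}^n,|y|^{-\lambda})$ has norm $\big(\int_{\mathbb{R}^n}|u(y)|^q|y|^{-\lambda}dy\big)^{1/q}$. For $p\in[1,\infty)$, $\gamma,\lambda>0$ with $\gamma+\lambda\in(0,n)$, the weighted Morrey space $L^{p,\gamma+\lambda}(\mathbb{R}^n,|y|^{-\lambda})$ consists of the Lebesgue measurable $u:\mathbb{R}^n\to\mathbb{R}$ with $$\|u\|_{L^{p,\gamma+\lambda}(\mathbb{R}^n,|y|^{-\lambda})}=\sup_{R>0,\,x\in\mathbb{R}^n}\Big\{R^{\gamma+\lambda-n}\int_{B_R(x)}\frac{|u(y)|^p}{|y|^\lambda}dy\Big\}^{1/p}<\infty;$$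 here it is used with $\gamma=\frac{n-2s}{2}p$ and $\lambda=pr$. *)

theory Defs
  imports "HOL-Analysis.Analysis"
begin

text \<open>Real powers on \<^typ>\<open>ennreal\<close>, meant for exponents \<open>a > 0\<close>, so that norms may take
  the value \<open>\<infinity>\<close>.\<close>

definition ennreal_rpow :: "ennreal \<Rightarrow> real \<Rightarrow> ennreal" where
  "ennreal_rpow x a = (if x = \<infinity> then \<infinity> else ennreal (enn2real x powr a))"

text \<open>All function spaces are sets of functions, not of almost-everywhere classes; the norms depend
  only on the class. Since \<^term>\<open>0 powr a = (0::real)\<close>, weights \<open>|y|\<^sup>a\<close> take the value 0 at the
  origin, a null set.\<close>

definition Lp_norm :: "real \<Rightarrow> (real^'n \<Rightarrow> 'b::{real_normed_vector}) \<Rightarrow> ennreal" where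
  "Lp_norm q u = ennreal_rpow (\<integral>\<^sup>+ x. ennreal (norm (u x) powr q) \<partial>lebesgue) (1 / q)"

definition Lp_space :: "real \<Rightarrow> (real^'n \<Rightarrow> 'b::{real_normed_vector}) set" where
  "Lp_space q = {u \<in> borel_measurable lebesgue. Lp_norm q u < \<infinity>}"

definition weighted_Lp_norm :: "real \<Rightarrow> real \<Rightarrow> (real^'n \<Rightarrow> real) \<Rightarrow> ennreal" where
  "weighted_Lp_norm q l u =
     ennreal_rpow (\<integral>\<^sup>+ y. ennreal (\<bar>u y\<bar> powr q * norm y powr (- l)) \<partial>lebesgue) (1 / q)"

definition weighted_Lp_space :: "real \<Rightarrow> real \<Rightarrow> (real^'n \<Rightarrow> real) set" where
  "weighted_Lp_space q l = {u \<in> borel_measurable lebesgue. weighted_Lp_norm q l u < \<infinity>}"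

text \<open>The second argument \<open>m\<close> is the whole Morrey exponent, written \<open>\<gamma> + \<lambda>\<close> in the notation
  \<open>L\<^bsup>p,\<gamma>+\<lambda>\<^esup>(|y|\<^bsup>-\<lambda>\<^esup>)\<close>; the third argument is \<open>l = \<lambda>\<close>.\<close>

definition morrey_norm :: "real \<Rightarrow> real \<Rightarrow> real \<Rightarrow> (real^'n \<Rightarrow> real) \<Rightarrow> ennreal" where
  "morrey_norm p m l u =
     (SUP (R, x) \<in> {0<..} \<times> UNIV.
        ennreal_rpow
          (ennreal (R powr (m - real CARD('n))) *
             (\<integral>\<^sup>+ y \<in> ball x R. ennreal (\<bar>u y\<bar> powr p / norm y powr l) \<partial>lebesgue))
          (1 / p))"

definition morrey_space :: "real \<Rightarrow> real \<Rightarrow> real \<Rightarrow> (real^'n \<Rightarrow> real) set" where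
  "morrey_space p m l = {u \<in> borel_measurable lebesgue. morrey_norm p m l u < \<infinity>}"

fun iterated_partial :: "'n list \<Rightarrow> (real^'n \<Rightarrow> complex) \<Rightarrow> real^'n \<Rightarrow> complex" where
  "iterated_partial [] \<phi> = \<phi>"
| "iterated_partial (i # is) \<phi> =
     (\<lambda>x. frechet_derivative (iterated_partial is \<phi>) (at x) (axis i 1))"

definition schwartz :: "(real^'n \<Rightarrow> complex) set" where
  "schwartz = {\<phi>. \<forall>is. (\<forall>x. iterated_partial is \<phi> differentiable at x) \<and>
                       (\<forall>k::nat. bounded (range (\<lambda>x. norm x ^ k *\<^sub>R iterated_partial is \<phi> x)))}"

text \<open>Unitary normalisation of the Fourier transform.\<close>

definition fourier_integral :: "(real^'n \<Rightarrow> complex) \<Rightarrow> real^'n \<Rightarrow> complex" where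
  "fourier_integral \<phi> \<xi> =
     (2 * pi) powr (- real CARD('n) / 2) *\<^sub>R (\<integral>x. cis (- (x \<bullet> \<xi>)) * \<phi> x \<partial>lebesgue)"

text \<open>The Fourier transform of the tempered distribution \<open>u\<close> is the function \<open>g\<close>: by duality,
  \<open>\<langle>\<hat>u, \<phi>\<rangle> = \<langle>u, \<hat>\<phi>\<rangle> = \<integral> g \<phi>\<close> for all Schwartz functions \<open>\<phi>\<close>.
  Such a \<open>g\<close> is unique up to null sets.\<close>

definition has_fourier_transform ::
    "(real^'n \<Rightarrow> complex) \<Rightarrow> (real^'n \<Rightarrow> complex) \<Rightarrow> bool" where
  "has_fourier_transform u g \<longleftrightarrow>
     u \<in> borel_measurable lebesgue \<and> g \<in> borel_measurable lebesgue \<and>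
     (\<forall>\<phi>\<in>schwartz.
        integrable lebesgue (\<lambda>x. u x * fourier_integral \<phi> x) \<and>
        integrable lebesgue (\<lambda>\<xi>. g \<xi> * \<phi> \<xi>) \<and>
        (\<integral>x. u x * fourier_integral \<phi> x \<partial>lebesgue) = (\<integral>\<xi>. g \<xi> * \<phi> \<xi> \<partial>lebesgue))"

definition fourier_transform :: "(real^'n \<Rightarrow> real) \<Rightarrow> real^'n \<Rightarrow> complex" where
  "fourier_transform u = (SOME g. has_fourier_transform (\<lambda>x. complex_of_real (u x)) g)"

definition hom_sobolev_norm :: "real \<Rightarrow> (real^'n \<Rightarrow> real) \<Rightarrow> ennreal" where
  "hom_sobolev_norm s u =
     ennreal_rpow
       (\<integral>\<^sup>+ \<xi>. ennreal (norm \<xi> powr (2 * s) * (norm (fourier_transform u \<xi>))\<^sup>2) \<partial>lebesgue) (1 / 2)"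

definition hom_sobolev_space :: "real \<Rightarrow> (real^'n \<Rightarrow> real) set" where
  "hom_sobolev_space s =
     {u \<in> Lp_space (2 * real CARD('n) / (real CARD('n) - 2 * s)).
        (\<exists>g. has_fourier_transform (\<lambda>x. complex_of_real (u x)) g) \<and>
        (\<lambda>\<xi>. norm \<xi> powr s *\<^sub>R fourier_transform u \<xi>) \<in> Lp_space 2}"

definition continuous_embedding ::
    "'f set \<Rightarrow> ('f \<Rightarrow> ennreal) \<Rightarrow> 'f set \<Rightarrow> ('f \<Rightarrow> ennreal) \<Rightarrow> bool" where
  "continuous_embedding X NX Y NY \<longleftrightarrow>
     X \<subseteq> Y \<and> (\<exists>C::real. 0 < C \<and> (\<forall>u\<in>X. NY u \<le> ennreal C * NX u))"

definition dilation :: "real \<Rightarrow> real \<Rightarrow> (real^'n \<Rightarrow> real) \<Rightarrow> real^'n \<Rightarrow> real" where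
  "dilation a t u = (\<lambda>x. t powr a * u (t *\<^sub>R x))"

definition dilation_invariant ::
    "real \<Rightarrow> (real^'n \<Rightarrow> real) set \<Rightarrow> ((real^'n \<Rightarrow> real) \<Rightarrow> ennreal) \<Rightarrow> bool" where
  "dilation_invariant a X N \<longleftrightarrow>
     (\<forall>t>0. \<forall>u\<in>X. dilation a t u \<in> X \<and> N (dilation a t u) = N u)"

end

theory Submission
  imports Defs "HOL-Probability.Probability"
begin

text \<open>
  For integrable \<open>H\<close> let \<open>u\<close> be its inverse Fourier transform and split \<open>H = H e\<^bsup>-t|\<xi>|\<^sup>2\<^esup> +
  H (1 - e\<^bsup>-t|\<xi>|\<^sup>2\<^esup>)\<close>. The low part is bounded uniformly by Cauchy--Schwarz, the high part in
  \<open>L\<^sup>2\<close> by Plancherel. Using this on the ball of radius \<open>R\<close> with \<open>t = R\<^sup>2\<close> and integrating over \<open>R\<close>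
  against \<open>R\<^bsup>-\<alpha>-1\<^esup>\<close> gives the Hardy inequality \<open>\<integral> |u|\<^sup>2 |y|\<^bsup>-\<alpha>\<^esup> \<le> C \<integral> |\<xi>|\<^sup>\<alpha> |H|\<^sup>2\<close>. Choosing \<open>t\<close>
  instead for each level \<open>l\<close> so that the low part is at most \<open>l / 2\<close> (the argument of Chemin and Xu), the
  set \<open>|u| \<ge> l\<close> is controlled by the Hardy inequality for the high part, and integrating over \<open>l\<close>
  gives the Hardy--Sobolev inequality.

  A function with a distributional Fourier transform \<open>g\<close> is reached by testing with Gaussians only: its
  Gaussian averages are inverse Fourier transforms of the integrable functions \<open>g e\<^bsup>-b|\<xi>|\<^sup>2\<^esup>\<close>, and
  they converge almost everywhere along a subsequence, so that Fatou's lemma applies. The same averages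
  show that \<open>g\<close> is unique, whence the invariance of the Sobolev norm. The second embedding is Hoelder's
  inequality on balls.
\<close>

subsection \<open>Affine changes of variables and Gaussian integrals\<close>

text \<open>Hardy's inequality cannot be applied to \<open>u\<close> itself: it would need the
  integral of |\<xi>|^\<alpha> |H|^2, which the integral with |\<xi>|^(2s) does not control at low
  frequencies. The high part at level \<open>l\<close> carries the extra factor (1 -
  e^(-t|\<xi>|^2))^2, at most min 1 (t |\<xi>|^2). With t a negative power of l, integrating over l
  turns this factor into exactly the missing |\<xi>|^(2s - \<alpha>). The bound gains at most two
  powers of |\<xi>|, so the integrals over scales and levels ask for \<alpha> < 2 and 2s - \<alpha>
  < 2; both follow from s < 1.

  The inequalities for inverse transforms need integrable H, but a distributional transform g is
  only known through its products with Schwartz functions. Since a Gaussian is one of them, g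
  e^(-b|\<xi>|^2) is integrable, and damping never increases the Sobolev integral, so the bounds are
  uniform in b. On the other side \<open>u\<close> is damped by e^(-|y|^2) to become integrable, and
  this factor is divided out again in the limit.\<close>

lemma lebesgue_affine:
  fixes t :: "'a::euclidean_space"
  assumes "c \<noteq> 0"
  shows "lebesgue = density (distr lebesgue lebesgue (\<lambda>x. t + c *\<^sub>R x)) (\<lambda>_. ennreal (\<bar>c\<bar> ^ DIM('a)))"
    and "(\<lambda>x. t + c *\<^sub>R x) \<in> lebesgue \<rightarrow>\<^sub>M lebesgue"
proof -
  have *: "(\<Sum>j\<in>Basis. (c * (x \<bullet> j)) *\<^sub>R j) = c *\<^sub>R x" for x :: 'a
    unfolding scaleR_scaleR[symmetric] scaleR_sum_right[symmetric] euclidean_representation ..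
  show "lebesgue = density (distr lebesgue lebesgue (\<lambda>x. t + c *\<^sub>R x)) (\<lambda>_. ennreal (\<bar>c\<bar> ^ DIM('a)))"
    using lebesgue_affine_euclidean[where c="\<lambda>_::'a. c" and t=t] assms by (simp add: *)
  show "(\<lambda>x. t + c *\<^sub>R x) \<in> lebesgue \<rightarrow>\<^sub>M lebesgue"
    using lebesgue_affine_measurable[where c="\<lambda>_::'a. c" and t=t] assms by (simp add: *)
qed

lemma nn_integral_lebesgue_affine:
  fixes t :: "'a::euclidean_space" and f :: "'a \<Rightarrow> ennreal"
  assumes "c \<noteq> 0" "f \<in> borel_measurable lebesgue"
  shows "(\<integral>\<^sup>+x. f x \<partial>lebesgue) = ennreal (\<bar>c\<bar> ^ DIM('a)) * (\<integral>\<^sup>+x. f (t + c *\<^sub>R x) \<partial>lebesgue)"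
proof -
  note m = lebesgue_affine[OF assms(1), of t]
  have "(\<integral>\<^sup>+x. f x \<partial>lebesgue) = 
    (\<integral>\<^sup>+x. f x \<partial>density (distr lebesgue lebesgue (\<lambda>x. t + c *\<^sub>R x)) (\<lambda>_. ennreal (\<bar>c\<bar> ^ DIM('a))))"
    using m(1) by simp
  also have "... = ennreal (\<bar>c\<bar> ^ DIM('a)) * (\<integral>\<^sup>+x. f (t + c *\<^sub>R x) \<partial>lebesgue)"
    using m(2) assms(2) by (simp add: nn_integral_density nn_integral_distr nn_integral_cmult)
  finally show ?thesis .
qed

lemma nn_integral_lborel_affine:
  fixes t :: "'a::euclidean_space" and f :: "'a \<Rightarrow> ennreal"
  assumes "c \<noteq> 0" "f \<in> borel_measurable borel"
  shows "(\<integral>\<^sup>+x. f x \<partial>lborel) = ennreal (\<bar>c\<bar> ^ DIM('a)) * (\<integral>\<^sup>+x. f (t + c *\<^sub>R x) \<partial>lborel)"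
  using nn_integral_lebesgue_affine[OF assms(1), of f t] assms(2)
  by (simp add: nn_integral_completion measurable_completion)

lemma integrable_scaleR_right_iff:
  fixes f :: "'a \<Rightarrow> 'b::{banach, second_countable_topology}"
  assumes "c \<noteq> 0"
  shows "integrable M (\<lambda>x. c *\<^sub>R f x) \<longleftrightarrow> integrable M f"
proof
  assume "integrable M (\<lambda>x. c *\<^sub>R f x)"
  then have "integrable M (\<lambda>x. inverse c *\<^sub>R c *\<^sub>R f x)" by (rule integrable_scaleR_right)
  then show "integrable M f" using assms by (simp del: integrable_scaleR_right)
qed simp

lemma integral_lebesgue_affine:
  fixes t :: "'a::euclidean_space" and f :: "'a \<Rightarrow> 'b::{banach, second_countable_topology}"
  assumes "c \<noteq> 0" "f \<in> borel_measurable lebesgue"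
  shows "(\<integral>x. f x \<partial>lebesgue) = \<bar>c\<bar> ^ DIM('a) *\<^sub>R (\<integral>x. f (t + c *\<^sub>R x) \<partial>lebesgue)"
    and "integrable lebesgue f \<longleftrightarrow> integrable lebesgue (\<lambda>x. f (t + c *\<^sub>R x))"
    and "(\<lambda>x. f (t + c *\<^sub>R x)) \<in> borel_measurable lebesgue"
proof -
  note m = lebesgue_affine[OF assms(1), of t]
  have "(\<integral>x. f x \<partial>lebesgue) = 
    (\<integral>x. f x \<partial>density (distr lebesgue lebesgue (\<lambda>x. t + c *\<^sub>R x)) (\<lambda>_. ennreal (\<bar>c\<bar> ^ DIM('a))))"
    using m(1) by simp
  also have "... = \<bar>c\<bar> ^ DIM('a) *\<^sub>R (\<integral>x. f (t + c *\<^sub>R x) \<partial>lebesgue)"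
    using m(2) assms(2) by (simp add: integral_density integral_distr)
  finally show "(\<integral>x. f x \<partial>lebesgue) = \<bar>c\<bar> ^ DIM('a) *\<^sub>R (\<integral>x. f (t + c *\<^sub>R x) \<partial>lebesgue)" .
  show b: "(\<lambda>x. f (t + c *\<^sub>R x)) \<in> borel_measurable lebesgue"
    using measurable_compose[OF m(2) assms(2)] .
  have "integrable lebesgue f \<longleftrightarrow> 
     integrable (density (distr lebesgue lebesgue (\<lambda>x. t + c *\<^sub>R x)) (\<lambda>_. ennreal (\<bar>c\<bar> ^ DIM('a)))) f"
    using m(1) by simp
  also have "... \<longleftrightarrow> integrable lebesgue (\<lambda>x. f (t + c *\<^sub>R x))"
    using m(2) assms by (simp add: integrable_density integrable_distr_eq integrable_scaleR_right_iff)
  finally show "integrable lebesgue f \<longleftrightarrow> integrable lebesgue (\<lambda>x. f (t + c *\<^sub>R x))" .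
qed

section \<open>Gaussian integrals and their Fourier transforms\<close>

text \<open>The integral is the characteristic function of the standard normal law at
  \<open>t / c\<close>; substituting \<open>c * y\<close> with \<open>c = sqrt (2 * a)\<close> turns
  the normal density into a multiple of the Gaussian with parameter \<open>a\<close>.\<close>

lemma gaussian_fourier_real:
  fixes a t :: real
  assumes a: "a > 0"
  shows "integrable lborel (\<lambda>y. cis (t * y) * complex_of_real (exp (- a * y\<^sup>2)))"
    and "(\<integral>y. cis (t * y) * complex_of_real (exp (- a * y\<^sup>2)) \<partial>lborel)
         = complex_of_real (sqrt (pi / a) * exp (- t\<^sup>2 / (4 * a)))"
proof -
  define c where "c = sqrt (2 * a)"
  have c: "c > 0" "c\<^sup>2 = 2 * a" using a by (auto simp: c_def)
  have i: "integrable lborel (\<lambda>x. std_normal_density x *\<^sub>R iexp (t / c * x))"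
    by (rule Bochner_Integration.integrable_bound[where f=std_normal_density])
       (auto simp: normal_density_nonneg integrable_normal_density)
  have eq: "std_normal_density (0 + c * y) *\<^sub>R iexp (t / c * (0 + c * y)) =
     (1 / sqrt (2 * pi)) *\<^sub>R (cis (t * y) * complex_of_real (exp (- a * y\<^sup>2)))" for y
    using c by (simp add: std_normal_density_def power_mult_distrib cis_conv_exp scaleR_conv_of_real mult_ac)
  have "complex_of_real (exp (- ((t/c)^2) / 2)) = char std_normal_distribution (t/c)"
    by (simp add: char_std_normal_distribution)
  also have "... = (\<integral>x. std_normal_density x *\<^sub>R iexp (t / c * x) \<partial>lborel)"
    unfolding char_def by (subst integral_density) (auto simp: normal_density_nonneg)
  also have "... = c *\<^sub>R (\<integral>y. (1 / sqrt (2 * pi)) *\<^sub>R (cis (t * y) * complex_of_real (exp (- a * y\<^sup>2))) \<partial>lborel)"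
    using c(1) by (subst lborel_integral_real_affine[where c=c and t=0]) (auto simp only: eq abs_of_pos)
  finally have 1: "complex_of_real (exp (- ((t/c)^2) / 2)) = 
     complex_of_real (c / sqrt (2*pi)) * (\<integral>y. cis (t * y) * complex_of_real (exp (- a * y\<^sup>2)) \<partial>lborel)"
    by (simp add: scaleR_conv_of_real)
  have "integrable lborel (\<lambda>y. (1 / sqrt (2 * pi)) *\<^sub>R (cis (t * y) * complex_of_real (exp (- a * y\<^sup>2))))"
    using lborel_integrable_real_affine[OF i, of c 0] c(1) by (simp only: eq)
  then show "integrable lborel (\<lambda>y. cis (t * y) * complex_of_real (exp (- a * y\<^sup>2)))"
    by (subst (asm) integrable_scaleR_right_iff) auto
  have 2: "(t/c)^2 / 2 = t\<^sup>2 / (4*a)" using c by (simp add: power_divide)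
  have "sqrt (pi/a) = sqrt (2*pi) / c" using a by (simp add: c_def real_sqrt_divide real_sqrt_mult)
  moreover have X: "X = complex_of_real (sqrt (2*pi) / c) * (complex_of_real (c / sqrt (2*pi)) * X)" for X
    using c(1) by (simp add: mult.assoc[symmetric] of_real_mult[symmetric] del: of_real_mult of_real_divide)
  have "(\<integral>y. cis (t * y) * complex_of_real (exp (- a * y\<^sup>2)) \<partial>lborel) =
      complex_of_real (sqrt (2*pi) / c) * complex_of_real (exp (- ((t/c)^2) / 2))"
    by (subst X) (simp only: 1)
  ultimately show "(\<integral>y. cis (t * y) * complex_of_real (exp (- a * y\<^sup>2)) \<partial>lborel)
         = complex_of_real (sqrt (pi / a) * exp (- t\<^sup>2 / (4 * a)))"
    using 2 by simp
qed

text \<open>Both the character and the Gaussian factor over the coordinates, and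
  \<open>lborel\<close> is the image of a product of one-dimensional measures, so the integral is a
  product of one-dimensional ones.\<close>

lemma gaussian_fourier:
  fixes x :: "'a::euclidean_space" and a :: real
  assumes a: "a > 0"
  shows "integrable lborel (\<lambda>y. cis (x \<bullet> y) * complex_of_real (exp (- a * (norm y)\<^sup>2)))" (is ?I)
    and "(\<integral>y. cis (x \<bullet> y) * complex_of_real (exp (- a * (norm y)\<^sup>2)) \<partial>lborel)
         = complex_of_real ((pi / a) powr (DIM('a) / 2) * exp (- (norm x)\<^sup>2 / (4 * a)))" (is ?E)
proof -
  interpret product_sigma_finite "\<lambda>_::'a. lborel :: real measure"
    by standard
  define f where "f b y = cis ((x \<bullet> b) * y) * complex_of_real (exp (- a * y\<^sup>2))" for b :: 'a and y :: real
  have cis_sum: "cis (sum g B) = (\<Prod>b\<in>B. cis (g b))" if "finite B" for g and B :: "'a set"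
    using that by induct (auto simp: cis_mult[symmetric])
  have nsq: "(norm z)\<^sup>2 = (\<Sum>b\<in>Basis. (z \<bullet> b)\<^sup>2)" for z :: 'a
    by (simp add: norm_eq_sqrt_inner euclidean_inner[of z z] sum_nonneg power2_eq_square)
  have F: "cis (x \<bullet> y) * complex_of_real (exp (- a * (norm y)\<^sup>2)) = (\<Prod>b\<in>Basis. f b (y \<bullet> b))" for y :: 'a
  proof -
    have "cis (x \<bullet> y) = (\<Prod>b\<in>Basis. cis ((x \<bullet> b) * (y \<bullet> b)))"
      by (simp add: euclidean_inner[of x y] cis_sum)
    moreover have "complex_of_real (exp (- a * (norm y)\<^sup>2)) = (\<Prod>b\<in>Basis. complex_of_real (exp (- a * (y \<bullet> b)\<^sup>2)))"
      by (simp add: nsq sum_distrib_left sum_negf[symmetric] exp_sum)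
    ultimately show ?thesis by (simp add: f_def prod.distrib)
  qed
  have fi: "integrable lborel (f b)" for b unfolding f_def using gaussian_fourier_real(1)[OF a] .
  have [measurable]: "f b \<in> borel_measurable borel" for b using fi[of b] by auto
  have sw: "(\<Prod>b\<in>Basis. f b ((\<Sum>b\<in>Basis. g b *\<^sub>R b) \<bullet> b)) = (\<Prod>b\<in>Basis. f b (g b))" for g :: "'a \<Rightarrow> real"
    by (intro prod.cong) auto
  have pi: "integrable (\<Pi>\<^sub>M b\<in>Basis. lborel) (\<lambda>g. \<Prod>b\<in>Basis. f b (g b))"
    using fi by (intro product_integrable_prod) auto
  show ?I unfolding F
    by (subst lborel_eq, subst integrable_distr_eq) (auto simp: sw pi)
  have "(\<integral>y. cis (x \<bullet> y) * complex_of_real (exp (- a * (norm y)\<^sup>2)) \<partial>lborel) = 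
     (\<integral>g. (\<Prod>b\<in>Basis. f b (g b)) \<partial>(\<Pi>\<^sub>M b\<in>Basis. lborel))"
    unfolding F by (subst lborel_eq, subst integral_distr) (auto simp: sw)
  also have "... = (\<Prod>b\<in>Basis. integral\<^sup>L lborel (f b))"
    using fi by (intro product_integral_prod) auto
  also have "... = (\<Prod>b\<in>(Basis::'a set). complex_of_real (sqrt (pi / a) * exp (- (x \<bullet> b)\<^sup>2 / (4 * a))))"
    unfolding f_def using gaussian_fourier_real(2)[OF a] by simp
  also have "... = complex_of_real (sqrt (pi/a) ^ DIM('a) * exp (\<Sum>b\<in>Basis. - (x \<bullet> b)\<^sup>2 / (4 * a)))"
    by (simp add: prod.distrib exp_sum)
  also have "(\<Sum>b\<in>Basis. - (x \<bullet> b)\<^sup>2 / (4 * a)) = - (norm x)\<^sup>2 / (4 * a)"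
    by (simp add: nsq sum_negf sum_divide_distrib)
  also have "sqrt (pi/a) ^ DIM('a) = (pi/a) powr (DIM('a)/2)"
    using a by (simp add: powr_half_sqrt[symmetric] powr_realpow[symmetric] powr_powr)
  finally show ?E .
qed

text \<open>The centre \<open>z\<close> is free because the Plancherel argument integrates a kernel
  in \<xi> - \<eta> over \<eta> for every fixed \<xi>.\<close>

lemma gaussian_integral:
  fixes z :: "'a::euclidean_space"
  assumes a: "a > 0"
  shows "integrable lborel (\<lambda>y::'a. exp (- a * (norm (z - y))\<^sup>2))"
    and "(\<integral>\<^sup>+y. ennreal (exp (- a * (norm (z - y))\<^sup>2)) \<partial>lborel) = ennreal ((pi / a) powr (DIM('a) / 2))"
proof -
  have i: "integrable lborel (\<lambda>y::'a. exp (- a * (norm y)\<^sup>2))"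
    using integrable_Re[OF gaussian_fourier(1)[OF a, of "0::'a"]] by simp
  have "complex_of_real (\<integral>y. exp (- a * (norm (y::'a))\<^sup>2) \<partial>lborel) = complex_of_real ((pi / a) powr (DIM('a) / 2))"
    using gaussian_fourier(2)[OF a, of "0::'a"] by simp
  then have e: "(\<integral>y. exp (- a * (norm (y::'a))\<^sup>2) \<partial>lborel) = (pi / a) powr (DIM('a) / 2)"
    by (simp only: of_real_eq_iff)
  have n: "(\<integral>\<^sup>+y. ennreal (exp (- a * (norm (y::'a))\<^sup>2)) \<partial>lborel) = ennreal ((pi / a) powr (DIM('a) / 2))"
    by (subst nn_integral_eq_integral[OF i]) (auto simp: e[simplified])
  have "(\<integral>\<^sup>+y. ennreal (exp (- a * (norm (y::'a))\<^sup>2)) \<partial>lborel) = 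
    (\<integral>\<^sup>+y. ennreal (exp (- a * (norm (z - y))\<^sup>2)) \<partial>lborel)"
    by (subst nn_integral_lborel_affine[where c="-1" and t=z]) auto
  then show n': "(\<integral>\<^sup>+y. ennreal (exp (- a * (norm (z - y))\<^sup>2)) \<partial>lborel) = ennreal ((pi / a) powr (DIM('a) / 2))"
    using n by simp
  show "integrable lborel (\<lambda>y::'a. exp (- a * (norm (z - y))\<^sup>2))"
    by (intro integrableI_bounded) (auto simp: n'[simplified])
qed

subsection \<open>One half of Plancherel's identity\<close>

text \<open>Every integral over a radius, a scale or a level is reduced to this one after replacing
  Gaussian factors by a minimum. \<open>0 < a\<close> gives convergence at 0 and
  \<open>a < d\<close> at infinity; the power \<open>a / d\<close> of \<open>X\<close> is what
  scaling dictates.\<close>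

lemma nn_integral_powr_min:
  fixes a d X :: real
  assumes a: "0 < a" "a < d" and X: "0 \<le> X"
  shows "(\<integral>\<^sup>+l. ennreal (l powr (a - 1) * min 1 (X * l powr (- d))) * indicator {0<..} l \<partial>lborel)
    \<le> ennreal (X powr (a / d) * (1 / a + 1 / (d - a)))"
proof (cases "X = 0")
  case True
  then show ?thesis by simp
next
  case False
  \<comment> \<open>The crossing point, where \<open>X * l powr (- d) = 1\<close>; below it the
    minimum is bounded by 1, above it by the power.\<close>
  define T where "T = X powr (1 / d)"
  have T: "T > 0" using False X by (simp add: T_def)
  have "(\<integral>\<^sup>+l. ennreal (l powr (a - 1) * min 1 (X * l powr (- d))) * indicator {0<..} l \<partial>lborel)
    \<le> (\<integral>\<^sup>+l. ennreal (indicator {0..T} l * l powr (a - 1)) + ennreal X * ennreal (indicator {T..} l * l powr (a - 1 - d)) \<partial>lborel)"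
  proof (rule nn_integral_mono)
    fix l :: real
    show "ennreal (l powr (a - 1) * min 1 (X * l powr (- d))) * indicator {0<..} l
     \<le> ennreal (indicator {0..T} l * l powr (a - 1)) + ennreal X * ennreal (indicator {T..} l * l powr (a - 1 - d))"
    proof (cases "l \<le> 0")
      case l: False
      show ?thesis
      proof (cases "l \<le> T")
        case True
        have "ennreal (l powr (a - 1) * min 1 (X * l powr (- d))) \<le> ennreal (l powr (a - 1))"
          by (intro ennreal_leI) (simp add: mult_left_le)
        then show ?thesis using True l by (auto simp: indicator_def intro: add_increasing2)
      next
        case F: False
        have "l powr (a - 1) * min 1 (X * l powr (- d)) \<le> l powr (a-1) * (X * l powr (-d))"
          by (intro mult_left_mono) auto
        also have "... = X * l powr (a - 1 - d)"
          using l by (simp add: diff_conv_add_uminus powr_add mult_ac del: add_uminus_conv_diff)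
        finally have "ennreal (l powr (a - 1) * min 1 (X * l powr (- d))) \<le> ennreal (X * l powr (a - 1 - d))"
          by (rule ennreal_leI)
        then show ?thesis using F l X by (auto simp: indicator_def ennreal_mult)
      qed
    qed auto
  qed
  also have "... = (\<integral>\<^sup>+l. ennreal (indicator {0..T} l * l powr (a - 1)) \<partial>lborel) + ennreal X * (\<integral>\<^sup>+l. ennreal (indicator {T..} l * l powr (a - 1 - d)) \<partial>lborel)"
    by (subst nn_integral_add) (auto simp: nn_integral_cmult)
  also have "(\<integral>\<^sup>+l. ennreal (indicator {0..T} l * l powr (a - 1)) \<partial>lborel) = ennreal (T powr a / a)"
    using has_integral_powr_from_0[of "a - 1" T] a T
    by (intro nn_integral_has_integral_lebesgue) auto
  also have "(\<integral>\<^sup>+l. ennreal (indicator {T..} l * l powr (a - 1 - d)) \<partial>lborel) = ennreal (T powr (a - d) / (d - a))"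
  proof (intro nn_integral_has_integral_lebesgue)
    have "((\<lambda>x. x powr (a - 1 - d)) has_integral - (T powr (a - 1 - d + 1)) / (a - 1 - d + 1)) {T..}"
      using a T by (intro has_integral_powr_to_inf) auto
    moreover have "a - 1 - d + 1 = a - d" by simp
    moreover have "- (T powr (a - d)) / (a - d) = T powr (a - d) / (d - a)"
      using a by (simp add: field_simps)
    ultimately show "((\<lambda>x. x powr (a - 1 - d)) has_integral T powr (a - d) / (d - a)) {T..}"
      by (simp only:)
  qed auto
  also have "ennreal (T powr a / a) + ennreal X * ennreal (T powr (a - d) / (d - a)) = 
     ennreal (T powr a / a + X * (T powr (a - d) / (d - a)))"
    using a X by (simp add: ennreal_mult[symmetric] ennreal_plus[symmetric] del: ennreal_plus)
  also have "T powr a / a + X * (T powr (a - d) / (d - a)) = X powr (a / d) * (1 / a + 1 / (d - a))"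
  proof -
    have "X * T powr (a - d) = X powr (a / d)"
    proof -
      have "X * X powr ((a - d) / d) = X powr (1 + (a - d) / d)" using False X by (simp add: powr_add)
      also have "1 + (a - d) / d = a / d" using a by (simp add: field_simps)
      finally show ?thesis by (simp add: T_def powr_powr)
    qed
    then show ?thesis using a by (simp add: T_def powr_powr field_simps)
  qed
  finally show ?thesis .
qed

text \<open>One power of \<open>x\<close> is kept. With \<open>x = R^2 * |\<xi>|^2\<close> this
  suffices for integrals in R against exponents below 2.\<close>

lemma one_minus_exp_sq_le: 
  fixes x :: real
  assumes "0 \<le> x"
  shows "(1 - exp (- x))\<^sup>2 \<le> min 1 x"
proof -
  have 1: "0 \<le> 1 - exp (-x)" "1 - exp (-x) \<le> 1" using assms by auto
  have "(1 - exp (-x))\<^sup>2 \<le> 1 - exp (-x)" using 1 by (simp add: power2_eq_square mult_left_le_one_le)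
  also have "1 - exp (-x) \<le> x" using exp_ge_add_one_self[of "-x"] by simp
  finally have "(1 - exp (-x))\<^sup>2 \<le> x" .
  moreover have "(1 - exp (-x))\<^sup>2 \<le> 1" using 1 by (simp add: power_le_one)
  ultimately show ?thesis by simp
qed

lemma exp_neg_le_inverse:
  fixes x :: real
  assumes "0 < x"
  shows "exp (- x) \<le> min 1 (1 / x)"
proof -
  have "x \<le> exp x" using exp_ge_add_one_self[of x] by linarith
  then show ?thesis using assms by (simp add: exp_minus field_simps)
qed

section \<open>The inverse Fourier integral\<close>

lemma measurable_cis [measurable]: "cis \<in> borel_measurable borel"
  by (intro borel_measurable_continuous_onI continuous_intros)

lemma measurable_cnj [measurable]: "cnj \<in> borel_measurable borel"
  by (intro borel_measurable_continuous_onI continuous_intros)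

lemma integrable_pair_mult:
  fixes f :: "'a \<Rightarrow> 'c::{banach, second_countable_topology, real_normed_field}" and g :: "'b \<Rightarrow> 'c"
  assumes "sigma_finite_measure M" "sigma_finite_measure N" "integrable M f" "integrable N g"
  shows "integrable (M \<Otimes>\<^sub>M N) (\<lambda>p. f (fst p) * g (snd p))"
proof -
  interpret M: sigma_finite_measure M by fact
  interpret N: sigma_finite_measure N by fact
  interpret P: pair_sigma_finite M N ..
  have [measurable]: "f \<in> borel_measurable M" "g \<in> borel_measurable N" using assms by auto
  show ?thesis
    by (rule P.Fubini_integrable)
       (auto simp: norm_mult intro!: integrable_mult_right integrable_mult_left assms integrable_norm)
qed

text \<open>The counterpart of \<open>fourier_integral\<close> with the opposite sign and the same
  unitary factor, over \<open>lborel\<close> so that product measures apply. For a non-integrable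
  \<open>H\<close> the integral has the default value 0, hence the integrability assumptions in the
  estimates.\<close>

definition inv_fourier :: "('a::euclidean_space \<Rightarrow> complex) \<Rightarrow> 'a \<Rightarrow> complex" where
  "inv_fourier H x = (2 * pi) powr (- real DIM('a) / 2) *\<^sub>R (\<integral>\<xi>. cis (x \<bullet> \<xi>) * H \<xi> \<partial>lborel)"

lemma integrable_cis_mult:
  assumes "integrable lborel (H :: 'a::euclidean_space \<Rightarrow> complex)"
  shows "integrable lborel (\<lambda>\<xi>. cis (x \<bullet> \<xi>) * H \<xi>)"
proof -
  have [measurable]: "H \<in> borel_measurable borel" using assms by auto
  show ?thesis by (rule Bochner_Integration.integrable_bound[OF assms]) (auto simp: norm_mult)
qed

lemma borel_measurable_inv_fourier [measurable]:
  assumes [measurable]: "H \<in> borel_measurable borel"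
  shows "inv_fourier H \<in> borel_measurable borel"
  unfolding inv_fourier_def by measurable

lemma inv_fourier_diff:
  assumes "integrable lborel H" "integrable lborel G"
  shows "inv_fourier (\<lambda>\<xi>. H \<xi> - G \<xi>) x = inv_fourier H x - inv_fourier G x"
  using integrable_cis_mult[OF assms(1), of x] integrable_cis_mult[OF assms(2), of x]
  by (simp add: inv_fourier_def right_diff_distrib scaleR_diff_right)

lemma norm_inv_fourier_le:
  fixes H :: "'a::euclidean_space \<Rightarrow> complex"
  assumes "integrable lborel H"
  shows "norm (inv_fourier H x) \<le> (2 * pi) powr (- real DIM('a) / 2) * (\<integral>\<xi>. norm (H \<xi>) \<partial>lborel)"
proof -
  have "norm (\<integral>\<xi>. cis (x \<bullet> \<xi>) * H \<xi> \<partial>lborel) \<le> (\<integral>\<xi>. norm (cis (x \<bullet> \<xi>) * H \<xi>) \<partial>lborel)"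
    by (rule integral_norm_bound)
  then show ?thesis by (simp add: inv_fourier_def norm_mult mult_left_mono)
qed

text \<open>Opening the square and integrating out \<open>x\<close> gives the double integral of \<open>H(\<xi>) H(\<eta>)\<^sup>*\<close>
  against a Gaussian in \<open>\<xi> - \<eta>\<close>; AM-GM on \<open>|H(\<xi>)| |H(\<eta>)|\<close> decouples the two variables.\<close>

lemma plancherel_gaussian:
  fixes H :: "'a::euclidean_space \<Rightarrow> complex"
  assumes H: "integrable lborel H" and d: "d > 0"
  shows "(\<integral>\<^sup>+x. ennreal ((norm (inv_fourier H x))\<^sup>2 * exp (- d * (norm x)\<^sup>2)) \<partial>lborel)
     \<le> (\<integral>\<^sup>+\<xi>. ennreal ((norm (H \<xi>))\<^sup>2) \<partial>lborel)"
proof -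
  interpret P3: pair_sigma_finite "lborel :: 'a measure" "lborel \<Otimes>\<^sub>M lborel :: ('a \<times> 'a) measure" ..
  let ?P = "lborel \<Otimes>\<^sub>M lborel :: ('a \<times> 'a) measure"
  have [measurable]: "H \<in> borel_measurable borel" using H by auto
  define c where "c = (2 * pi) powr (- real DIM('a) / 2)"
  define f where "f p = H (fst p) * cnj (H (snd p))" for p
  define I where "I x = (\<integral>\<xi>. cis (x \<bullet> \<xi>) * H \<xi> \<partial>lborel)" for x
  have [measurable]: "f \<in> borel_measurable ?P" unfolding f_def by measurable
  have [measurable]: "I \<in> borel_measurable borel" unfolding I_def by measurable
  let ?H2 = "\<integral>\<^sup>+\<xi>. ennreal ((norm (H \<xi>))\<^sup>2) \<partial>lborel"
  let ?I2 = "\<lambda>x. (norm (I x))\<^sup>2 * exp (- d * (norm x)\<^sup>2)"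
  have cH: "integrable lborel (\<lambda>y. cnj (H y))" using H by simp
  have fi: "integrable ?P f"
    unfolding f_def by (intro integrable_pair_mult H cH sigma_finite_lborel)
  have gi: "integrable lborel (\<lambda>x::'a. exp (- d * (norm x)\<^sup>2))"
    using gaussian_integral(1)[OF d, of "0::'a"] by simp
  have gi': "integrable lborel (\<lambda>x::'a. complex_of_real (exp (- d * (norm x)\<^sup>2)))"
    using gi by (rule integrable_of_real)
  define K where "K x p = complex_of_real (exp (- d * (norm x)\<^sup>2)) * f p * cis (x \<bullet> (fst p - snd p))" for x p
  \<comment> \<open>The Gaussian in \<open>x\<close> makes the triple integral absolutely
    convergent; this is what permits exchanging the order of integration.\<close>
  have Ki: "integrable (lborel \<Otimes>\<^sub>M ?P) (\<lambda>(x, p). K x p)"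
  proof (rule Bochner_Integration.integrable_bound[OF integrable_pair_mult[OF sigma_finite_lborel lborel_pair.P.sigma_finite_measure_axioms gi' fi]])
    show "(\<lambda>(x, p). K x p) \<in> borel_measurable (lborel \<Otimes>\<^sub>M ?P)"
      unfolding K_def by measurable
  qed (auto simp: K_def norm_mult)
  have II: "(\<integral>p. f p * cis (x \<bullet> (fst p - snd p)) \<partial>?P) = I x * cnj (I x)" for x
  proof -
    have i1: "integrable lborel (\<lambda>\<xi>. cis (x \<bullet> \<xi>) * H \<xi>)" using integrable_cis_mult[OF H] .
    have i2: "integrable lborel (\<lambda>\<xi>. cnj (cis (x \<bullet> \<xi>) * H \<xi>))" using i1 by (subst complex_integrable_cnj)
    have "(\<integral>p. f p * cis (x \<bullet> (fst p - snd p)) \<partial>?P) = 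
       (\<integral>p. (cis (x \<bullet> fst p) * H (fst p)) * cnj (cis (x \<bullet> snd p) * H (snd p)) \<partial>?P)"
    proof (rule Bochner_Integration.integral_cong[OF refl])
      fix p :: "'a \<times> 'a"
      have "cis (x \<bullet> (fst p - snd p)) = cis (x \<bullet> fst p) * cnj (cis (x \<bullet> snd p))"
        by (simp add: inner_diff_right cis_cnj cis_mult)
      then show "f p * cis (x \<bullet> (fst p - snd p)) = (cis (x \<bullet> fst p) * H (fst p)) * cnj (cis (x \<bullet> snd p) * H (snd p))"
        by (simp add: f_def)
    qed
    also have "... = (\<integral>\<xi>. (\<integral>\<eta>. (cis (x \<bullet> \<xi>) * H \<xi>) * cnj (cis (x \<bullet> \<eta>) * H \<eta>) \<partial>lborel) \<partial>lborel)"
      using lborel_pair.integral_fst'[OF integrable_pair_mult[OF sigma_finite_lborel sigma_finite_lborel i1 i2]] by simp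
    also have "... = I x * cnj (I x)"
      unfolding I_def using i1 i2 by (simp add: Bochner_Integration.integral_cnj[symmetric] del: Bochner_Integration.integral_cnj complex_cnj_mult)
    finally show ?thesis .
  qed
  have Ke: "(\<integral>x. K x p \<partial>lborel) = f p * complex_of_real ((pi / d) powr (DIM('a) / 2) * exp (- (norm (fst p - snd p))\<^sup>2 / (4 * d)))" for p
  proof -
    have "(\<integral>x. K x p \<partial>lborel) = f p * (\<integral>x. cis ((fst p - snd p) \<bullet> x) * complex_of_real (exp (- d * (norm x)\<^sup>2)) \<partial>lborel)"
      unfolding K_def by (subst integral_mult_right_zero[symmetric]) (simp add: mult_ac inner_commute)
    then show ?thesis using gaussian_fourier(2)[OF d, of "fst p - snd p"] by simp
  qed
  define M where "M = (pi / d) powr (DIM('a) / 2)"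
  let ?g = "\<lambda>(p::'a \<times> 'a). ennreal (M * exp (- (1 / (4 * d)) * (norm (fst p - snd p))\<^sup>2))"
  let ?E = "\<lambda>(\<xi>::'a) \<eta>. ennreal (exp (- (1 / (4 * d)) * (norm (\<xi> - \<eta>))\<^sup>2))"
  let ?h = "\<lambda>\<xi>. ennreal ((norm (H \<xi>))\<^sup>2 / 2)"
  have Ii: "integrable lborel (\<lambda>x. ?I2 x)"
  proof (rule Bochner_Integration.integrable_bound[OF integrable_mult_right[OF gi, of "(\<integral>\<xi>. norm (H \<xi>) \<partial>lborel)\<^sup>2"]])
    have "norm (I x) \<le> (\<integral>\<xi>. norm (H \<xi>) \<partial>lborel)" for x
      using integral_norm_bound[of lborel "\<lambda>\<xi>. cis (x \<bullet> \<xi>) * H \<xi>"] by (simp add: I_def norm_mult)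
    then show "AE x in lborel. norm (?I2 x) \<le> norm ((\<integral>\<xi>. norm (H \<xi>) \<partial>lborel)\<^sup>2 * exp (- d * (norm x)\<^sup>2))"
      by (auto intro!: mult_right_mono power_mono)
  qed auto
  have "complex_of_real (\<integral>x. ?I2 x \<partial>lborel)
     = (\<integral>x. complex_of_real (exp (- d * (norm x)\<^sup>2)) * (I x * cnj (I x)) \<partial>lborel)"
    by (subst integral_complex_of_real[symmetric]) (simp only: of_real_mult complex_norm_square mult_ac)
  also have "... = (\<integral>x. (\<integral>p. K x p \<partial>?P) \<partial>lborel)"
    by (simp add: II[symmetric] K_def mult.assoc)
  also have "... = (\<integral>p. (\<integral>x. K x p \<partial>lborel) \<partial>?P)"
    using P3.Fubini_integral[OF Ki] by simp
  also have "... = (\<integral>p. f p * complex_of_real (M * exp (- (norm (fst p - snd p))\<^sup>2 / (4 * d))) \<partial>?P)"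
    by (simp only: Ke M_def)
  finally have 1: "complex_of_real (\<integral>x. ?I2 x \<partial>lborel) = ..." .
  have dbl: "(\<integral>\<^sup>+\<xi>. (\<integral>\<^sup>+\<eta>. ennreal M * ?E \<xi> \<eta> * ?h \<xi> \<partial>lborel) \<partial>lborel)
     = ennreal (M * (4 * d * pi) powr (DIM('a) / 2) / 2) * ?H2"
  proof -
    have "(\<integral>\<^sup>+\<eta>. ennreal M * ?E \<xi> \<eta> * ?h \<xi> \<partial>lborel)
        = ennreal (M * (4 * d * pi) powr (DIM('a) / 2) / 2) * ennreal ((norm (H \<xi>))\<^sup>2)" for \<xi>
    proof -
      have "(\<integral>\<^sup>+\<eta>. ennreal M * ?E \<xi> \<eta> * ?h \<xi> \<partial>lborel)
         = ennreal M * (\<integral>\<^sup>+\<eta>. ?E \<xi> \<eta> \<partial>lborel) * ?h \<xi>"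
        by (subst nn_integral_multc, simp, subst nn_integral_cmult) auto
      also have "(\<integral>\<^sup>+\<eta>. ?E \<xi> \<eta> \<partial>lborel) = ennreal ((4 * d * pi) powr (DIM('a) / 2))"
        using d by (subst gaussian_integral(2)) (auto simp: mult_ac)
      finally show ?thesis by (simp add: M_def mult_ac flip: ennreal_mult)
    qed
    then show ?thesis by (simp only:) (simp add: nn_integral_cmult)
  qed
  have "ennreal (\<integral>x. ?I2 x \<partial>lborel) = 
     ennreal (norm (complex_of_real (\<integral>x. ?I2 x \<partial>lborel)))"
    by (simp add: integral_nonneg_AE)
  \<comment> \<open>From here the phase of \<open>f\<close> is discarded, since only an upper bound
    is wanted.\<close>
  also have "... \<le> (\<integral>\<^sup>+p. ennreal (norm (f p * complex_of_real (M * exp (- (norm (fst p - snd p))\<^sup>2 / (4 * d))))) \<partial>?P)"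
    unfolding 1 using d
    by (intro integral_norm_bound_ennreal Bochner_Integration.integrable_bound[OF integrable_mult_left[OF fi, of "complex_of_real M"]] AE_I2)
       (auto simp: norm_mult M_def abs_mult intro!: mult_left_le mult_left_mono)
  also have "... \<le> (\<integral>\<^sup>+p. ?g p * ennreal ((norm (H (fst p)))\<^sup>2 / 2) +
      ?g p * ennreal ((norm (H (snd p)))\<^sup>2 / 2) \<partial>?P)"
  proof (rule nn_integral_mono)
    fix p :: "'a \<times> 'a"
    have M: "M \<ge> 0" by (simp add: M_def)
    have "norm (f p) \<le> (norm (H (fst p)))\<^sup>2 / 2 + (norm (H (snd p)))\<^sup>2 / 2"
      using sum_squares_bound[of "norm (H (fst p))" "norm (H (snd p))"] by (simp add: f_def norm_mult)
    then have "norm (f p * complex_of_real (M * exp (- (norm (fst p - snd p))\<^sup>2 / (4 * d)))) \<le> 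
      (M * exp (- (1 / (4 * d)) * (norm (fst p - snd p))\<^sup>2)) * ((norm (H (fst p)))\<^sup>2 / 2 + (norm (H (snd p)))\<^sup>2 / 2)"
      using M by (subst mult.commute) (auto simp: norm_mult abs_mult intro!: mult_mono)
    then show "ennreal (norm (f p * complex_of_real (M * exp (- (norm (fst p - snd p))\<^sup>2 / (4 * d))))) \<le> 
      ?g p * ennreal ((norm (H (fst p)))\<^sup>2 / 2) +
      ?g p * ennreal ((norm (H (snd p)))\<^sup>2 / 2)"
      using M by (simp add: ennreal_mult[symmetric] ennreal_plus[symmetric] distrib_left ennreal_leI del: ennreal_plus)
  qed
  also have "... = (\<integral>\<^sup>+p. ?g p * ennreal ((norm (H (fst p)))\<^sup>2 / 2) \<partial>?P) +
      (\<integral>\<^sup>+p. ?g p * ennreal ((norm (H (snd p)))\<^sup>2 / 2) \<partial>?P)"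
    by (intro nn_integral_add) measurable
  also have "(\<integral>\<^sup>+p. ?g p * ennreal ((norm (H (fst p)))\<^sup>2 / 2) \<partial>?P)
     = (\<integral>\<^sup>+\<xi>. (\<integral>\<^sup>+\<eta>. ennreal M * ?E \<xi> \<eta> * ?h \<xi> \<partial>lborel) \<partial>lborel)"
    by (subst lborel.nn_integral_fst[symmetric]) (simp_all add: ennreal_mult M_def)
  also have "... = ennreal (M * (4 * d * pi) powr (DIM('a) / 2) / 2) * ?H2"
    by (rule dbl)
  also have "(\<integral>\<^sup>+p. ?g p * ennreal ((norm (H (snd p)))\<^sup>2 / 2) \<partial>?P)
     = (\<integral>\<^sup>+\<xi>. (\<integral>\<^sup>+\<eta>. ennreal M * ?E \<xi> \<eta> * ?h \<xi> \<partial>lborel) \<partial>lborel)"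
    by (subst lborel_pair.nn_integral_snd[symmetric]) (simp_all add: ennreal_mult M_def norm_minus_commute)
  also have "... = ennreal (M * (4 * d * pi) powr (DIM('a) / 2) / 2) * ?H2"
    by (rule dbl)
  also have "ennreal (M * (4 * d * pi) powr (DIM('a) / 2) / 2) * ?H2 +
     ennreal (M * (4 * d * pi) powr (DIM('a) / 2) / 2) * ?H2
     = ennreal (M * (4 * d * pi) powr (DIM('a) / 2)) * ?H2"
    by (subst distrib_right[symmetric], subst ennreal_plus[symmetric]) (auto simp: M_def)
  \<comment> \<open>The parameter \<open>d\<close> cancels between the transform of the Gaussian and
    the mass of the kernel. What remains is the inverse of the squared normalisation
    \<open>c\<close>, so the final constant is 1 for every \<open>d\<close>.\<close>
  also have "M * (4 * d * pi) powr (DIM('a) / 2) = (2 * pi) powr DIM('a)"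
  proof -
    have "M * (4 * d * pi) powr (DIM('a) / 2) = ((pi / d) * (4 * d * pi)) powr (DIM('a) / 2)"
      using d unfolding M_def by (intro powr_mult[symmetric])
    also have "(pi / d) * (4 * d * pi) = (2 * pi) powr 2" using d by (simp add: power2_eq_square field_simps)
    finally have "M * (4 * d * pi) powr (DIM('a) / 2) = ((2 * pi) powr 2) powr (DIM('a) / 2)" .
    moreover have "2 * (real DIM('a) / 2) = real DIM('a)" by simp
    ultimately show ?thesis by (simp only: powr_powr)
  qed
  finally have 2: "ennreal (\<integral>x. ?I2 x \<partial>lborel) \<le> 
      ennreal ((2 * pi) powr DIM('a)) * ?H2" .
  have "c\<^sup>2 = (2 * pi) powr (- real DIM('a))"
    unfolding c_def power2_eq_square by (simp flip: powr_add)
  then have cc: "ennreal (c\<^sup>2) * ennreal ((2 * pi) powr DIM('a)) = 1"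
    by (simp flip: ennreal_mult powr_add)
  have "(\<integral>\<^sup>+x. ennreal ((norm (inv_fourier H x))\<^sup>2 * exp (- d * (norm x)\<^sup>2)) \<partial>lborel) =
     ennreal (c\<^sup>2) * (\<integral>\<^sup>+x. ennreal (?I2 x) \<partial>lborel)"
    unfolding inv_fourier_def I_def[symmetric] c_def[symmetric]
    by (subst nn_integral_cmult[symmetric]) (auto simp: power_mult_distrib mult_ac simp flip: ennreal_mult)
  also have "... = ennreal (c\<^sup>2) * ennreal (\<integral>x. ?I2 x \<partial>lborel)"
    by (subst nn_integral_eq_integral[OF Ii]) auto
  also have "... \<le> ennreal (c\<^sup>2) * (ennreal ((2 * pi) powr DIM('a)) * ?H2)"
    by (intro mult_left_mono 2) simp
  also have "... = ?H2"
    by (simp add: mult.assoc[symmetric] cc)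
  finally show ?thesis .
qed

text \<open>The Gaussian weight tends to 1 as its parameter tends to 0 and the bound does not depend
  on the parameter, so Fatou's lemma removes the weight.\<close>

lemma plancherel_le:
  fixes H :: "'a::euclidean_space \<Rightarrow> complex"
  assumes H: "integrable lborel H"
  shows "(\<integral>\<^sup>+x. ennreal ((norm (inv_fourier H x))\<^sup>2) \<partial>lborel) \<le> (\<integral>\<^sup>+\<xi>. ennreal ((norm (H \<xi>))\<^sup>2) \<partial>lborel)"
proof -
  have [measurable]: "H \<in> borel_measurable borel" using H by auto
  let ?f = "\<lambda>k x. ennreal ((norm (inv_fourier H x))\<^sup>2 * exp (- (1 / real (Suc k)) * (norm x)\<^sup>2))"
  have lim: "(\<lambda>k. ?f k x) \<longlonglongrightarrow> ennreal ((norm (inv_fourier H x))\<^sup>2)" for x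
  proof -
    have "(\<lambda>k. (norm (inv_fourier H x))\<^sup>2 * exp (- (1 / real (Suc k)) * (norm x)\<^sup>2)) \<longlonglongrightarrow> (norm (inv_fourier H x))\<^sup>2 * exp (- 0 * (norm x)\<^sup>2)"
      by (intro tendsto_intros LIMSEQ_Suc[OF lim_1_over_n])
    then show ?thesis by simp
  qed
  have "(\<integral>\<^sup>+x. ennreal ((norm (inv_fourier H x))\<^sup>2) \<partial>lborel) = (\<integral>\<^sup>+x. liminf (\<lambda>k. ?f k x) \<partial>lborel)"
    by (intro nn_integral_cong lim_imp_Liminf[symmetric] lim) simp
  also have "... \<le> liminf (\<lambda>k. \<integral>\<^sup>+x. ?f k x \<partial>lborel)"
    by (intro nn_integral_liminf) simp
  also have "... \<le> liminf (\<lambda>k. (\<integral>\<^sup>+\<xi>. ennreal ((norm (H \<xi>))\<^sup>2) \<partial>lborel))"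
    by (intro Liminf_mono always_eventually allI plancherel_gaussian H) simp
  also have "... = (\<integral>\<^sup>+\<xi>. ennreal ((norm (H \<xi>))\<^sup>2) \<partial>lborel)"
    by (simp add: Liminf_const)
  finally show ?thesis .
qed

subsection \<open>The Hardy inequality\<close>

text \<open>An inequality only because of the origin: \<open>0 powr (- a) = 0\<close>, while the
  right side is infinite at \<open>r = 0\<close>. For positive \<open>r\<close> the two sides
  agree.\<close>

lemma powr_neg_layer_cake:
  fixes r a :: real
  assumes a: "0 < a" and r: "0 \<le> r"
  shows "ennreal (r powr (- a)) \<le> ennreal a * (\<integral>\<^sup>+R. (if 0 < R \<and> r \<le> R then ennreal (R powr (- a - 1)) else 0) \<partial>lborel)"
proof (cases "r = 0")
  case False
  then have r: "r > 0" using r by simp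
  have "((\<lambda>x. x powr (- a - 1)) has_integral - (r powr (- a - 1 + 1)) / (- a - 1 + 1)) {r..}"
    using a r by (intro has_integral_powr_to_inf) auto
  then have "((\<lambda>x. x powr (- a - 1)) has_integral r powr (- a) / a) {r..}" by simp
  then have "(\<integral>\<^sup>+R. ennreal (indicator {r..} R * R powr (- a - 1)) \<partial>lborel) = ennreal (r powr (- a) / a)"
    by (intro nn_integral_has_integral_lebesgue) auto
  also have "(\<integral>\<^sup>+R. ennreal (indicator {r..} R * R powr (- a - 1)) \<partial>lborel) = 
     (\<integral>\<^sup>+R. (if 0 < R \<and> r \<le> R then ennreal (R powr (- a - 1)) else 0) \<partial>lborel)"
    using r by (intro nn_integral_cong) auto
  finally show ?thesis using a by (simp add: ennreal_mult[symmetric])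
qed simp

lemma powr_layer_cake:
  fixes x q :: real
  assumes q: "0 < q" and x: "0 \<le> x"
  shows "ennreal (x powr q) = ennreal q * (\<integral>\<^sup>+l. (if 0 < l \<and> l \<le> x then ennreal (l powr (q - 1)) else 0) \<partial>lborel)"
proof -
  have "((\<lambda>l. l powr (q - 1)) has_integral x powr q / q) {0..x}"
    using has_integral_powr_from_0[of "q - 1" x] q x by simp
  then have "(\<integral>\<^sup>+l. ennreal (indicator {0..x} l * l powr (q - 1)) \<partial>lborel) = ennreal (x powr q / q)"
    by (intro nn_integral_has_integral_lebesgue) auto
  also have "(\<integral>\<^sup>+l. ennreal (indicator {0..x} l * l powr (q - 1)) \<partial>lborel) = 
     (\<integral>\<^sup>+l. (if 0 < l \<and> l \<le> x then ennreal (l powr (q - 1)) else 0) \<partial>lborel)"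
    by (intro nn_integral_cong) (auto simp: indicator_def)
  finally show ?thesis using q by (simp add: ennreal_mult[symmetric])
qed

section \<open>The low-frequency part\<close>

text \<open>A layer cake over balls replaces polar coordinates: inside the ball of radius R the
  Gaussian has mass at most the volume of the ball and at most its total mass, and the minimum of
  the two is integrated over R.\<close>

lemma nn_integral_riesz_gaussian:
  fixes b :: real
  assumes b: "0 < b" "b < real DIM('a::euclidean_space)"
  obtains K where "0 < K"
    "\<And>t. 0 < t \<Longrightarrow> (\<integral>\<^sup>+(\<xi>::'a). ennreal (norm \<xi> powr (- b) * exp (- t * (norm \<xi>)\<^sup>2)) \<partial>lborel)
       \<le> ennreal (K * t powr (- (real DIM('a) - b) / 2))"
proof -
  define N where "N = real DIM('a)"
  define V where "V = unit_ball_vol N"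
  have V: "V > 0" by (simp add: V_def N_def)
  define c where "c = 1 / (N - b) + 1 / (N - (N - b))"
  have bN: "0 < N - b" "N - b < N" "0 < N" using b by (auto simp: N_def)
  have c: "c > 0" using bN b by (simp add: c_def add_pos_pos)
  define K where "K = b * V * (pi powr (N / 2) / V) powr ((N - b) / N) * c"
  have K: "K > 0" using b V c by (simp add: K_def)
  moreover have "(\<integral>\<^sup>+(\<xi>::'a). ennreal (norm \<xi> powr (- b) * exp (- t * (norm \<xi>)\<^sup>2)) \<partial>lborel)
       \<le> ennreal (K * t powr (- (N - b) / 2))" if t: "0 < t" for t
  proof -
    \<comment> \<open>The total Gaussian mass divided by the volume of the unit ball, so that the
      smaller of mass and volume is \<open>V * R powr N * min 1 (Z * R powr (- N))\<close>.\<close>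
    define Z where "Z = (pi / t) powr (N / 2) / V"
    have Z: "Z > 0" using t V by (simp add: Z_def)
    let ?S = "\<lambda>R (\<xi>::'a). if 0 < R \<and> norm \<xi> \<le> R then ennreal (R powr (- b - 1)) * ennreal (exp (- t * (norm \<xi>)\<^sup>2)) else 0"
    have "(\<integral>\<^sup>+(\<xi>::'a). ennreal (norm \<xi> powr (- b) * exp (- t * (norm \<xi>)\<^sup>2)) \<partial>lborel) \<le>
      (\<integral>\<^sup>+(\<xi>::'a). ennreal b * (\<integral>\<^sup>+R. ?S R \<xi> \<partial>lborel) \<partial>lborel)"
    proof (rule nn_integral_mono)
      fix \<xi> :: 'a
      have "ennreal (norm \<xi> powr (- b) * exp (- t * (norm \<xi>)\<^sup>2)) \<le> 
        (ennreal b * (\<integral>\<^sup>+R. (if 0 < R \<and> norm \<xi> \<le> R then ennreal (R powr (- b - 1)) else 0) \<partial>lborel)) * ennreal (exp (- t * (norm \<xi>)\<^sup>2))"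
        unfolding ennreal_mult''[OF exp_ge_zero]
        by (intro mult_right_mono powr_neg_layer_cake b) auto
      also have "... = ennreal b * (\<integral>\<^sup>+R. (if 0 < R \<and> norm \<xi> \<le> R then ennreal (R powr (- b - 1)) else 0) * ennreal (exp (- t * (norm \<xi>)\<^sup>2)) \<partial>lborel)"
        by (subst nn_integral_multc) (auto simp: mult.assoc)
      also have "... = ennreal b * (\<integral>\<^sup>+R. ?S R \<xi> \<partial>lborel)"
        by (intro arg_cong2[where f="(*)"] nn_integral_cong) auto
      finally show "ennreal (norm \<xi> powr (- b) * exp (- t * (norm \<xi>)\<^sup>2)) \<le> ..." .
    qed
    also have "... = ennreal b * (\<integral>\<^sup>+(\<xi>::'a). (\<integral>\<^sup>+R. ?S R \<xi> \<partial>lborel) \<partial>lborel)"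
      by (rule nn_integral_cmult) measurable
    also have "... = ennreal b * (\<integral>\<^sup>+R. (\<integral>\<^sup>+(\<xi>::'a). ?S R \<xi> \<partial>lborel) \<partial>lborel)"
      by (intro arg_cong2[where f="(*)"] refl lborel_pair.Fubini'[symmetric]) measurable
    also have "... \<le> ennreal b * (\<integral>\<^sup>+R. ennreal V * (ennreal (R powr (N - b - 1) * min 1 (Z * R powr (- N))) * indicator {0<..} R) \<partial>lborel)"
    proof (intro mult_left_mono nn_integral_mono)
      fix R :: real
      show "(\<integral>\<^sup>+(\<xi>::'a). ?S R \<xi> \<partial>lborel)
         \<le> ennreal V * (ennreal (R powr (N - b - 1) * min 1 (Z * R powr (- N))) * indicator {0<..} R)"
      proof (cases "0 < R")
        case R: True
        have "(\<integral>\<^sup>+(\<xi>::'a). ?S R \<xi> \<partial>lborel)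
          = (\<integral>\<^sup>+(\<xi>::'a). ennreal (R powr (- b - 1)) * (ennreal (exp (- t * (norm \<xi>)\<^sup>2)) * indicator (cball 0 R) \<xi>) \<partial>lborel)"
          using R by (intro nn_integral_cong) (auto simp: indicator_def)
        also have "... = ennreal (R powr (- b - 1)) * (\<integral>\<^sup>+(\<xi>::'a). ennreal (exp (- t * (norm \<xi>)\<^sup>2)) * indicator (cball 0 R) \<xi> \<partial>lborel)"
          by (rule nn_integral_cmult) (auto intro!: borel_measurable_times_ennreal borel_measurable_indicator borel_closed)
        also have "(\<integral>\<^sup>+(\<xi>::'a). ennreal (exp (- t * (norm \<xi>)\<^sup>2)) * indicator (cball 0 R) \<xi> \<partial>lborel) \<le> ennreal (V * R powr N * min 1 (Z * R powr (- N)))"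
        proof -
          have "(\<integral>\<^sup>+(\<xi>::'a). ennreal (exp (- t * (norm \<xi>)\<^sup>2)) * indicator (cball 0 R) \<xi> \<partial>lborel) \<le> 
             (\<integral>\<^sup>+(\<xi>::'a). indicator (cball 0 R) \<xi> \<partial>lborel)"
            using t by (intro nn_integral_mono) (auto simp: indicator_def)
          also have "... = ennreal (V * R powr N)"
            using R by (simp add: emeasure_cball V_def N_def powr_realpow)
          finally have 1: "(\<integral>\<^sup>+(\<xi>::'a). ennreal (exp (- t * (norm \<xi>)\<^sup>2)) * indicator (cball 0 R) \<xi> \<partial>lborel) \<le> ennreal (V * R powr N)" .
          have "(\<integral>\<^sup>+(\<xi>::'a). ennreal (exp (- t * (norm \<xi>)\<^sup>2)) * indicator (cball 0 R) \<xi> \<partial>lborel) \<le> 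
             (\<integral>\<^sup>+(\<xi>::'a). ennreal (exp (- t * (norm \<xi>)\<^sup>2)) \<partial>lborel)"
            by (intro nn_integral_mono) (auto simp: indicator_def)
          also have "... = ennreal ((pi / t) powr (N / 2))"
            using gaussian_integral(2)[OF t, of "0::'a"] by (simp add: N_def)
          also have "(pi / t) powr (N / 2) = V * R powr N * (Z * R powr (- N))"
            using V R by (simp add: Z_def powr_minus)
          finally have 2: "(\<integral>\<^sup>+(\<xi>::'a). ennreal (exp (- t * (norm \<xi>)\<^sup>2)) * indicator (cball 0 R) \<xi> \<partial>lborel) \<le> ennreal (V * R powr N * (Z * R powr (- N)))" .
          show ?thesis
            using 1 2 by (cases "Z * R powr (- N) \<le> 1") (auto simp: min_def)
        qed
        finally have "(\<integral>\<^sup>+(\<xi>::'a). ?S R \<xi> \<partial>lborel)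
          \<le> ennreal (R powr (- b - 1)) * ennreal (V * R powr N * min 1 (Z * R powr (- N)))"
          by (simp add: mult_left_mono)
        also have "... = ennreal (V * (R powr N * R powr (- b - 1) * min 1 (Z * R powr (- N))))"
          using V Z by (simp add: ennreal_mult[symmetric] mult_ac)
        also have "R powr N * R powr (- b - 1) = R powr (N - b - 1)"
          by (simp add: algebra_simps flip: powr_add)
        finally show ?thesis using V R by (simp add: ennreal_mult')
      qed auto
    qed auto
    also have "... = ennreal b * (ennreal V * (\<integral>\<^sup>+R. (ennreal (R powr (N - b - 1) * min 1 (Z * R powr (- N))) * indicator {0<..} R) \<partial>lborel))"
      by (subst nn_integral_cmult) auto
    also have "... \<le> ennreal b * (ennreal V * ennreal (Z powr ((N - b) / N) * c))"
      unfolding c_def using bN Z by (intro mult_left_mono nn_integral_powr_min) auto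
    also have "... = ennreal (b * V * Z powr ((N - b) / N) * c)"
      using b V c by (simp add: ennreal_mult[symmetric] mult_ac)
    also have "b * V * Z powr ((N - b) / N) * c = K * t powr (- (N - b) / 2)"
    proof -
      have "Z = (pi powr (N / 2) / V) * t powr (- N / 2)"
        using t by (simp add: Z_def powr_divide powr_minus field_simps)
      then have "Z powr ((N - b) / N) = (pi powr (N / 2) / V) powr ((N - b) / N) * t powr (- N / 2 * ((N - b) / N))"
        by (simp only: powr_mult powr_powr)
      also have "- N / 2 * ((N - b) / N) = - (N - b) / 2" using bN by (simp add: field_simps)
      finally show ?thesis by (simp add: K_def)
    qed
    finally show ?thesis .
  qed
  ultimately show ?thesis using that unfolding N_def by blast
qed

lemma powr_half_square: "(z powr (c / 2))\<^sup>2 = (z :: real) powr c"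
  by (simp add: power2_eq_square flip: powr_add)

text \<open>Cauchy--Schwarz with the powers \<open>- b / 2\<close> and \<open>b / 2\<close> of
  |\<xi>| and the Gaussian split evenly, so that each square carries it in full. It is kept on the
  right side because the Hardy inequality integrates it over the scale, where it gives convergence
  at infinity.\<close>

lemma low_frequency_bound:
  fixes b :: real
  assumes b: "0 < b" "b < real DIM('a::euclidean_space)"
  obtains K where "0 < K"
    "\<And>(H :: 'a \<Rightarrow> complex) t x. integrable lborel H \<Longrightarrow> 0 < t \<Longrightarrow>
       ennreal ((norm (inv_fourier (\<lambda>\<xi>. H \<xi> * exp (- t * (norm \<xi>)\<^sup>2)) x))\<^sup>2) \<le>
       ennreal (K * t powr (- (real DIM('a) - b) / 2)) *
         (\<integral>\<^sup>+\<xi>. ennreal (norm \<xi> powr b * exp (- t * (norm \<xi>)\<^sup>2) * (norm (H \<xi>))\<^sup>2) \<partial>lborel)"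
proof -
  obtain K where K: "0 < K" "\<And>t. 0 < t \<Longrightarrow> (\<integral>\<^sup>+(\<xi>::'a). ennreal (norm \<xi> powr (- b) * exp (- t * (norm \<xi>)\<^sup>2)) \<partial>lborel)
       \<le> ennreal (K * t powr (- (real DIM('a) - b) / 2))"
    using nn_integral_riesz_gaussian[OF b] by blast
  define c where "c = (2 * pi) powr (- real DIM('a) / 2)"
  have c: "c > 0" by (simp add: c_def)
  have "ennreal ((norm (inv_fourier (\<lambda>\<xi>. H \<xi> * exp (- t * (norm \<xi>)\<^sup>2)) x))\<^sup>2) \<le>
       ennreal (c\<^sup>2 * K * t powr (- (real DIM('a) - b) / 2)) *
         (\<integral>\<^sup>+\<xi>. ennreal (norm \<xi> powr b * exp (- t * (norm \<xi>)\<^sup>2) * (norm (H \<xi>))\<^sup>2) \<partial>lborel)"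
    if H: "integrable lborel H" and t: "0 < t" for H :: "'a \<Rightarrow> complex" and t x
  proof -
    have [measurable]: "H \<in> borel_measurable borel" using H by auto
    let ?G = "\<lambda>\<xi>. H \<xi> * complex_of_real (exp (- t * (norm \<xi>)\<^sup>2))"
    let ?I = "\<integral>\<xi>. norm (?G \<xi>) \<partial>lborel"
    let ?J = "\<integral>\<^sup>+\<xi>. ennreal (norm \<xi> powr b * exp (- t * (norm \<xi>)\<^sup>2) * (norm (H \<xi>))\<^sup>2) \<partial>lborel"
    let ?K = "\<integral>\<^sup>+(\<xi>::'a). ennreal (norm \<xi> powr (- b) * exp (- t * (norm \<xi>)\<^sup>2)) \<partial>lborel"
    have G: "integrable lborel ?G"
      using t by (intro Bochner_Integration.integrable_bound[OF H]) (auto simp: norm_mult intro!: mult_right_le_one_le AE_I2)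
    have "ennreal ((norm (inv_fourier ?G x))\<^sup>2) \<le> ennreal ((c * ?I)\<^sup>2)"
      using norm_inv_fourier_le[OF G] by (intro ennreal_leI power_mono) (auto simp: c_def)
    also have "... = ennreal (c\<^sup>2) * (\<integral>\<^sup>+\<xi>. ennreal (norm (?G \<xi>)) \<partial>lborel)\<^sup>2"
      using G by (subst nn_integral_eq_integral) (auto simp: power_mult_distrib ennreal_mult ennreal_power)
    also have "(\<integral>\<^sup>+\<xi>. ennreal (norm (?G \<xi>)) \<partial>lborel) = 
      (\<integral>\<^sup>+\<xi>. ennreal (norm \<xi> powr (- b / 2) * exp (- (t / 2) * (norm \<xi>)\<^sup>2)) * ennreal (norm \<xi> powr (b / 2) * exp (- (t / 2) * (norm \<xi>)\<^sup>2) * norm (H \<xi>)) \<partial>lborel)"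
    proof (rule nn_integral_cong_AE)
      \<comment> \<open>At the origin the two powers multiply to 0 instead of 1, so this point has
        to be left out.\<close>
      have "AE \<xi> in lborel. \<xi> \<noteq> (0::'a)" by (rule AE_lborel_singleton)
      then show "AE \<xi> in lborel. ennreal (norm (?G \<xi>)) = ennreal (norm \<xi> powr (- b / 2) * exp (- (t / 2) * (norm \<xi>)\<^sup>2)) * ennreal (norm \<xi> powr (b / 2) * exp (- (t / 2) * (norm \<xi>)\<^sup>2) * norm (H \<xi>))"
      proof eventually_elim
        case (elim \<xi>)
        have "norm (?G \<xi>) = (norm \<xi> powr (- b / 2) * norm \<xi> powr (b / 2)) * (exp (- (t / 2) * (norm \<xi>)\<^sup>2) * exp (- (t / 2) * (norm \<xi>)\<^sup>2)) * norm (H \<xi>)"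
          using elim by (simp add: norm_mult flip: powr_add exp_add)
        then show ?case by (simp add: mult_ac flip: ennreal_mult)
      qed
    qed
    also have "...\<^sup>2 \<le> (\<integral>\<^sup>+(\<xi>::'a). (ennreal (norm \<xi> powr (- b / 2) * exp (- (t / 2) * (norm \<xi>)\<^sup>2)))\<^sup>2 \<partial>lborel) * 
       (\<integral>\<^sup>+\<xi>. (ennreal (norm \<xi> powr (b / 2) * exp (- (t / 2) * (norm \<xi>)\<^sup>2) * norm (H \<xi>)))\<^sup>2 \<partial>lborel)"
      by (rule Cauchy_Schwarz_nn_integral) measurable
    also have "(\<integral>\<^sup>+(\<xi>::'a). (ennreal (norm \<xi> powr (- b / 2) * exp (- (t / 2) * (norm \<xi>)\<^sup>2)))\<^sup>2 \<partial>lborel) = 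
       ?K"
      by (intro nn_integral_cong) (simp add: ennreal_power power_mult_distrib powr_half_square powr_half_square[of _ "- b", simplified] flip: exp_double)
    also have "(\<integral>\<^sup>+\<xi>. (ennreal (norm \<xi> powr (b / 2) * exp (- (t / 2) * (norm \<xi>)\<^sup>2) * norm (H \<xi>)))\<^sup>2 \<partial>lborel) = 
       ?J"
      by (intro nn_integral_cong) (simp add: ennreal_power power_mult_distrib powr_half_square powr_half_square[of _ "- b", simplified] flip: exp_double)
    finally have "ennreal ((norm (inv_fourier ?G x))\<^sup>2) \<le> ennreal (c\<^sup>2) * (?K * 
       ?J)"
      by (simp add: mult_left_mono)
    also have "... \<le> ennreal (c\<^sup>2) * (ennreal (K * t powr (- (real DIM('a) - b) / 2)) * 
       ?J)"
      by (intro mult_left_mono mult_right_mono K t) auto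
    also have "... = ennreal (c\<^sup>2 * K * t powr (- (real DIM('a) - b) / 2)) *
         ?J"
      using K(1) by (simp add: mult.assoc ennreal_mult)
    finally show ?thesis .
  qed
  then show ?thesis using that[of "c\<^sup>2 * K"] c K(1) by simp
qed

section \<open>Scale integrals for the Hardy inequality\<close>

text \<open>The scale integral of the low part, at fixed frequency \<open>x = |\<xi>|\<close>. The
  Hardy inequality uses it with the exponent \<open>b - a\<close>, turning |\<xi>|^b into
  |\<xi>|^a.\<close>

lemma gaussian_weight_integral_le:
  fixes a x :: real
  assumes a: "0 < a" "a < 2" and x: "0 < x"
  shows "(\<integral>\<^sup>+R. (if 0 < R then ennreal (R powr (a - 1) * exp (- R\<^sup>2 * x\<^sup>2)) else 0) \<partial>lborel)
     \<le> ennreal (x powr (- a) * (1 / a + 1 / (2 - a)))"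
proof -
  have "(\<integral>\<^sup>+R. (if 0 < R then ennreal (R powr (a - 1) * exp (- R\<^sup>2 * x\<^sup>2)) else 0) \<partial>lborel)
    \<le> (\<integral>\<^sup>+R. ennreal (R powr (a - 1) * min 1 (x powr (- 2) * R powr (- 2))) * indicator {0<..} R \<partial>lborel)"
  proof (rule nn_integral_mono)
    fix R :: real
    show "(if 0 < R then ennreal (R powr (a - 1) * exp (- R\<^sup>2 * x\<^sup>2)) else 0) \<le> 
       ennreal (R powr (a - 1) * min 1 (x powr (- 2) * R powr (- 2))) * indicator {0<..} R"
    proof (cases "0 < R")
      case R: True
      have "exp (- (R\<^sup>2 * x\<^sup>2)) \<le> min 1 (1 / (R\<^sup>2 * x\<^sup>2))"
        using R x by (intro exp_neg_le_inverse) auto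
      also have "1 / (R\<^sup>2 * x\<^sup>2) = x powr (- 2) * R powr (- 2)"
        using R x by (simp add: powr_minus field_simps)
      finally show ?thesis using R by (auto intro!: ennreal_leI mult_left_mono)
    qed auto
  qed
  also have "... \<le> ennreal ((x powr (- 2)) powr (a / 2) * (1 / a + 1 / (2 - a)))"
    using a by (intro nn_integral_powr_min) auto
  also have "(x powr (- 2)) powr (a / 2) = x powr (- a)"
    by (simp only: powr_powr) simp
  finally show ?thesis .
qed

text \<open>The scale integral of the high part. The squared factor is of order R^2 near 0, which
  tames \<open>R powr (- a - 1)\<close> there because \<open>a < 2\<close>.\<close>

lemma gaussian_complement_weight_integral_le:
  fixes a x :: real
  assumes a: "0 < a" "a < 2" and x: "0 \<le> x"
  shows "(\<integral>\<^sup>+R. (if 0 < R then ennreal (R powr (- a - 1) * (1 - exp (- R\<^sup>2 * x\<^sup>2))\<^sup>2) else 0) \<partial>lborel)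
     \<le> ennreal (x powr a * (1 / (2 - a) + 1 / a))"
proof (cases "x = 0")
  case False
  then have x: "x > 0" using x by simp
  have "(\<integral>\<^sup>+R. (if 0 < R then ennreal (R powr (- a - 1) * (1 - exp (- R\<^sup>2 * x\<^sup>2))\<^sup>2) else 0) \<partial>lborel)
    \<le> (\<integral>\<^sup>+R. ennreal (x\<^sup>2) * (ennreal (R powr ((2 - a) - 1) * min 1 (x powr (- 2) * R powr (- 2))) * indicator {0<..} R) \<partial>lborel)"
  proof (rule nn_integral_mono)
    fix R :: real
    show "(if 0 < R then ennreal (R powr (- a - 1) * (1 - exp (- R\<^sup>2 * x\<^sup>2))\<^sup>2) else 0) \<le> 
       ennreal (x\<^sup>2) * (ennreal (R powr ((2 - a) - 1) * min 1 (x powr (- 2) * R powr (- 2))) * indicator {0<..} R)"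
    proof (cases "0 < R")
      case R: True
      have "(1 - exp (- (R\<^sup>2 * x\<^sup>2)))\<^sup>2 \<le> min 1 (R\<^sup>2 * x\<^sup>2)"
        by (intro one_minus_exp_sq_le) auto
      \<comment> \<open>Pulling out \<open>x^2 * R^2\<close> leaves a minimum that decreases in
        \<open>R\<close>, so \<open>nn_integral_powr_min\<close> applies with the exponent
        \<open>2 - a\<close>.\<close>
      also have "... = x\<^sup>2 * R\<^sup>2 * min 1 (x powr (- 2) * R powr (- 2))"
        using R x by (simp add: powr_minus min_mult_distrib_left field_simps)
      finally have "R powr (- a - 1) * (1 - exp (- R\<^sup>2 * x\<^sup>2))\<^sup>2 \<le> R powr (- a - 1) * (x\<^sup>2 * R\<^sup>2 * min 1 (x powr (- 2) * R powr (- 2)))"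
        by (intro mult_left_mono) auto
      also have "... = x\<^sup>2 * ((R powr 2 * R powr (- a - 1)) * min 1 (x powr (- 2) * R powr (- 2)))"
        using R by simp
      also have "R powr 2 * R powr (- a - 1) = R powr ((2 - a) - 1)"
        unfolding powr_add[symmetric] by (simp add: algebra_simps)
      finally show ?thesis using R by (simp add: ennreal_leI flip: ennreal_mult)
    qed auto
  qed
  also have "... = ennreal (x\<^sup>2) * (\<integral>\<^sup>+R. (ennreal (R powr ((2 - a) - 1) * min 1 (x powr (- 2) * R powr (- 2))) * indicator {0<..} R) \<partial>lborel)"
    by (rule nn_integral_cmult) simp
  also have "... \<le> ennreal (x\<^sup>2) * ennreal ((x powr (- 2)) powr ((2 - a) / 2) * (1 / (2 - a) + 1 / (2 - (2 - a))))"
    using a by (intro mult_left_mono nn_integral_powr_min) auto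
  also have "... = ennreal (x powr 2 * (x powr (- 2)) powr ((2 - a) / 2) * (1 / (2 - a) + 1 / a))"
    using a x by (simp add: mult.assoc flip: ennreal_mult)
  also have "x powr 2 * (x powr (- 2)) powr ((2 - a) / 2) = x powr a"
    unfolding powr_powr powr_add[symmetric] by (simp add: field_simps)
  finally show ?thesis .
qed (simp cong: if_cong)

lemma nn_integral_indicator_cball_add:
  fixes w :: "'a::euclidean_space \<Rightarrow> ennreal"
  assumes [measurable]: "w \<in> borel_measurable borel"
  shows "(\<integral>\<^sup>+y. k * indicator (cball 0 R) y + 2 * w y \<partial>lborel) = k * emeasure lborel (cball (0::'a) R) + 2 * (\<integral>\<^sup>+y. w y \<partial>lborel)"
proof -
  have [measurable]: "cball (0::'a) R \<in> sets borel" by (rule borel_closed) simp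
  show ?thesis by (simp add: nn_integral_add nn_integral_cmult)
qed

lemma integrable_mult_gaussian:
  fixes H :: "'a::euclidean_space \<Rightarrow> complex"
  assumes H: "integrable lborel H" and t: "0 \<le> t"
  shows "integrable lborel (\<lambda>\<xi>. H \<xi> * complex_of_real (exp (- t * (norm \<xi>)\<^sup>2)))"
    "integrable lborel (\<lambda>\<xi>. H \<xi> * complex_of_real (1 - exp (- t * (norm \<xi>)\<^sup>2)))"
proof -
  have [measurable]: "H \<in> borel_measurable borel" using H by auto
  show "integrable lborel (\<lambda>\<xi>. H \<xi> * complex_of_real (exp (- t * (norm \<xi>)\<^sup>2)))"
    using t by (intro Bochner_Integration.integrable_bound[OF H]) (auto simp: norm_mult intro!: mult_right_le_one_le AE_I2)
  then show "integrable lborel (\<lambda>\<xi>. H \<xi> * complex_of_real (1 - exp (- t * (norm \<xi>)\<^sup>2)))"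
    using H by (simp add: right_diff_distrib)
qed

lemma inv_fourier_split:
  fixes H :: "'a::euclidean_space \<Rightarrow> complex"
  assumes H: "integrable lborel H" and t: "0 \<le> t"
  shows "inv_fourier H x = inv_fourier (\<lambda>\<xi>. H \<xi> * complex_of_real (exp (- t * (norm \<xi>)\<^sup>2))) x
     + inv_fourier (\<lambda>\<xi>. H \<xi> * complex_of_real (1 - exp (- t * (norm \<xi>)\<^sup>2))) x"
  using inv_fourier_diff[OF H integrable_mult_gaussian(1)[OF H t], of x] by (simp add: right_diff_distrib)

theorem hardy_inequality:
  fixes a :: real
  assumes a: "0 < a" "a < 2" "a < real DIM('a::euclidean_space)"
  obtains C where "0 < C"
    "\<And>H :: 'a \<Rightarrow> complex. integrable lborel H \<Longrightarrow>
       (\<integral>\<^sup>+y. ennreal ((norm (inv_fourier H y))\<^sup>2 * norm y powr (- a)) \<partial>lborel)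
         \<le> ennreal C * (\<integral>\<^sup>+\<xi>. ennreal (norm \<xi> powr a * (norm (H \<xi>))\<^sup>2) \<partial>lborel)"
proof -
  define N where "N = real DIM('a)"
  \<comment> \<open>An auxiliary exponent: \<open>b < N\<close> is required by the low-frequency
    bound, \<open>a < b\<close> makes the scale integral of the low part converge at 0, and
    \<open>b - a < 2\<close> makes its majorant converge at infinity.\<close>
  define b where "b = min (a + 1) ((a + N) / 2)"
  have b: "0 < b" "b < N" "a < b" "b - a < 2" using a by (auto simp: b_def N_def min_def field_simps)
  obtain K where K: "0 < K"
    "\<And>(H :: 'a \<Rightarrow> complex) t x. integrable lborel H \<Longrightarrow> 0 < t \<Longrightarrow>
       ennreal ((norm (inv_fourier (\<lambda>\<xi>. H \<xi> * exp (- t * (norm \<xi>)\<^sup>2)) x))\<^sup>2) \<le>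
       ennreal (K * t powr (- (N - b) / 2)) *
         (\<integral>\<^sup>+\<xi>. ennreal (norm \<xi> powr b * exp (- t * (norm \<xi>)\<^sup>2) * (norm (H \<xi>))\<^sup>2) \<partial>lborel)"
    using low_frequency_bound[OF b(1) b(2)[unfolded N_def]] unfolding N_def by blast
  define V where "V = unit_ball_vol N"
  have V: "V > 0" by (simp add: V_def N_def)
  define c1 where "c1 = 1 / (b - a) + 1 / (2 - (b - a))"
  define c2 where "c2 = 1 / (2 - a) + 1 / a"
  have c: "0 < c1" "0 < c2" using a b by (auto simp: c1_def c2_def add_pos_pos)
  \<comment> \<open>The factor \<open>a\<close> comes from the layer cake, the factors 2 from
    bounding the square of a sum, \<open>V * K\<close> from the ball and the low-frequency bound,
    and \<open>c1\<close>, \<open>c2\<close> from the two scale integrals.\<close>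
  define C where "C = a * (2 * V * K * c1 + 2 * c2)"
  have C: "C > 0" using a V K(1) c by (simp add: C_def add_pos_pos)
  moreover have "(\<integral>\<^sup>+y. ennreal ((norm (inv_fourier H y))\<^sup>2 * norm y powr (- a)) \<partial>lborel)
         \<le> ennreal C * (\<integral>\<^sup>+\<xi>. ennreal (norm \<xi> powr a * (norm (H \<xi>))\<^sup>2) \<partial>lborel)"
    if H: "integrable lborel H" for H :: "'a \<Rightarrow> complex"
  proof -
    have [measurable]: "H \<in> borel_measurable borel" using H by auto
    let ?U = "\<lambda>y. ennreal ((norm (inv_fourier H y))\<^sup>2)"
    let ?S = "\<lambda>R (y::'a). if 0 < R \<and> norm y \<le> R then ennreal (R powr (- a - 1)) * ?U y else 0"
    let ?P = "\<lambda>R (\<xi>::'a). if 0 < R then ennreal (R powr (b - a - 1) * exp (- R\<^sup>2 * (norm \<xi>)\<^sup>2)) else 0"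
    let ?Q = "\<lambda>R (\<xi>::'a). if 0 < R then ennreal (R powr (- a - 1) * (1 - exp (- R\<^sup>2 * (norm \<xi>)\<^sup>2))\<^sup>2) else 0"
    let ?Hb = "\<lambda>\<xi>. ennreal (norm \<xi> powr b * (norm (H \<xi>))\<^sup>2)"
    let ?Ha = "\<lambda>\<xi>. ennreal (norm \<xi> powr a * (norm (H \<xi>))\<^sup>2)"
    let ?A = "\<lambda>R. \<integral>\<^sup>+\<xi>. ennreal (norm \<xi> powr b * exp (- R\<^sup>2 * (norm \<xi>)\<^sup>2) * (norm (H \<xi>))\<^sup>2) \<partial>lborel"
    let ?B = "\<lambda>R. \<integral>\<^sup>+\<xi>. ennreal ((1 - exp (- R\<^sup>2 * (norm \<xi>)\<^sup>2))\<^sup>2 * (norm (H \<xi>))\<^sup>2) \<partial>lborel"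
    \<comment> \<open>For \<open>t = R^2\<close> the pointwise bound contributes
      \<open>R powr (b - N)\<close> and the volume \<open>R powr N\<close>, which leaves
      \<open>R powr b\<close> before the low-frequency integral.\<close>
    have ball: "(\<integral>\<^sup>+y. ?U y * indicator (cball 0 R) y \<partial>lborel) \<le> ennreal (2 * V * K * R powr b) * ?A R + 2 * ?B R"
      if R: "R > 0" for R
    proof -
      let ?L = "inv_fourier (\<lambda>\<xi>. H \<xi> * complex_of_real (exp (- R\<^sup>2 * (norm \<xi>)\<^sup>2)))"
      let ?G = "\<lambda>\<xi>. H \<xi> * complex_of_real (1 - exp (- R\<^sup>2 * (norm \<xi>)\<^sup>2))"
      have R2: "0 < R\<^sup>2" using R by simp
      have "(\<integral>\<^sup>+y. ?U y * indicator (cball 0 R) y \<partial>lborel) \<le>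
        (\<integral>\<^sup>+y. 2 * (ennreal (K * (R\<^sup>2) powr (- (N - b) / 2)) * ?A R) * indicator (cball 0 R) y + 2 * ennreal ((norm (inv_fourier ?G y))\<^sup>2) \<partial>lborel)"
      proof (rule nn_integral_mono)
        fix y
        have "(norm (inv_fourier H y))\<^sup>2 \<le> (norm (?L y) + norm (inv_fourier ?G y))\<^sup>2"
          unfolding inv_fourier_split[OF H less_imp_le[OF R2], of y] by (intro power_mono norm_triangle_ineq) auto
        also have "... \<le> 2 * (norm (?L y))\<^sup>2 + 2 * (norm (inv_fourier ?G y))\<^sup>2"
          using sum_squares_bound[of "norm (?L y)" "norm (inv_fourier ?G y)"] by (simp add: power2_sum)
        finally have "?U y \<le> ennreal (2 * (norm (?L y))\<^sup>2 + 2 * (norm (inv_fourier ?G y))\<^sup>2)"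
          by (rule ennreal_leI)
        also have "... = 2 * ennreal ((norm (?L y))\<^sup>2) + 2 * ennreal ((norm (inv_fourier ?G y))\<^sup>2)"
          by (simp add: ennreal_mult)
        also have "... \<le> 2 * (ennreal (K * (R\<^sup>2) powr (- (N - b) / 2)) * ?A R) + 2 * ennreal ((norm (inv_fourier ?G y))\<^sup>2)"
          by (intro add_right_mono mult_left_mono K(2)[OF H R2]) auto
        finally show "?U y * indicator (cball 0 R) y \<le> 
            2 * (ennreal (K * (R\<^sup>2) powr (- (N - b) / 2)) * ?A R) * indicator (cball 0 R) y + 2 * ennreal ((norm (inv_fourier ?G y))\<^sup>2)"
          by (auto simp: indicator_def)
      qed
      also have "... = 2 * (ennreal (K * (R\<^sup>2) powr (- (N - b) / 2)) * ?A R) * emeasure lborel (cball (0::'a) R) + 2 * (\<integral>\<^sup>+y. ennreal ((norm (inv_fourier ?G y))\<^sup>2) \<partial>lborel)"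
        by (rule nn_integral_indicator_cball_add) measurable
      also have "... \<le> 2 * (ennreal (K * (R\<^sup>2) powr (- (N - b) / 2)) * ?A R) * emeasure lborel (cball (0::'a) R) + 2 * (\<integral>\<^sup>+\<xi>. ennreal ((norm (?G \<xi>))\<^sup>2) \<partial>lborel)"
        by (intro add_left_mono mult_left_mono plancherel_le integrable_mult_gaussian(2) H) auto
      also have "(\<integral>\<^sup>+\<xi>. ennreal ((norm (?G \<xi>))\<^sup>2) \<partial>lborel) = ?B R"
        by (intro nn_integral_cong) (simp add: norm_mult power_mult_distrib mult_ac del: of_real_diff)
      also have "emeasure lborel (cball (0::'a) R) = ennreal (V * R powr N)"
        using R by (simp add: emeasure_cball V_def N_def powr_realpow)
      also have "2 * (ennreal (K * (R\<^sup>2) powr (- (N - b) / 2)) * ?A R) * ennreal (V * R powr N) = 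
          ennreal (2 * V * K * (R powr N * (R\<^sup>2) powr (- (N - b) / 2))) * ?A R"
        using V K(1) by (simp add: ennreal_mult mult_ac)
      also have "R powr N * (R\<^sup>2) powr (- (N - b) / 2) = R powr b"
      proof -
        have "(R\<^sup>2) powr (- (N - b) / 2) = (R powr 2) powr (- (N - b) / 2)" using R by simp
        also have "... = R powr (2 * (- (N - b) / 2))" by (simp only: powr_powr)
        also have "2 * (- (N - b) / 2) = b - N" by simp
        finally show ?thesis by (simp flip: powr_add)
      qed
      finally show ?thesis .
    qed
    have "(\<integral>\<^sup>+y. ennreal ((norm (inv_fourier H y))\<^sup>2 * norm y powr (- a)) \<partial>lborel) \<le>
       (\<integral>\<^sup>+y. ennreal a * (\<integral>\<^sup>+R. ?S R y \<partial>lborel) \<partial>lborel)"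
    proof (rule nn_integral_mono)
      fix y
      have "ennreal ((norm (inv_fourier H y))\<^sup>2 * norm y powr (- a)) = ennreal (norm y powr (- a)) * ?U y"
        by (simp add: mult.commute flip: ennreal_mult)
      also have "... \<le> (ennreal a * (\<integral>\<^sup>+R. (if 0 < R \<and> norm y \<le> R then ennreal (R powr (- a - 1)) else 0) \<partial>lborel)) * ?U y"
        by (intro mult_right_mono powr_neg_layer_cake a) auto
      also have "... = ennreal a * (\<integral>\<^sup>+R. (if 0 < R \<and> norm y \<le> R then ennreal (R powr (- a - 1)) else 0) * ?U y \<partial>lborel)"
        by (subst nn_integral_multc) (auto simp: mult.assoc)
      also have "... = ennreal a * (\<integral>\<^sup>+R. ?S R y \<partial>lborel)"
        by (intro arg_cong2[where f="(*)"] nn_integral_cong) auto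
      finally show "ennreal ((norm (inv_fourier H y))\<^sup>2 * norm y powr (- a)) \<le> ..." .
    qed
    also have "... = ennreal a * (\<integral>\<^sup>+y. (\<integral>\<^sup>+R. ?S R y \<partial>lborel) \<partial>lborel)"
      by (rule nn_integral_cmult) measurable
    also have "... = ennreal a * (\<integral>\<^sup>+R. (\<integral>\<^sup>+y. ?S R y \<partial>lborel) \<partial>lborel)"
      by (intro arg_cong2[where f="(*)"] refl lborel_pair.Fubini'[symmetric]) measurable
    also have "... \<le> ennreal a * (\<integral>\<^sup>+R. (ennreal (2 * V * K) * (\<integral>\<^sup>+\<xi>. ?Hb \<xi> * ?P R \<xi> \<partial>lborel)
        + 2 * (\<integral>\<^sup>+\<xi>. ennreal ((norm (H \<xi>))\<^sup>2) * ?Q R \<xi> \<partial>lborel)) \<partial>lborel)"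
    proof (intro mult_left_mono nn_integral_mono)
      fix R :: real
      show "(\<integral>\<^sup>+y. ?S R y \<partial>lborel)
         \<le> ennreal (2 * V * K) * (\<integral>\<^sup>+\<xi>. ?Hb \<xi> * ?P R \<xi> \<partial>lborel)
        + 2 * (\<integral>\<^sup>+\<xi>. ennreal ((norm (H \<xi>))\<^sup>2) * ?Q R \<xi> \<partial>lborel)"
      proof (cases "0 < R")
        case R: True
        have "(\<integral>\<^sup>+y. ?S R y \<partial>lborel) =
          (\<integral>\<^sup>+y. ennreal (R powr (- a - 1)) * (?U y * indicator (cball 0 R) y) \<partial>lborel)"
          using R by (intro nn_integral_cong) (auto simp: indicator_def)
        also have "... = ennreal (R powr (- a - 1)) * (\<integral>\<^sup>+y. ?U y * indicator (cball 0 R) y \<partial>lborel)"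
          by (rule nn_integral_cmult) (auto intro!: borel_measurable_times_ennreal borel_measurable_indicator borel_closed)
        also have "... \<le> ennreal (R powr (- a - 1)) * (ennreal (2 * V * K * R powr b) * ?A R + 2 * ?B R)"
          by (intro mult_left_mono ball R) auto
        also have "... = ennreal (2 * V * K) * (ennreal (R powr b * R powr (- a - 1)) * ?A R) + 2 * (ennreal (R powr (- a - 1)) * ?B R)"
          using V K(1) by (simp add: ennreal_mult distrib_left mult_ac)
        also have "R powr b * R powr (- a - 1) = R powr (b - a - 1)"
          by (simp add: algebra_simps flip: powr_add)
        also have "ennreal (R powr (b - a - 1)) * ?A R = (\<integral>\<^sup>+\<xi>. ?Hb \<xi> * ennreal (R powr (b - a - 1) * exp (- R\<^sup>2 * (norm \<xi>)\<^sup>2)) \<partial>lborel)"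
          by (subst nn_integral_cmult[symmetric]) (auto simp: mult_ac simp flip: ennreal_mult)
        also have "ennreal (R powr (- a - 1)) * ?B R = (\<integral>\<^sup>+\<xi>. ennreal ((norm (H \<xi>))\<^sup>2) * ennreal (R powr (- a - 1) * (1 - exp (- R\<^sup>2 * (norm \<xi>)\<^sup>2))\<^sup>2) \<partial>lborel)"
          by (subst nn_integral_cmult[symmetric]) (auto simp: mult_ac simp flip: ennreal_mult)
        finally show ?thesis using R by simp
      qed simp
    qed auto
    also have "... = ennreal a * (ennreal (2 * V * K) * (\<integral>\<^sup>+R. (\<integral>\<^sup>+\<xi>. ?Hb \<xi> * ?P R \<xi> \<partial>lborel) \<partial>lborel)
        + 2 * (\<integral>\<^sup>+R. (\<integral>\<^sup>+\<xi>. ennreal ((norm (H \<xi>))\<^sup>2) * ?Q R \<xi> \<partial>lborel) \<partial>lborel))"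
      by (subst nn_integral_add, measurable, subst nn_integral_cmult, measurable, subst nn_integral_cmult, measurable)
    \<comment> \<open>Exchanging the integrals isolates the scale integral at each fixed \<xi>; both
      scale integrals then reproduce the same weight |\<xi>|^a.\<close>
    also have "(\<integral>\<^sup>+R. (\<integral>\<^sup>+\<xi>. ?Hb \<xi> * ?P R \<xi> \<partial>lborel) \<partial>lborel)
       = (\<integral>\<^sup>+\<xi>. (\<integral>\<^sup>+R. ?Hb \<xi> * ?P R \<xi> \<partial>lborel) \<partial>lborel)"
      by (rule lborel_pair.Fubini') measurable
    also have "... = (\<integral>\<^sup>+\<xi>. ?Hb \<xi> * (\<integral>\<^sup>+R. ?P R \<xi> \<partial>lborel) \<partial>lborel)"
      by (intro nn_integral_cong nn_integral_cmult) measurable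
    also have "(\<integral>\<^sup>+R. (\<integral>\<^sup>+\<xi>. ennreal ((norm (H \<xi>))\<^sup>2) * ?Q R \<xi> \<partial>lborel) \<partial>lborel)
       = (\<integral>\<^sup>+\<xi>. (\<integral>\<^sup>+R. ennreal ((norm (H \<xi>))\<^sup>2) * ?Q R \<xi> \<partial>lborel) \<partial>lborel)"
      by (rule lborel_pair.Fubini') measurable
    also have "... = (\<integral>\<^sup>+\<xi>. ennreal ((norm (H \<xi>))\<^sup>2) * (\<integral>\<^sup>+R. ?Q R \<xi> \<partial>lborel) \<partial>lborel)"
      by (intro nn_integral_cong nn_integral_cmult) measurable
    also have "ennreal a * (ennreal (2 * V * K) * (\<integral>\<^sup>+\<xi>. ?Hb \<xi> * (\<integral>\<^sup>+R. ?P R \<xi> \<partial>lborel) \<partial>lborel)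
        + 2 * (\<integral>\<^sup>+\<xi>. ennreal ((norm (H \<xi>))\<^sup>2) * (\<integral>\<^sup>+R. ?Q R \<xi> \<partial>lborel) \<partial>lborel))
      \<le> ennreal a * (ennreal (2 * V * K) * (\<integral>\<^sup>+\<xi>. ennreal c1 * ?Ha \<xi> \<partial>lborel)
        + 2 * (\<integral>\<^sup>+\<xi>. ennreal c2 * ?Ha \<xi> \<partial>lborel))"
    proof (intro mult_left_mono add_mono nn_integral_mono)
      fix \<xi>
      show "?Hb \<xi> * (\<integral>\<^sup>+R. ?P R \<xi> \<partial>lborel)
         \<le> ennreal c1 * ?Ha \<xi>"
      proof (cases "\<xi> = 0")
        case False
        have "?Hb \<xi> * (\<integral>\<^sup>+R. ?P R \<xi> \<partial>lborel)
           \<le> ?Hb \<xi> * ennreal (norm \<xi> powr (- (b - a)) * c1)"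
          unfolding c1_def using b a False by (intro mult_left_mono gaussian_weight_integral_le) auto
        also have "... = ennreal ((norm \<xi> powr b * norm \<xi> powr (- (b - a))) * (norm (H \<xi>))\<^sup>2 * c1)"
          using c by (simp add: mult_ac flip: ennreal_mult)
        also have "norm \<xi> powr b * norm \<xi> powr (- (b - a)) = norm \<xi> powr a" by (simp flip: powr_add)
        finally show ?thesis using c by (simp add: mult_ac flip: ennreal_mult)
      qed simp
      have "ennreal ((norm (H \<xi>))\<^sup>2) * (\<integral>\<^sup>+R. ?Q R \<xi> \<partial>lborel)
         \<le> ennreal ((norm (H \<xi>))\<^sup>2) * ennreal (norm \<xi> powr a * c2)"
        unfolding c2_def using a by (intro mult_left_mono gaussian_complement_weight_integral_le) auto
      also have "... = ennreal c2 * ?Ha \<xi>"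
        using c by (simp add: mult_ac flip: ennreal_mult)
      finally show "ennreal ((norm (H \<xi>))\<^sup>2) * (\<integral>\<^sup>+R. ?Q R \<xi> \<partial>lborel)
         \<le> ennreal c2 * ?Ha \<xi>" .
    qed auto
    also have "... = ennreal a * (ennreal (2 * V * K) * (ennreal c1 * (\<integral>\<^sup>+\<xi>. ?Ha \<xi> \<partial>lborel))
        + 2 * (ennreal c2 * (\<integral>\<^sup>+\<xi>. ?Ha \<xi> \<partial>lborel)))"
      by (subst nn_integral_cmult, measurable, subst nn_integral_cmult, measurable)
    also have "... = ennreal C * (\<integral>\<^sup>+\<xi>. ?Ha \<xi> \<partial>lborel)"
      unfolding C_def using a V K(1) c
      by (simp add: ennreal_mult ennreal_plus distrib_left distrib_right mult_ac)
    finally show ?thesis .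
  qed
  ultimately show ?thesis using that by blast
qed

subsection \<open>The Hardy--Sobolev inequality\<close>

text \<open>The Sobolev integral enters through a real bound \<open>f\<close> because the splitting
  parameter at each level is built from that number. The power \<open>f powr (q / 2)\<close> is the
  one that homogeneity in \<open>H\<close> demands.\<close>

theorem hardy_sobolev_inv_fourier:
  fixes s a q :: real
  assumes s: "0 < s" "s < 1" and a: "0 < a" "a < 2 * s" "2 * s < real DIM('a::euclidean_space)"
    and q: "q = 2 * (real DIM('a) - a) / (real DIM('a) - 2 * s)"
  obtains C where "0 < C"
    "\<And>(H :: 'a \<Rightarrow> complex) f. integrable lborel H \<Longrightarrow> 0 \<le> f \<Longrightarrow>
       (\<integral>\<^sup>+\<xi>. ennreal (norm \<xi> powr (2 * s) * (norm (H \<xi>))\<^sup>2) \<partial>lborel) \<le> ennreal f \<Longrightarrow>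
       (\<integral>\<^sup>+y. ennreal (norm (inv_fourier H y) powr q * norm y powr (- a)) \<partial>lborel) \<le> ennreal (C * f powr (q / 2))"
proof -
  define N where "N = real DIM('a)"
  \<comment> \<open>The solution of \<open>d * (N - 2 * s) / 2 = 2\<close>: with \<open>t\<close>
    proportional to \<open>l powr (- d)\<close>, the low-frequency bound on the square becomes
    proportional to \<open>l^2\<close>.\<close>
  define d where "d = 4 / (N - 2 * s)"
  have N: "0 < N - 2 * s" "0 < N" using a by (auto simp: N_def)
  have q': "q - 2 = 2 * (2 * s - a) / (N - 2 * s)" using N unfolding q N_def[symmetric] by (simp add: field_simps)
  \<comment> \<open>These two inequalities are the convergence conditions of the integral over
    levels, at 0 and at infinity. They amount to \<open>a < 2 * s\<close> and
    \<open>2 * s - a < 2\<close>.\<close>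
  have q2: "0 < q - 2" using a N by (simp add: q')
  have qd: "q - 2 < d" unfolding q' d_def using N s a by (intro divide_strict_right_mono) auto
  have d: "d > 0" using N by (simp add: d_def)
  obtain K where K: "0 < K"
    "\<And>(H :: 'a \<Rightarrow> complex) t x. integrable lborel H \<Longrightarrow> 0 < t \<Longrightarrow>
       ennreal ((norm (inv_fourier (\<lambda>\<xi>. H \<xi> * exp (- t * (norm \<xi>)\<^sup>2)) x))\<^sup>2) \<le>
       ennreal (K * t powr (- (N - 2 * s) / 2)) *
         (\<integral>\<^sup>+\<xi>. ennreal (norm \<xi> powr (2 * s) * exp (- t * (norm \<xi>)\<^sup>2) * (norm (H \<xi>))\<^sup>2) \<partial>lborel)"
    using low_frequency_bound[of "2 * s", where 'a='a] s a unfolding N_def by auto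
  obtain C1 where C1: "0 < C1"
    "\<And>H :: 'a \<Rightarrow> complex. integrable lborel H \<Longrightarrow>
       (\<integral>\<^sup>+y. ennreal ((norm (inv_fourier H y))\<^sup>2 * norm y powr (- a)) \<partial>lborel)
         \<le> ennreal C1 * (\<integral>\<^sup>+\<xi>. ennreal (norm \<xi> powr a * (norm (H \<xi>))\<^sup>2) \<partial>lborel)"
    using hardy_inequality[of a, where 'a='a] s a by auto
  define c where "c = 1 / (q - 2) + 1 / (d - (q - 2))"
  have c: "c > 0" using q2 qd by (simp add: c_def add_pos_pos)
  \<comment> \<open>Collected from the layer cake (\<open>q\<close>), the squared lower bound on the
    high part (4), Hardy (\<open>C1\<close>), the level integral (\<open>c\<close>), and
    \<open>B powr (q - 2)\<close> without its power of \<open>f\<close>.\<close>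
  define C where "C = q * 4 * C1 * c * (2 * sqrt K) powr (q - 2)"
  have C: "C > 0" using q2 C1(1) c K(1) by (simp add: C_def)
  moreover have "(\<integral>\<^sup>+y. ennreal (norm (inv_fourier H y) powr q * norm y powr (- a)) \<partial>lborel) \<le> ennreal (C * f powr (q / 2))"
    if H: "integrable lborel H" and f: "0 \<le> f" and Hf: "(\<integral>\<^sup>+\<xi>. ennreal (norm \<xi> powr (2 * s) * (norm (H \<xi>))\<^sup>2) \<partial>lborel) \<le> ennreal f"
    for H :: "'a \<Rightarrow> complex" and f
  proof (cases "f = 0")
    \<comment> \<open>Treated apart because the splitting parameter below must be positive; here
      \<open>H\<close> vanishes almost everywhere and its inverse transform vanishes
      everywhere.\<close>
    case True
    have [measurable]: "H \<in> borel_measurable borel" using H by auto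
    have "(\<integral>\<^sup>+\<xi>. ennreal (norm \<xi> powr (2 * s) * (norm (H \<xi>))\<^sup>2) \<partial>lborel) = 0" using Hf True by simp
    then have "AE \<xi> in lborel. ennreal (norm \<xi> powr (2 * s) * (norm (H \<xi>))\<^sup>2) = 0"
      by (subst (asm) nn_integral_0_iff_AE) auto
    moreover have "AE \<xi> in lborel. \<xi> \<noteq> (0::'a)" by (rule AE_lborel_singleton)
    ultimately have AE0: "AE \<xi> in lborel. H \<xi> = 0"
      by eventually_elim (auto simp: ennreal_eq_0_iff mult_le_0_iff)
    have "inv_fourier H y = 0" for y
    proof -
      have "(\<integral>\<xi>. cis (y \<bullet> \<xi>) * H \<xi> \<partial>lborel) = (\<integral>(\<xi>::'a). 0 \<partial>lborel)"
        using AE0 by (intro integral_cong_AE) auto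
      then show ?thesis by (simp add: inv_fourier_def)
    qed
    then show ?thesis by simp
  next
    case False
    then have f: "f > 0" using f by simp
    have [measurable]: "H \<in> borel_measurable borel" using H by auto
    \<comment> \<open>The squared low part is at most \<open>K * f * (l / B)^2\<close>, and this
      \<open>B\<close> makes it \<open>(l / 2)^2\<close>.\<close>
    define B where "B = 2 * sqrt (K * f)"
    have B: "B > 0" using K(1) f by (simp add: B_def)
    define t where "t l = (B / l) powr d" for l
    have [measurable]: "t \<in> borel_measurable borel" unfolding t_def by measurable
    let ?u = "inv_fourier H"
    let ?G = "\<lambda>l \<xi>. H \<xi> * complex_of_real (1 - exp (- t l * (norm \<xi>)\<^sup>2))"
    let ?S = "\<lambda>l (y::'a). if 0 < l \<and> l \<le> norm (?u y) then ennreal (l powr (q - 1)) * ennreal (norm y powr (- a)) else 0"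
    let ?L = "\<lambda>l. inv_fourier (\<lambda>\<xi>. H \<xi> * complex_of_real (exp (- t l * (norm \<xi>)\<^sup>2)))"
    let ?Ha = "\<lambda>\<xi>. ennreal (norm \<xi> powr a * (norm (H \<xi>))\<^sup>2)"
    let ?Hs = "\<lambda>\<xi>. ennreal (norm \<xi> powr (2 * s) * (norm (H \<xi>))\<^sup>2)"
    let ?M = "\<lambda>l (\<xi>::'a). min 1 (B powr d * (norm \<xi>)\<^sup>2 * l powr (- d))"
    have low: "norm (?L l y) \<le> l / 2" if l: "l > 0" for l y
    proof -
      have tl: "t l > 0" using l B by (simp add: t_def)
      have "ennreal ((norm (?L l y))\<^sup>2) \<le> ennreal (K * t l powr (- (N - 2 * s) / 2)) *
         (\<integral>\<^sup>+\<xi>. ennreal (norm \<xi> powr (2 * s) * exp (- t l * (norm \<xi>)\<^sup>2) * (norm (H \<xi>))\<^sup>2) \<partial>lborel)"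
        by (rule K(2)[OF H tl])
      also have "(\<integral>\<^sup>+\<xi>. ennreal (norm \<xi> powr (2 * s) * exp (- t l * (norm \<xi>)\<^sup>2) * (norm (H \<xi>))\<^sup>2) \<partial>lborel) \<le>
         (\<integral>\<^sup>+\<xi>. ?Hs \<xi> \<partial>lborel)"
        using tl by (intro nn_integral_mono ennreal_leI mult_right_mono mult_left_le) auto
      also have "... \<le> ennreal f" by (rule Hf)
      finally have "ennreal ((norm (?L l y))\<^sup>2) \<le> ennreal (K * t l powr (- (N - 2 * s) / 2)) * ennreal f"
        by (simp add: mult_left_mono)
      also have "... = ennreal (K * t l powr (- (N - 2 * s) / 2) * f)" using K(1) f by (simp flip: ennreal_mult)
      also have "t l powr (- (N - 2 * s) / 2) = (B / l) powr (- 2)"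
      proof -
        have "d * (- (N - 2 * s) / 2) = - 2" using N unfolding d_def by (simp add: field_simps)
        then show ?thesis unfolding t_def powr_powr by simp
      qed
      also have "K * (B / l) powr (- 2) * f = (l / 2)\<^sup>2"
        using B l K(1) f by (simp add: powr_minus power_divide) (simp add: B_def power_mult_distrib field_simps)
      finally have "(norm (?L l y))\<^sup>2 \<le> (l / 2)\<^sup>2" by (subst (asm) ennreal_le_iff) auto
      then show ?thesis by (rule power2_le_imp_le) (use l in simp)
    qed
    \<comment> \<open>A Chebyshev step: where |u| is at least \<open>l\<close>, the high part is at
      least \<open>l / 2\<close>, so two powers of \<open>l\<close> are exchanged for four times its
      square.\<close>
    have level: "ennreal (l powr (q - 1)) * (if l \<le> norm (?u y) then 1 else 0) \<le> ennreal (4 * l powr (q - 3)) * ennreal ((norm (inv_fourier (?G l) y))\<^sup>2)"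
      if l: "l > 0" for l y
    proof (cases "l \<le> norm (?u y)")
      case True
      have tl: "t l > 0" using l B by (simp add: t_def)
      have "l \<le> norm (?L l y) + norm (inv_fourier (?G l) y)"
        using True unfolding inv_fourier_split[OF H less_imp_le[OF tl], of y] by (rule order_trans[OF _ norm_triangle_ineq])
      then have "l / 2 \<le> norm (inv_fourier (?G l) y)" using low[OF l, of y] by simp
      then have "(l / 2)\<^sup>2 \<le> (norm (inv_fourier (?G l) y))\<^sup>2" using l by (intro power_mono) auto
      then have "4 * l powr (q - 3) * (l / 2)\<^sup>2 \<le> 4 * l powr (q - 3) * (norm (inv_fourier (?G l) y))\<^sup>2"
        by (intro mult_left_mono) auto
      also have "4 * l powr (q - 3) * (l / 2)\<^sup>2 = l powr (q - 3) * l powr 2" using l by (simp add: power_divide)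
      also have "... = l powr (q - 1)" by (simp flip: powr_add)
      finally show ?thesis using True by (simp add: ennreal_leI flip: ennreal_mult)
    qed simp
    let ?W = "\<lambda>l \<xi>. if 0 < l then ennreal (l powr (q - 2 - 1) * ?M l \<xi>) else 0"
    have "(\<integral>\<^sup>+y. ennreal (norm (?u y) powr q * norm y powr (- a)) \<partial>lborel) =
       (\<integral>\<^sup>+y. ennreal q * (\<integral>\<^sup>+l. ?S l y \<partial>lborel) \<partial>lborel)"
    proof (rule nn_integral_cong)
      fix y
      have "ennreal (norm (?u y) powr q * norm y powr (- a)) = ennreal q * (\<integral>\<^sup>+l. (if 0 < l \<and> l \<le> norm (?u y) then ennreal (l powr (q - 1)) else 0) \<partial>lborel) * ennreal (norm y powr (- a))"
        using q2 by (subst ennreal_mult) (auto simp: powr_layer_cake)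
      also have "... = ennreal q * (\<integral>\<^sup>+l. (if 0 < l \<and> l \<le> norm (?u y) then ennreal (l powr (q - 1)) else 0) * ennreal (norm y powr (- a)) \<partial>lborel)"
        by (subst nn_integral_multc) (auto simp: mult.assoc)
      also have "... = ennreal q * (\<integral>\<^sup>+l. ?S l y \<partial>lborel)"
        by (intro arg_cong2[where f="(*)"] nn_integral_cong) auto
      finally show "ennreal (norm (?u y) powr q * norm y powr (- a)) = ..." .
    qed
    also have "... = ennreal q * (\<integral>\<^sup>+y. (\<integral>\<^sup>+l. ?S l y \<partial>lborel) \<partial>lborel)"
      by (rule nn_integral_cmult) measurable
    also have "... = ennreal q * (\<integral>\<^sup>+l. (\<integral>\<^sup>+y. ?S l y \<partial>lborel) \<partial>lborel)"
      by (intro arg_cong2[where f="(*)"] refl lborel_pair.Fubini'[symmetric]) measurable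
    also have "... \<le> ennreal q * (\<integral>\<^sup>+l. (\<integral>\<^sup>+\<xi>. ennreal (4 * C1) * (?Ha \<xi> * ?W l \<xi>) \<partial>lborel) \<partial>lborel)"
    proof (rule mult_left_mono[OF nn_integral_mono])
      fix l :: real
      show "(\<integral>\<^sup>+y. ?S l y \<partial>lborel)
        \<le> (\<integral>\<^sup>+\<xi>. ennreal (4 * C1) * (?Ha \<xi> * ?W l \<xi>) \<partial>lborel)"
      proof (cases "0 < l")
        case l: True
        have tl: "t l > 0" using l B by (simp add: t_def)
        have G: "integrable lborel (?G l)" using tl by (intro integrable_mult_gaussian(2) H) auto
        have [measurable]: "?G l \<in> borel_measurable borel" using G by auto
        have "(\<integral>\<^sup>+y. ?S l y \<partial>lborel)
          \<le> (\<integral>\<^sup>+y. ennreal (4 * l powr (q - 3)) * ennreal ((norm (inv_fourier (?G l) y))\<^sup>2 * norm y powr (- a)) \<partial>lborel)"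
        proof (rule nn_integral_mono)
          fix y
          have "?S l y = 
             ennreal (l powr (q - 1)) * (if l \<le> norm (?u y) then 1 else 0) * ennreal (norm y powr (- a))"
            using l by simp
          also have "... \<le> ennreal (4 * l powr (q - 3)) * ennreal ((norm (inv_fourier (?G l) y))\<^sup>2) * ennreal (norm y powr (- a))"
            by (intro mult_right_mono level l) auto
          finally show "?S l y \<le>
             ennreal (4 * l powr (q - 3)) * ennreal ((norm (inv_fourier (?G l) y))\<^sup>2 * norm y powr (- a))"
            by (simp add: ennreal_mult mult.assoc)
        qed
        also have "... = ennreal (4 * l powr (q - 3)) * (\<integral>\<^sup>+y. ennreal ((norm (inv_fourier (?G l) y))\<^sup>2 * norm y powr (- a)) \<partial>lborel)"
          by (rule nn_integral_cmult) measurable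
        also have "... \<le> ennreal (4 * l powr (q - 3)) * (ennreal C1 * (\<integral>\<^sup>+\<xi>. ennreal (norm \<xi> powr a * (norm (?G l \<xi>))\<^sup>2) \<partial>lborel))"
          by (intro mult_left_mono C1(2) G) auto
        also have "... \<le> ennreal (4 * l powr (q - 3)) * (ennreal C1 * (\<integral>\<^sup>+\<xi>. ?Ha \<xi> * ennreal (?M l \<xi>) \<partial>lborel))"
        proof (intro mult_left_mono nn_integral_mono)
          fix \<xi>
          have "(norm (?G l \<xi>))\<^sup>2 = (norm (H \<xi>))\<^sup>2 * (1 - exp (- (t l * (norm \<xi>)\<^sup>2)))\<^sup>2"
            by (simp add: norm_mult power_mult_distrib del: of_real_diff)
          also have "... \<le> (norm (H \<xi>))\<^sup>2 * min 1 (t l * (norm \<xi>)\<^sup>2)"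
            using tl by (intro mult_left_mono one_minus_exp_sq_le) auto
          also have "t l * (norm \<xi>)\<^sup>2 = B powr d * (norm \<xi>)\<^sup>2 * l powr (- d)"
            using B l by (simp add: t_def powr_divide powr_minus field_simps)
          finally have "norm \<xi> powr a * (norm (?G l \<xi>))\<^sup>2 \<le> norm \<xi> powr a * ((norm (H \<xi>))\<^sup>2 * ?M l \<xi>)"
            by (intro mult_left_mono) auto
          then show "ennreal (norm \<xi> powr a * (norm (?G l \<xi>))\<^sup>2) \<le> ?Ha \<xi> * ennreal (?M l \<xi>)"
            by (subst ennreal_mult[symmetric]) (auto intro!: ennreal_leI simp: mult.assoc)
        qed auto
        also have "... = ennreal (4 * C1) * (ennreal (l powr (q - 3)) * (\<integral>\<^sup>+\<xi>. ?Ha \<xi> * ennreal (?M l \<xi>) \<partial>lborel))"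
          using C1(1) by (simp add: ennreal_mult mult_ac)
        also have "... = ennreal (4 * C1) * (\<integral>\<^sup>+\<xi>. ennreal (l powr (q - 3)) * (?Ha \<xi> * ennreal (?M l \<xi>)) \<partial>lborel)"
          by (subst nn_integral_cmult) auto
        also have "... = ennreal (4 * C1) * (\<integral>\<^sup>+\<xi>. ?Ha \<xi> * ?W l \<xi> \<partial>lborel)"
          by (rule arg_cong2[where f="(*)", OF refl], rule nn_integral_cong) (use l in \<open>simp add: ennreal_mult' mult_ac\<close>)
        also have "... = (\<integral>\<^sup>+\<xi>. ennreal (4 * C1) * (?Ha \<xi> * ?W l \<xi>) \<partial>lborel)"
          by (rule nn_integral_cmult[symmetric]) measurable
        finally show ?thesis .
      qed (auto cong: if_cong)
    qed auto
    also have "... = ennreal q * (\<integral>\<^sup>+\<xi>. (\<integral>\<^sup>+l. ennreal (4 * C1) * (?Ha \<xi> * ?W l \<xi>) \<partial>lborel) \<partial>lborel)"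
      by (intro arg_cong2[where f="(*)"] refl lborel_pair.Fubini') measurable
    also have "... = ennreal q * (\<integral>\<^sup>+\<xi>. ennreal (4 * C1) * (?Ha \<xi> * (\<integral>\<^sup>+l. ?W l \<xi> \<partial>lborel)) \<partial>lborel)"
      by (rule arg_cong2[where f="(*)", OF refl], rule nn_integral_cong, subst nn_integral_cmult, measurable, subst nn_integral_cmult, measurable)
    also have "... \<le> ennreal q * (\<integral>\<^sup>+\<xi>. ennreal (4 * C1 * (c * B powr (q - 2))) * ?Hs \<xi> \<partial>lborel)"
    proof (intro mult_left_mono nn_integral_mono)
      fix \<xi> :: 'a
      have "(\<integral>\<^sup>+l. ?W l \<xi> \<partial>lborel) = (\<integral>\<^sup>+l. ennreal (l powr (q - 2 - 1) * ?M l \<xi>) * indicator {0<..} l \<partial>lborel)"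
        by (intro nn_integral_cong) auto
      also have "... \<le> ennreal ((B powr d * (norm \<xi>)\<^sup>2) powr ((q - 2) / d) * c)"
        unfolding c_def using q2 qd by (intro nn_integral_powr_min) auto
      \<comment> \<open>The exponents were arranged for this:
        \<open>2 * ((q - 2) / d) = 2 * s - a\<close>, exactly the power that raises |\<xi>|^a to
        |\<xi>|^(2s).\<close>
      also have "(B powr d * (norm \<xi>)\<^sup>2) powr ((q - 2) / d) = B powr (q - 2) * norm \<xi> powr (2 * s - a)"
      proof (cases "\<xi> = 0")
        case False
        have e: "d * ((q - 2) / d) = q - 2" using d by simp
        have e': "2 * ((q - 2) / d) = 2 * s - a" using N unfolding q' d_def by (simp add: field_simps)
        have "(B powr d * (norm \<xi>)\<^sup>2) powr ((q - 2) / d) = (B powr d * norm \<xi> powr 2) powr ((q - 2) / d)"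
          using False by simp
        also have "... = B powr (q - 2) * norm \<xi> powr (2 * s - a)" 
          by (simp only: powr_mult powr_powr e e')
        finally show ?thesis .
      qed simp
      finally have "ennreal (4 * C1) * (?Ha \<xi> * (\<integral>\<^sup>+l. ?W l \<xi> \<partial>lborel)) \<le>
         ennreal (4 * C1) * (?Ha \<xi> * ennreal (B powr (q - 2) * norm \<xi> powr (2 * s - a) * c))"
        by (intro mult_left_mono) auto
      also have "... = ennreal (4 * C1 * (c * B powr (q - 2)) * ((norm \<xi> powr (2 * s - a) * norm \<xi> powr a) * (norm (H \<xi>))\<^sup>2))"
        using C1(1) c by (simp add: mult_ac flip: ennreal_mult)
      also have "norm \<xi> powr (2 * s - a) * norm \<xi> powr a = norm \<xi> powr (2 * s)" by (simp flip: powr_add)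
      finally show "ennreal (4 * C1) * (?Ha \<xi> * (\<integral>\<^sup>+l. ?W l \<xi> \<partial>lborel))
        \<le> ennreal (4 * C1 * (c * B powr (q - 2))) * ?Hs \<xi>"
        using C1(1) c by (simp add: ennreal_mult)
    qed auto
    also have "... = ennreal q * (ennreal (4 * C1 * (c * B powr (q - 2))) * (\<integral>\<^sup>+\<xi>. ?Hs \<xi> \<partial>lborel))"
      by (subst nn_integral_cmult) auto
    also have "... \<le> ennreal q * (ennreal (4 * C1 * (c * B powr (q - 2))) * ennreal f)"
      by (intro mult_left_mono Hf) auto
    also have "... = ennreal (q * (4 * C1 * (c * B powr (q - 2))) * f)"
      using q2 C1(1) c f by (simp add: mult_ac flip: ennreal_mult)
    also have "q * (4 * C1 * (c * B powr (q - 2))) * f = C * f powr (q / 2)"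
    proof -
      have "B powr (q - 2) = (2 * sqrt K) powr (q - 2) * sqrt f powr (q - 2)"
        unfolding B_def real_sqrt_mult mult.assoc[symmetric] by (rule powr_mult)
      moreover have "sqrt f powr (q - 2) * f = f powr (q / 2)"
      proof -
        have "sqrt f powr (q - 2) * f = f powr (1 / 2 * (q - 2)) * f powr 1"
          using f by (simp add: powr_powr powr_half_sqrt[symmetric])
        also have "... = f powr (1 / 2 * (q - 2) + 1)" by (rule powr_add[symmetric])
        also have "1 / 2 * (q - 2) + 1 = q / 2" by (simp add: field_simps)
        finally show ?thesis .
      qed
      ultimately show ?thesis by (simp add: C_def mult_ac)
    qed
    finally show ?thesis .
  qed
  ultimately show ?thesis using that by blast
qed

subsection \<open>Gaussian averages of integrable functions\<close>

text \<open>Outer regularity provides \<open>U\<close> and inner regularity provides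
  \<open>K\<close>, each within \<open>e / 2\<close>.\<close>

lemma finite_measure_compact_open_approx:
  fixes A :: "'a::euclidean_space set"
  assumes A: "A \<in> sets borel" "emeasure lborel A < \<infinity>" and e: "0 < e"
  obtains K U where "compact K" "open U" "K \<subseteq> A" "A \<subseteq> U" "emeasure lborel (U - K) \<le> ennreal e"
proof -
  have e2: "0 < e / 2" using e by simp
  obtain U where U: "open U" "A \<subseteq> U" "emeasure lborel (U - A) < ennreal (e / 2)"
    by (rule outer_regular_lborel[OF A(1) e2])
  \<comment> \<open>Inner regularity is applied to a finite measure, hence Lebesgue measure
    restricted to \<open>A\<close>.\<close>
  let ?M = "density lborel (indicator A)"
  have MA: "emeasure ?M X = emeasure lborel (A \<inter> X)" if "X \<in> sets borel" for X
    using that A by (simp add: emeasure_density nn_integral_indicator flip: indicator_inter_arith)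
  have "emeasure ?M A = (SUP K\<in>{K. K \<subseteq> A \<and> compact K}. emeasure ?M K)"
    using A MA[of UNIV] by (intro inner_regular) (auto simp: less_top[symmetric])
  also have "(SUP K\<in>{K. K \<subseteq> A \<and> compact K}. emeasure ?M K) = (SUP K\<in>{K. K \<subseteq> A \<and> compact K}. emeasure lborel K)"
  proof (rule SUP_cong[OF refl])
    fix K assume "K \<in> {K. K \<subseteq> A \<and> compact K}"
    then have "A \<inter> K = K" "K \<in> sets borel" by (auto intro: borel_compact)
    then show "emeasure ?M K = emeasure lborel K" using MA[of K] by simp
  qed
  finally have sup: "emeasure lborel A = (SUP K\<in>{K. K \<subseteq> A \<and> compact K}. emeasure lborel K)"
    using MA[of A] A by simp
  have "(SUP K\<in>{K. K \<subseteq> A \<and> compact K}. emeasure lborel K) < emeasure lborel A + ennreal (e / 2)"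
    using A e unfolding sup[symmetric] by (simp add: ennreal_add_left_cancel_less less_top[symmetric])
  have "\<exists>K\<in>{K. K \<subseteq> A \<and> compact K}. emeasure lborel A < emeasure lborel K + ennreal (e / 2)"
    by (rule SUP_approx_ennreal[OF _ _ sup]) (use A e in \<open>auto simp: less_top[symmetric]\<close>)
  then obtain K where K: "K \<subseteq> A" "compact K" "emeasure lborel A < emeasure lborel K + ennreal (e / 2)"
    by auto
  have Km: "K \<in> sets borel" "U \<in> sets borel" using K U by (auto intro: borel_compact)
  have "emeasure lborel A = emeasure lborel K + emeasure lborel (A - K)"
    using K Km A by (subst plus_emeasure) (auto simp: Un_absorb1)
  moreover have Kfin: "emeasure lborel K < \<infinity>"
    using emeasure_mono[of K A lborel] K A by (auto simp: le_less_trans)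
  ultimately have AK: "emeasure lborel (A - K) \<le> ennreal (e / 2)"
    using K(3) by (simp add: ennreal_add_left_cancel_less less_imp_le)
  have "emeasure lborel (U - K) \<le> emeasure lborel ((U - A) \<union> (A - K))"
    using Km A U by (intro emeasure_mono) auto
  also have "... \<le> emeasure lborel (U - A) + emeasure lborel (A - K)"
    using Km A U by (intro emeasure_subadditive) auto
  also have "... \<le> ennreal (e / 2) + ennreal (e / 2)"
    using U AK by (intro add_mono) auto
  also have "... = ennreal e" using e by (simp flip: ennreal_plus)
  finally show ?thesis using that K U by blast
qed

lemma nn_integral_lborel_translate:
  fixes f :: "'a::euclidean_space \<Rightarrow> ennreal"
  assumes "f \<in> borel_measurable borel"
  shows "(\<integral>\<^sup>+x. f (x + v) \<partial>lborel) = (\<integral>\<^sup>+x. f x \<partial>lborel)"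
  using nn_integral_lborel_affine[of 1 f v] assms by (simp add: add.commute)

text \<open>By approximation with simple functions it suffices to treat an indicator. With
  \<open>A\<close> squeezed between a compact \<open>K\<close> and an open \<open>U\<close>, a shift
  too short to lead from \<open>K\<close> out of \<open>U\<close> changes the indicator at
  \<open>x\<close> only if \<open>x\<close> or \<open>x + v\<close> lies in the small set
  \<open>U - K\<close>.\<close>

lemma translation_continuous_L1:
  fixes h :: "'a::euclidean_space \<Rightarrow> 'b::{banach, second_countable_topology}"
  assumes "integrable lborel h" 
  shows "\<And>e. 0 < e \<Longrightarrow> \<exists>d>0. \<forall>v. norm v < d \<longrightarrow> (\<integral>\<^sup>+x. ennreal (norm (h (x + v) - h x)) \<partial>lborel) \<le> ennreal e"
  using assms
proof (induct h rule: integrable_induct)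
  case (base A c)
  \<comment> \<open>The halving pays for the two copies of \<open>U - K\<close>; the
    \<open>+ 1\<close> covers \<open>c = 0\<close>.\<close>
  define e' where "e' = e / (norm c + 1) / 2"
  have e': "e' > 0" using base.prems by (simp add: e'_def add_nonneg_pos)
  have A: "A \<in> sets borel" "emeasure lborel A < \<infinity>" using base by auto
  obtain K U where KU: "compact K" "open U" "K \<subseteq> A" "A \<subseteq> U" "emeasure lborel (U - K) \<le> ennreal e'"
    by (rule finite_measure_compact_open_approx[OF A e'])
  obtain d where d: "d > 0" "(\<Union>x\<in>K. ball x d) \<subseteq> U"
    using compact_subset_open_imp_ball_epsilon_subset[OF KU(1,2)] KU by blast
  have [measurable]: "U - K \<in> sets borel" using KU by (auto intro: borel_compact)
  have near: "y \<in> U" if "x \<in> K" "norm (y - x) < d" for x y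
  proof -
    have "y \<in> ball x d" using that by (simp add: dist_norm norm_minus_commute)
    then show ?thesis using d(2) that(1) by blast
  qed
  have le2: "z \<le> z * 2" for z :: ennreal by (simp add: mult_2_right)
  have "(\<integral>\<^sup>+x. ennreal (norm (indicat_real A (x + v) *\<^sub>R c - indicat_real A x *\<^sub>R c)) \<partial>lborel) \<le> ennreal e"
    if v: "norm v < d" for v
  proof -
    have "(\<integral>\<^sup>+x. ennreal (norm (indicat_real A (x + v) *\<^sub>R c - indicat_real A x *\<^sub>R c)) \<partial>lborel) \<le>
      (\<integral>\<^sup>+x. ennreal (norm c) * (indicator (U - K) (x + v) + indicator (U - K) x) \<partial>lborel)"
    proof (rule nn_integral_mono)
      fix x :: 'a
      have "x + v \<in> U" if "x \<in> K" using near[OF that, of "x + v"] v by simp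
      moreover have "x \<in> U" if "x + v \<in> K" using near[OF that, of x] v by simp
      ultimately show "ennreal (norm (indicat_real A (x + v) *\<^sub>R c - indicat_real A x *\<^sub>R c)) \<le>
        ennreal (norm c) * (indicator (U - K) (x + v) + indicator (U - K) x)"
        using KU(3,4) le2[of "ennreal (norm c)"] by (auto simp: indicator_def)
    qed
    also have "... = ennreal (norm c) * (emeasure lborel (U - K) + emeasure lborel (U - K))"
      by (simp add: nn_integral_cmult nn_integral_add nn_integral_lborel_translate[of "indicator (U - K)"])
    also have "... \<le> ennreal (norm c) * (ennreal e' + ennreal e')"
      by (intro mult_left_mono add_mono KU) auto
    also have "... = ennreal (norm c * (2 * e'))" using e' by (simp add: ennreal_mult flip: ennreal_plus)
    also have "... \<le> ennreal e" 
    proof (rule ennreal_leI)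
      have k: "norm c + 1 > 0" by (simp add: add_nonneg_pos)
      have "norm c * (2 * e') \<le> (norm c + 1) * (2 * e')" using e' by (intro mult_right_mono) auto
      also have "... = e" using k unfolding e'_def by (simp only: times_divide_eq_right) simp
      finally show "norm c * (2 * e') \<le> e" .
    qed
    finally show ?thesis .
  qed
  then show ?case using d(1) by blast
next
  case (add f g)
  have [measurable]: "f \<in> borel_measurable borel" "g \<in> borel_measurable borel" using add by auto
  have e2: "e / 2 > 0" using add.prems by simp
  obtain d1 where d1: "d1 > 0" "\<And>v. norm v < d1 \<Longrightarrow> (\<integral>\<^sup>+x. ennreal (norm (f (x + v) - f x)) \<partial>lborel) \<le> ennreal (e / 2)"
    using add(2)[OF e2] by blast
  obtain d2 where d2: "d2 > 0" "\<And>v. norm v < d2 \<Longrightarrow> (\<integral>\<^sup>+x. ennreal (norm (g (x + v) - g x)) \<partial>lborel) \<le> ennreal (e / 2)"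
    using add(4)[OF e2] by blast
  have "(\<integral>\<^sup>+x. ennreal (norm (f (x + v) + g (x + v) - (f x + g x))) \<partial>lborel) \<le> ennreal e"
    if "norm v < min d1 d2" for v
  proof -
    have "(\<integral>\<^sup>+x. ennreal (norm (f (x + v) + g (x + v) - (f x + g x))) \<partial>lborel) \<le>
       (\<integral>\<^sup>+x. ennreal (norm (f (x + v) - f x)) + ennreal (norm (g (x + v) - g x)) \<partial>lborel)"
      by (intro nn_integral_mono) (auto simp: add_diff_add norm_triangle_ineq ennreal_leI simp flip: ennreal_plus)
    also have "... = (\<integral>\<^sup>+x. ennreal (norm (f (x + v) - f x)) \<partial>lborel) + (\<integral>\<^sup>+x. ennreal (norm (g (x + v) - g x)) \<partial>lborel)"
      by (intro nn_integral_add) measurable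
    also have "... \<le> ennreal (e / 2) + ennreal (e / 2)"
      using that by (intro add_mono d1 d2) auto
    also have "... = ennreal e" using add.prems by (simp flip: ennreal_plus)
    finally show ?thesis .
  qed
  then show ?case using d1(1) d2(1) by (intro exI[of _ "min d1 d2"]) auto
next
  case (lim f s)
  have [measurable]: "f \<in> borel_measurable borel" "\<And>i. s i \<in> borel_measurable borel" using lim by auto
  have e3: "e / 3 > 0" using lim.prems by simp
  \<comment> \<open>The approximants are bounded by \<open>2 * norm (f x)\<close>, so their distance
    to \<open>f\<close> is dominated by three times its norm.\<close>
  have "(\<lambda>i. \<integral>\<^sup>+x. ennreal (norm (s i x - f x)) \<partial>lborel) \<longlonglongrightarrow> (\<integral>\<^sup>+(x::'a). 0 \<partial>lborel)"
  proof (rule nn_integral_dominated_convergence[where w="\<lambda>x. ennreal (3 * norm (f x))"])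
    have "(\<integral>\<^sup>+x. ennreal (3 * norm (f x)) \<partial>lborel) = 3 * (\<integral>\<^sup>+x. ennreal (norm (f x)) \<partial>lborel)"
      by (simp add: ennreal_mult nn_integral_cmult)
    then show "(\<integral>\<^sup>+x. ennreal (3 * norm (f x)) \<partial>lborel) < \<infinity>"
      using lim(5) by (simp add: integrable_iff_bounded ennreal_mult_less_top)
    show "AE x in lborel. ennreal (norm (s i x - f x)) \<le> ennreal (3 * norm (f x))" for i
    proof (intro AE_I2 ennreal_leI)
      fix x
      show "norm (s i x - f x) \<le> 3 * norm (f x)"
        using norm_triangle_ineq4[of "s i x" "f x"] lim(4)[of x i] by simp
    qed
    show "AE x in lborel. (\<lambda>i. ennreal (norm (s i x - f x))) \<longlonglongrightarrow> 0"
    proof (intro AE_I2)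
      fix x
      have "(\<lambda>i. norm (s i x - f x)) \<longlonglongrightarrow> 0"
        using lim(3)[of x] by (simp add: LIM_zero_iff tendsto_norm_zero_iff)
      then show "(\<lambda>i. ennreal (norm (s i x - f x))) \<longlonglongrightarrow> 0"
        using tendsto_ennrealI by fastforce
    qed
  qed measurable
  then have "\<forall>\<^sub>F i in sequentially. (\<integral>\<^sup>+x. ennreal (norm (s i x - f x)) \<partial>lborel) < ennreal (e / 3)"
    using e3 by (intro order_tendstoD) auto
  then obtain i where i: "(\<integral>\<^sup>+x. ennreal (norm (s i x - f x)) \<partial>lborel) \<le> ennreal (e / 3)"
    by (auto simp: eventually_sequentially intro: less_imp_le)
  obtain d where d: "d > 0" "\<And>v. norm v < d \<Longrightarrow> (\<integral>\<^sup>+x. ennreal (norm (s i (x + v) - s i x)) \<partial>lborel) \<le> ennreal (e / 3)"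
    using lim(2)[OF e3, of i] by blast
  have "(\<integral>\<^sup>+x. ennreal (norm (f (x + v) - f x)) \<partial>lborel) \<le> ennreal e" if v: "norm v < d" for v
  proof -
    have "(\<integral>\<^sup>+x. ennreal (norm (f (x + v) - f x)) \<partial>lborel) \<le>
      (\<integral>\<^sup>+x. ennreal (norm (s i (x + v) - f (x + v))) + (ennreal (norm (s i (x + v) - s i x)) + ennreal (norm (s i x - f x))) \<partial>lborel)"
    proof (rule nn_integral_mono)
      fix x
      have "norm (f (x + v) - f x) = norm (- (s i (x + v) - f (x + v)) + ((s i (x + v) - s i x) + (s i x - f x)))"
        by simp
      also have "... \<le> norm (s i (x + v) - f (x + v)) + (norm (s i (x + v) - s i x) + norm (s i x - f x))"
        using norm_triangle_ineq[of "- (s i (x + v) - f (x + v))" "(s i (x + v) - s i x) + (s i x - f x)"] 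
          norm_triangle_ineq[of "s i (x + v) - s i x" "s i x - f x"] by (simp add: norm_minus_commute)
      finally show "ennreal (norm (f (x + v) - f x)) \<le> ennreal (norm (s i (x + v) - f (x + v))) + (ennreal (norm (s i (x + v) - s i x)) + ennreal (norm (s i x - f x)))"
        by (simp add: ennreal_leI flip: ennreal_plus)
    qed
    also have "... = (\<integral>\<^sup>+x. ennreal (norm (s i (x + v) - f (x + v))) \<partial>lborel) + ((\<integral>\<^sup>+x. ennreal (norm (s i (x + v) - s i x)) \<partial>lborel) + (\<integral>\<^sup>+x. ennreal (norm (s i x - f x)) \<partial>lborel))"
      by (subst nn_integral_add, measurable, subst nn_integral_add, measurable)
    also have "(\<integral>\<^sup>+x. ennreal (norm (s i (x + v) - f (x + v))) \<partial>lborel) = (\<integral>\<^sup>+x. ennreal (norm (s i x - f x)) \<partial>lborel)"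
      by (rule nn_integral_lborel_translate) measurable
    also have "(\<integral>\<^sup>+x. ennreal (norm (s i x - f x)) \<partial>lborel) + ((\<integral>\<^sup>+x. ennreal (norm (s i (x + v) - s i x)) \<partial>lborel) + (\<integral>\<^sup>+x. ennreal (norm (s i x - f x)) \<partial>lborel))
       \<le> ennreal (e / 3) + (ennreal (e / 3) + ennreal (e / 3))"
      by (intro add_mono i d v)
    also have "... = ennreal e" using lim.prems by (simp flip: ennreal_plus)
    finally show ?thesis .
  qed
  then show ?case using d(1) by blast
qed

text \<open>Convolution of \<open>h\<close> with the Gaussian probability density of width
  \<open>d\<close>, substituted so that the kernel is fixed and \<open>d\<close> sits only in the
  argument of \<open>h\<close>.\<close>

definition gauss_mean :: "real \<Rightarrow> ('a::euclidean_space \<Rightarrow> complex) \<Rightarrow> 'a \<Rightarrow> complex" where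
  "gauss_mean d h x = (\<integral>z. (pi powr (- real DIM('a) / 2) * exp (- (norm z)\<^sup>2)) *\<^sub>R h (x + d *\<^sub>R z) \<partial>lborel)"

text \<open>Approximate identity: the L1 distance from the average to \<open>h\<close> is at most
  the Gaussian average of the translation modulus \<open>om\<close>. The modulus is bounded by
  \<open>2 * J\<close> and tends to 0 at the origin, so dominated convergence gives L1 convergence,
  and a subsequence converges almost everywhere.\<close>

theorem gauss_mean_tendsto_AE:
  fixes h :: "'a::euclidean_space \<Rightarrow> complex"
  assumes h: "integrable lborel h"
  obtains r where "strict_mono (r :: nat \<Rightarrow> nat)" "AE x in lborel. (\<lambda>k. gauss_mean (1 / real (Suc (r k))) h x) \<longlonglongrightarrow> h x"
proof -
  have [measurable]: "h \<in> borel_measurable borel" using h by auto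
  define w where "w z = pi powr (- real DIM('a) / 2) * exp (- (norm z)\<^sup>2)" for z :: 'a
  have w0: "w z \<ge> 0" for z by (simp add: w_def)
  have [measurable]: "w \<in> borel_measurable borel" unfolding w_def by measurable
  have wn: "(\<integral>\<^sup>+z. ennreal (w z) \<partial>lborel) = 1"
    using gaussian_integral(2)[of 1 "0::'a"]
    by (simp add: w_def ennreal_mult nn_integral_cmult) (simp flip: ennreal_mult powr_add)
  have wi: "integrable lborel w" using wn w0 by (intro integrableI_nonneg) auto
  have w1: "(\<integral>z. w z \<partial>lborel) = 1"
    using nn_integral_eq_integral[OF wi] wn w0 by (simp add: integral_nonneg_AE)
  define om where "om v = (\<integral>\<^sup>+x. ennreal (norm (h (x + v) - h x)) \<partial>lborel)" for v
  have [measurable]: "om \<in> borel_measurable borel" unfolding om_def by measurable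
  define J where "J = (\<integral>\<^sup>+x. ennreal (norm (h x)) \<partial>lborel)"
  have J: "J < \<infinity>" using h unfolding J_def by (simp add: integrable_iff_bounded)
  have om_le: "om v \<le> 2 * J" for v
  proof -
    have "om v \<le> (\<integral>\<^sup>+x. ennreal (norm (h (x + v))) + ennreal (norm (h x)) \<partial>lborel)"
      unfolding om_def by (intro nn_integral_mono) (simp add: norm_triangle_ineq4 ennreal_leI flip: ennreal_plus)
    also have "... = (\<integral>\<^sup>+x. ennreal (norm (h (x + v))) \<partial>lborel) + J"
      unfolding J_def by (rule nn_integral_add) measurable
    also have "(\<integral>\<^sup>+x. ennreal (norm (h (x + v))) \<partial>lborel) = J"
      unfolding J_def by (rule nn_integral_lborel_translate) measurable
    finally show ?thesis by (simp add: mult_2)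
  qed
  have om0: "(om \<longlongrightarrow> 0) (nhds 0)"
  proof (rule order_tendstoI)
    fix e :: ennreal assume "0 < e"
    then obtain m where m: "0 < m" "m < e" using dense by blast
    define e' where "e' = enn2real m"
    have "m < top" using m(2) by (rule order.strict_trans2) simp
    then have e': "0 < e'" "ennreal e' < e" using m by (auto simp: e'_def enn2real_positive_iff)
    obtain d where d: "d > 0" "\<And>v. norm v < d \<Longrightarrow> om v \<le> ennreal e'"
      using translation_continuous_L1[OF h e'(1)] unfolding om_def by blast
    then show "\<forall>\<^sub>F v in nhds 0. om v < e"
      unfolding eventually_nhds_metric using e'(2) by (auto intro!: exI[of _ d] intro: le_less_trans)
  qed simp
  let ?d = "\<lambda>k. 1 / real (Suc k)"
  let ?u = "\<lambda>k x. gauss_mean (?d k) h x - h x"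
  have um [measurable]: "gauss_mean (?d k) h \<in> borel_measurable borel" for k
    unfolding gauss_mean_def by measurable
  have bound: "(\<integral>\<^sup>+x. ennreal (norm (?u k x)) \<partial>lborel) \<le> (\<integral>\<^sup>+z. ennreal (w z) * om (?d k *\<^sub>R z) \<partial>lborel)" for k
  proof -
    have d: "?d k \<noteq> 0" by simp
    have "ennreal (norm (?u k x)) \<le> (\<integral>\<^sup>+z. ennreal (w z) * ennreal (norm (h (x + ?d k *\<^sub>R z) - h x)) \<partial>lborel)" for x
    proof -
      have hi: "integrable lborel (\<lambda>z. h (x + ?d k *\<^sub>R z))"
        using integral_lebesgue_affine(2)[OF d, of h x] h
        by (simp add: integrable_completion measurable_completion)
      have whi: "integrable lborel (\<lambda>z. w z *\<^sub>R h (x + ?d k *\<^sub>R z))"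
      proof (rule Bochner_Integration.integrable_bound[OF integrable_scaleR_right[of "pi powr (- real DIM('a) / 2)", OF hi]])
        show "AE z in lborel. norm (w z *\<^sub>R h (x + ?d k *\<^sub>R z)) \<le> norm (pi powr (- real DIM('a) / 2) *\<^sub>R h (x + ?d k *\<^sub>R z))"
          by (intro AE_I2) (auto simp: w_def intro!: mult_left_le_one_le)
      qed measurable
      have whx: "integrable lborel (\<lambda>z. w z *\<^sub>R h x)" using wi by simp
      have "?u k x = (\<integral>z. w z *\<^sub>R h (x + ?d k *\<^sub>R z) - w z *\<^sub>R h x \<partial>lborel)"
        unfolding gauss_mean_def w_def[symmetric] using whi whx wi
        by (subst Bochner_Integration.integral_diff) (auto simp: w1)
      also have "ennreal (norm ...) \<le> (\<integral>\<^sup>+z. ennreal (norm (w z *\<^sub>R h (x + ?d k *\<^sub>R z) - w z *\<^sub>R h x)) \<partial>lborel)"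
        using whi whx by (intro integral_norm_bound_ennreal) auto
      also have "... = (\<integral>\<^sup>+z. ennreal (w z) * ennreal (norm (h (x + ?d k *\<^sub>R z) - h x)) \<partial>lborel)"
        using w0 by (intro nn_integral_cong) (simp add: ennreal_mult'[symmetric] flip: scaleR_diff_right)
      finally show ?thesis .
    qed
    then have "(\<integral>\<^sup>+x. ennreal (norm (?u k x)) \<partial>lborel) \<le> (\<integral>\<^sup>+x. (\<integral>\<^sup>+z. ennreal (w z) * ennreal (norm (h (x + ?d k *\<^sub>R z) - h x)) \<partial>lborel) \<partial>lborel)"
      by (rule nn_integral_mono)
    also have "... = (\<integral>\<^sup>+z. (\<integral>\<^sup>+x. ennreal (w z) * ennreal (norm (h (x + ?d k *\<^sub>R z) - h x)) \<partial>lborel) \<partial>lborel)"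
      by (rule lborel_pair.Fubini') measurable
    also have "... = (\<integral>\<^sup>+z. ennreal (w z) * om (?d k *\<^sub>R z) \<partial>lborel)"
      unfolding om_def by (intro nn_integral_cong nn_integral_cmult) measurable
    finally show ?thesis .
  qed
  have ui: "integrable lborel (?u k)" for k
  proof (rule integrableI_bounded)
    note bound[of k]
    also have "(\<integral>\<^sup>+z. ennreal (w z) * om (?d k *\<^sub>R z) \<partial>lborel) \<le> (\<integral>\<^sup>+z. ennreal (w z) * (2 * J) \<partial>lborel)"
      by (intro nn_integral_mono mult_left_mono om_le) auto
    also have "... = 2 * J" by (simp add: nn_integral_multc wn)
    also have "... < \<infinity>" using J by (simp add: ennreal_mult_less_top)
    finally show "(\<integral>\<^sup>+x. ennreal (norm (?u k x)) \<partial>lborel) < \<infinity>" .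
  qed measurable
  have "(\<lambda>k. \<integral>\<^sup>+z. ennreal (w z) * om (?d k *\<^sub>R z) \<partial>lborel) \<longlonglongrightarrow> (\<integral>\<^sup>+(z::'a). 0 \<partial>lborel)"
  proof (rule nn_integral_dominated_convergence[where w="\<lambda>z. ennreal (w z) * (2 * J)"])
    show "(\<integral>\<^sup>+z. ennreal (w z) * (2 * J) \<partial>lborel) < \<infinity>" using J by (simp add: nn_integral_multc wn ennreal_mult_less_top)
    show "AE z in lborel. ennreal (w z) * om (?d k *\<^sub>R z) \<le> ennreal (w z) * (2 * J)" for k
      by (intro AE_I2 mult_left_mono om_le) auto
    show "AE z in lborel. (\<lambda>k. ennreal (w z) * om (?d k *\<^sub>R z)) \<longlonglongrightarrow> 0"
    proof (intro AE_I2)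
      fix z :: 'a
      have "(\<lambda>k. ?d k *\<^sub>R z) \<longlonglongrightarrow> 0 *\<^sub>R z" by (intro tendsto_intros LIMSEQ_Suc[OF lim_1_over_n])
      then have "(\<lambda>k. om (?d k *\<^sub>R z)) \<longlonglongrightarrow> 0" by (intro filterlim_compose[OF om0]) simp
      then have "(\<lambda>k. ennreal (w z) * om (?d k *\<^sub>R z)) \<longlonglongrightarrow> ennreal (w z) * 0"
        by (intro ennreal_tendsto_cmult) auto
      then show "(\<lambda>k. ennreal (w z) * om (?d k *\<^sub>R z)) \<longlonglongrightarrow> 0" by simp
    qed
  qed measurable
  then have "(\<lambda>k. \<integral>\<^sup>+z. ennreal (w z) * om (?d k *\<^sub>R z) \<partial>lborel) \<longlonglongrightarrow> 0" by simp
  then have "(\<lambda>k. \<integral>\<^sup>+x. ennreal (norm (?u k x)) \<partial>lborel) \<longlonglongrightarrow> 0"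
    by (rule tendsto_sandwich[OF _ _ tendsto_const, rotated 2]) (use bound in \<open>auto simp del: of_nat_Suc\<close>)
  then have "(\<lambda>k. ennreal (\<integral>x. norm (?u k x) \<partial>lborel)) \<longlonglongrightarrow> ennreal 0"
    using ui by (subst (asm) nn_integral_eq_integral) auto
  then have "(\<lambda>k. \<integral>x. norm (?u k x) \<partial>lborel) \<longlonglongrightarrow> 0"
    by (subst (asm) tendsto_ennreal_iff) (auto intro!: integral_nonneg_AE always_eventually)
  then obtain r where r: "strict_mono r" "AE x in lborel. (\<lambda>k. ?u (r k) x) \<longlonglongrightarrow> 0"
    using tendsto_L1_AE_subseq[of lborel ?u] ui by blast
  from r(2) have "AE x in lborel. (\<lambda>k. gauss_mean (?d (r k)) h x) \<longlonglongrightarrow> h x"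
    by eventually_elim (simp add: LIM_zero_iff)
  then show ?thesis using that r(1) by blast
qed

subsection \<open>Gaussians as Schwartz functions\<close>

text \<open>Polynomials in the coordinates, given by generators so that closure under partial
  derivatives and polynomial growth are inductions. These are the two facts behind the Schwartz
  bounds for Gaussians.\<close>

inductive polyfun :: "(real^'n \<Rightarrow> complex) \<Rightarrow> bool" where
  polyfun_const: "polyfun (\<lambda>x. c)"
| polyfun_coord: "polyfun (\<lambda>x. complex_of_real (x $ i))"
| polyfun_add: "polyfun P \<Longrightarrow> polyfun Q \<Longrightarrow> polyfun (\<lambda>x. P x + Q x)"
| polyfun_mult: "polyfun P \<Longrightarrow> polyfun Q \<Longrightarrow> polyfun (\<lambda>x. P x * Q x)"

lemma polyfun_derivative:
  fixes P :: "real^'n \<Rightarrow> complex"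
  assumes "polyfun P"
  obtains D where "\<And>x. (P has_derivative D x) (at x)" "\<And>i. polyfun (\<lambda>x. D x (axis i 1))"
  using assms
proof (induct P arbitrary: thesis rule: polyfun.induct)
  case (polyfun_const c)
  show ?case by (rule polyfun_const[of "\<lambda>x h. 0"]) (auto intro: polyfun.polyfun_const)
next
  case (polyfun_coord j)
  have d: "((\<lambda>x. complex_of_real (x $ j)) has_derivative (\<lambda>h. complex_of_real (h $ j))) (at x)" for x :: "real^'n"
    by (intro has_derivative_of_real bounded_linear.has_derivative[OF bounded_linear_vec_nth has_derivative_ident])
  show ?case
    by (rule polyfun_coord[of "\<lambda>x h. complex_of_real (h $ j)"]) (auto intro: polyfun.polyfun_const d)
next
  case (polyfun_add P Q)
  obtain D where D: "\<And>x. (P has_derivative D x) (at x)" "\<And>i. polyfun (\<lambda>x. D x (axis i 1))"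
    using polyfun_add(2) by blast
  obtain E where E: "\<And>x. (Q has_derivative E x) (at x)" "\<And>i. polyfun (\<lambda>x. E x (axis i 1))"
    using polyfun_add(4) by blast
  show ?case
    by (rule polyfun_add(5)[of "\<lambda>x h. D x h + E x h"])
       (auto intro: polyfun.intros has_derivative_add D E)
next
  case (polyfun_mult P Q)
  obtain D where D: "\<And>x. (P has_derivative D x) (at x)" "\<And>i. polyfun (\<lambda>x. D x (axis i 1))"
    using polyfun_mult(2) by blast
  obtain E where E: "\<And>x. (Q has_derivative E x) (at x)" "\<And>i. polyfun (\<lambda>x. E x (axis i 1))"
    using polyfun_mult(4) by blast
  show ?case
    by (rule polyfun_mult(5)[of "\<lambda>x h. P x * E x h + D x h * Q x"])
       (intro has_derivative_mult polyfun.polyfun_add polyfun.polyfun_mult polyfun_mult(1) polyfun_mult(3) D E)+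
qed

lemma polyfun_bound:
  fixes P :: "real^'n \<Rightarrow> complex"
  assumes "polyfun P"
  obtains C k where "0 \<le> C" "\<And>x. norm (P x) \<le> C * (1 + norm x) ^ k"
  using assms
proof (induct P arbitrary: thesis rule: polyfun.induct)
  case (polyfun_const c)
  show ?case by (rule polyfun_const[of "norm c" 0]) auto
next
  case (polyfun_coord j)
  show ?case
  proof (rule polyfun_coord[of 1 1])
    show "norm (complex_of_real (x $ j)) \<le> 1 * (1 + norm x) ^ 1" for x :: "real^'n"
      using component_le_norm_cart[of x j] by simp
  qed simp
next
  case (polyfun_add P Q)
  obtain C k where C: "0 \<le> C" "\<And>x. norm (P x) \<le> C * (1 + norm x) ^ k" using polyfun_add(2) by blast
  obtain D l where D: "0 \<le> D" "\<And>x. norm (Q x) \<le> D * (1 + norm x) ^ l" using polyfun_add(4) by blast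
  show ?case
  proof (rule polyfun_add(5)[of "C + D" "k + l"])
    fix x :: "real^'n"
    have 1: "1 \<le> 1 + norm x" by simp
    have "norm (P x + Q x) \<le> C * (1 + norm x) ^ k + D * (1 + norm x) ^ l"
      using norm_triangle_ineq[of "P x" "Q x"] C(2)[of x] D(2)[of x] by linarith
    also have "... \<le> C * (1 + norm x) ^ (k + l) + D * (1 + norm x) ^ (k + l)"
      using C D by (intro add_mono mult_left_mono power_increasing 1) auto
    finally show "norm (P x + Q x) \<le> (C + D) * (1 + norm x) ^ (k + l)" by (simp add: distrib_right)
  qed (use C D in auto)
next
  case (polyfun_mult P Q)
  obtain C k where C: "0 \<le> C" "\<And>x. norm (P x) \<le> C * (1 + norm x) ^ k" using polyfun_mult(2) by blast
  obtain D l where D: "0 \<le> D" "\<And>x. norm (Q x) \<le> D * (1 + norm x) ^ l" using polyfun_mult(4) by blast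
  show ?case
  proof (rule polyfun_mult(5)[of "C * D" "k + l"])
    fix x :: "real^'n"
    have "norm (P x * Q x) \<le> (C * (1 + norm x) ^ k) * (D * (1 + norm x) ^ l)"
      unfolding norm_mult using C D by (intro mult_mono) auto
    then show "norm (P x * Q x) \<le> (C * D) * (1 + norm x) ^ (k + l)" by (simp add: power_add mult_ac)
  qed (use C D in auto)
qed

text \<open>The real shift \<open>w\<close> is needed for uniqueness: a Gaussian average of \<open>k(y) exp(-|y|\<^sup>2)\<close> is
  an integral of \<open>k\<close> against a shifted, unmodulated Gaussian.\<close>

definition gaussfun :: "real \<Rightarrow> real^'n \<Rightarrow> real^'n \<Rightarrow> real^'n \<Rightarrow> complex" where
  "gaussfun a w v x = exp (complex_of_real (- a * (x \<bullet> x) + w \<bullet> x) + \<i> * complex_of_real (v \<bullet> x))"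

lemma gaussfun_eq:
  "gaussfun a w v x = complex_of_real (exp (- a * (norm x)\<^sup>2 + w \<bullet> x)) * cis (v \<bullet> x)"
  unfolding gaussfun_def cis_conv_exp exp_of_real[symmetric] exp_add[symmetric] by (simp add: power2_norm_eq_inner)

lemma has_derivative_gaussfun:
  "(gaussfun a w v has_derivative 
     (\<lambda>h. gaussfun a w v x * (complex_of_real (- 2 * a * (x \<bullet> h) + w \<bullet> h) + \<i> * complex_of_real (v \<bullet> h)))) (at x)"
proof -
  have 1: "((\<lambda>x. complex_of_real (- a * (x \<bullet> x) + w \<bullet> x) + \<i> * complex_of_real (v \<bullet> x)) has_derivative
     (\<lambda>h. complex_of_real (- 2 * a * (x \<bullet> h) + w \<bullet> h) + \<i> * complex_of_real (v \<bullet> h))) (at x)"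
    by (auto intro!: derivative_eq_intros simp: inner_commute algebra_simps)
  have 2: "(exp has_derivative (\<lambda>h. exp y * h)) (at y)" for y :: complex
    using DERIV_exp[of y] unfolding has_field_derivative_def .
  show ?thesis
    using has_derivative_compose[OF 1 2] unfolding gaussfun_def .
qed

lemma iterated_partial_gaussfun:
  fixes w v :: "real^'n"
  shows "\<exists>P. polyfun P \<and> iterated_partial is (gaussfun a w v) = (\<lambda>x. P x * gaussfun a w v x)"
proof (induct "is")
  case Nil
  show ?case by (rule exI[of _ "\<lambda>x. 1"]) (auto intro: polyfun_const)
next
  case (Cons i "is")
  then obtain P where P: "polyfun P" "iterated_partial is (gaussfun a w v) = (\<lambda>x. P x * gaussfun a w v x)" by blast
  obtain D where D: "\<And>x. (P has_derivative D x) (at x)" "\<And>i. polyfun (\<lambda>x. D x (axis i 1))"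
    using polyfun_derivative[OF P(1)] by blast
  \<comment> \<open>The logarithmic derivative of the Gaussian in direction \<open>i\<close>. It is
    affine, so polynomial times Gaussian is stable under differentiation.\<close>
  define L where "L x = complex_of_real (- 2 * a) * complex_of_real (x $ i) + (complex_of_real (w $ i) + \<i> * complex_of_real (v $ i))" for x :: "real^'n"
  have "((\<lambda>x. P x * gaussfun a w v x) has_derivative (\<lambda>h. P x * (gaussfun a w v x * (complex_of_real (- 2 * a * (x \<bullet> h) + w \<bullet> h) + \<i> * complex_of_real (v \<bullet> h))) + D x h * gaussfun a w v x)) (at x)" for x
    by (intro has_derivative_mult D has_derivative_gaussfun)
  then have fd: "frechet_derivative (\<lambda>x. P x * gaussfun a w v x) (at x) = (\<lambda>h. P x * (gaussfun a w v x * (complex_of_real (- 2 * a * (x \<bullet> h) + w \<bullet> h) + \<i> * complex_of_real (v \<bullet> h))) + D x h * gaussfun a w v x)" for x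
    by (rule frechet_derivative_at[symmetric])
  have "iterated_partial (i # is) (gaussfun a w v) = (\<lambda>x. (P x * L x + D x (axis i 1)) * gaussfun a w v x)"
    by (rule ext) (simp add: P(2) fd L_def inner_axis algebra_simps)
  moreover have "polyfun (\<lambda>x. P x * L x + D x (axis i 1))"
    unfolding L_def by (intro polyfun.intros P D)
  ultimately show ?case by blast
qed

text \<open>A single term of the exponential series, whose terms are all nonnegative.\<close>

lemma power_le_fact_exp:
  fixes r :: real
  assumes "0 \<le> r"
  shows "r ^ k \<le> fact k * exp r"
proof -
  have s: "(\<lambda>n. r ^ n /\<^sub>R fact n) sums exp r" by (rule exp_converges)
  have "r ^ k /\<^sub>R fact k \<le> exp r"
    using sum_le_suminf[of "\<lambda>n. r ^ n /\<^sub>R fact n" "{k}"] s assms by (simp add: sums_iff)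
  then show ?thesis by (simp add: divide_simps mult_ac)
qed

text \<open>All polynomial growth is absorbed into one factor \<open>exp (1 + |x|)\<close>;
  completing the square against \<open>- a * |x|^2\<close> then bounds the remaining
  exponent.\<close>

theorem gaussfun_schwartz:
  fixes w v :: "real^'n"
  assumes a: "0 < a"
  shows "gaussfun a w v \<in> schwartz"
  unfolding schwartz_def
proof (intro CollectI allI conjI)
  fix "is" :: "'n list" and x :: "real^'n" and k :: nat
  obtain P where P: "polyfun P" "iterated_partial is (gaussfun a w v) = (\<lambda>x. P x * gaussfun a w v x)"
    using iterated_partial_gaussfun by blast
  obtain D where D: "\<And>x. (P has_derivative D x) (at x)"
    using polyfun_derivative[OF P(1)] by blast
  show "iterated_partial is (gaussfun a w v) differentiable at x"
    unfolding P(2) by (rule differentiableI[OF has_derivative_mult[OF D has_derivative_gaussfun]])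
  obtain C m where C: "0 \<le> C" "\<And>x. norm (P x) \<le> C * (1 + norm x) ^ m"
    using polyfun_bound[OF P(1)] by blast
  \<comment> \<open>The total linear rate in the exponent: 1 from absorbing the polynomial and
    \<open>norm w\<close> from the shift.\<close>
  let ?W = "1 + norm w"
  show "bounded (range (\<lambda>x. norm x ^ k *\<^sub>R iterated_partial is (gaussfun a w v) x))"
    unfolding bounded_iff P(2)
  proof (intro exI ballI, elim imageE, hypsubst)
    fix x :: "real^'n"
    let ?r = "norm x"
    have wx: "w \<bullet> x \<le> norm w * norm x" by (rule norm_cauchy_schwarz)
    have sq: "?W * ?r - a * ?r\<^sup>2 \<le> ?W\<^sup>2 / (4 * a)"
    proof -
      have "0 \<le> (2 * a * ?r - ?W)\<^sup>2 / (4 * a)" using a by simp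
      also have "... = a * ?r\<^sup>2 - ?W * ?r + ?W\<^sup>2 / (4 * a)"
        using a by (simp add: power2_diff power_mult_distrib field_simps) (simp add: power2_eq_square algebra_simps)
      finally show ?thesis by simp
    qed
    have "norm (?r ^ k *\<^sub>R (P x * gaussfun a w v x)) = ?r ^ k * norm (P x) * exp (- a * ?r\<^sup>2 + w \<bullet> x)"
      by (simp add: gaussfun_eq norm_mult)
    also have "... \<le> (1 + ?r) ^ k * (C * (1 + ?r) ^ m) * exp (- a * ?r\<^sup>2 + norm w * ?r)"
      using C wx by (intro mult_mono power_mono) auto
    also have "... = C * ((1 + ?r) ^ (k + m) * exp (- a * ?r\<^sup>2 + norm w * ?r))"
      by (simp add: power_add mult_ac)
    also have "... \<le> C * ((fact (k + m) * exp (1 + ?r)) * exp (- a * ?r\<^sup>2 + norm w * ?r))"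
      using C by (intro mult_left_mono mult_right_mono power_le_fact_exp) auto
    also have "... = C * fact (k + m) * exp (1 + (?W * ?r - a * ?r\<^sup>2))"
      by (simp add: mult.assoc algebra_simps flip: exp_add)
    also have "... \<le> C * fact (k + m) * exp (1 + ?W\<^sup>2 / (4 * a))"
      using C sq by (intro mult_left_mono) auto
    finally show "norm (?r ^ k *\<^sub>R (P x * gaussfun a w v x)) \<le> C * fact (k + m) * exp (1 + ?W\<^sup>2 / (4 * a))" .
  qed
qed

section \<open>Dilations of Schwartz functions\<close>

lemma schwartz_has_derivative:
  assumes "\<phi> \<in> schwartz"
  shows "(iterated_partial is \<phi> has_derivative frechet_derivative (iterated_partial is \<phi>) (at y)) (at y)"
  using assms by (simp add: schwartz_def frechet_derivative_works)

lemma has_derivative_scaled_iterated_partial: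
  assumes "\<phi> \<in> schwartz"
  shows "((\<lambda>x. c *\<^sub>R iterated_partial is \<phi> (t *\<^sub>R x)) has_derivative
     (\<lambda>h. c *\<^sub>R frechet_derivative (iterated_partial is \<phi>) (at (t *\<^sub>R x)) (t *\<^sub>R h))) (at x)"
  by (intro has_derivative_scaleR_right has_derivative_compose[OF _ schwartz_has_derivative[OF assms]]
      derivative_intros has_derivative_ident)

lemma iterated_partial_scaleR:
  assumes "\<phi> \<in> schwartz"
  shows "iterated_partial is (\<lambda>x. \<phi> (t *\<^sub>R x)) = (\<lambda>x. t ^ length is *\<^sub>R iterated_partial is \<phi> (t *\<^sub>R x))"
proof (induct "is")
  case (Cons i "is")
  let ?f = "iterated_partial is \<phi>"
  have d: "(?f has_derivative frechet_derivative ?f (at y)) (at y)" for y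
    by (rule schwartz_has_derivative[OF assms])
  have "frechet_derivative (\<lambda>x. t ^ length is *\<^sub>R ?f (t *\<^sub>R x)) (at x) = (\<lambda>h. t ^ length is *\<^sub>R frechet_derivative ?f (at (t *\<^sub>R x)) (t *\<^sub>R h))" for x
    by (rule frechet_derivative_at[OF has_derivative_scaled_iterated_partial[OF assms], symmetric])
  then show ?case
    using linear_cmul[OF has_derivative_linear[OF d], symmetric] by (simp add: Cons fun_eq_iff mult_ac)
qed simp

lemma schwartz_scaleR:
  assumes phi: "\<phi> \<in> schwartz" and t: "t \<noteq> 0"
  shows "(\<lambda>x. \<phi> (t *\<^sub>R x)) \<in> schwartz"
  unfolding schwartz_def
proof (intro CollectI allI conjI)
  fix "is" :: "'a list" and x :: "real^'a" and k :: nat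
  let ?f = "iterated_partial is \<phi>"
  show "iterated_partial is (\<lambda>x. \<phi> (t *\<^sub>R x)) differentiable at x"
    unfolding iterated_partial_scaleR[OF phi]
    by (rule differentiableI[OF has_derivative_scaled_iterated_partial[OF phi]])
  obtain B where B: "\<And>x. norm (norm x ^ k *\<^sub>R ?f x) \<le> B"
  proof -
    have "bounded (range (\<lambda>x. norm x ^ k *\<^sub>R ?f x))" using phi by (simp add: schwartz_def)
    then show ?thesis using that unfolding bounded_iff by blast
  qed
  show "bounded (range (\<lambda>x. norm x ^ k *\<^sub>R iterated_partial is (\<lambda>x. \<phi> (t *\<^sub>R x)) x))"
    unfolding bounded_iff iterated_partial_scaleR[OF phi]
  proof (intro exI ballI, elim imageE, hypsubst)
    fix x :: "real^'a"
    have "norm (norm x ^ k *\<^sub>R t ^ length is *\<^sub>R ?f (t *\<^sub>R x)) = \<bar>t\<bar> ^ length is / \<bar>t\<bar> ^ k * norm (norm (t *\<^sub>R x) ^ k *\<^sub>R ?f (t *\<^sub>R x))"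
      using t by (simp add: power_mult_distrib power_abs abs_mult)
    also have "... \<le> \<bar>t\<bar> ^ length is / \<bar>t\<bar> ^ k * B"
      by (intro mult_left_mono B) auto
    finally show "norm (norm x ^ k *\<^sub>R t ^ length is *\<^sub>R ?f (t *\<^sub>R x)) \<le> \<bar>t\<bar> ^ length is / \<bar>t\<bar> ^ k * B" .
  qed
qed

text \<open>Modulation by \<open>v\<close> becomes translation by \<open>v\<close>: testing
  \<open>u\<close> with a modulated Gaussian reads off a Gaussian average of \<open>u\<close> around
  \<open>v\<close>.\<close>

lemma fourier_integral_gaussfun:
  fixes v :: "real^'n"
  assumes a: "0 < a"
  shows "fourier_integral (gaussfun a 0 v) \<eta> = 
    complex_of_real ((2 * pi) powr (- real CARD('n) / 2) * (pi / a) powr (real CARD('n) / 2) * exp (- (norm (v - \<eta>))\<^sup>2 / (4 * a)))"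
proof -
  have "(\<integral>x. cis (- (x \<bullet> \<eta>)) * gaussfun a 0 v x \<partial>lebesgue) = (\<integral>x. cis ((v - \<eta>) \<bullet> x) * complex_of_real (exp (- a * (norm x)\<^sup>2)) \<partial>lborel)"
  proof -
    have "cis (- (x \<bullet> \<eta>)) * gaussfun a 0 v x = cis ((v - \<eta>) \<bullet> x) * complex_of_real (exp (- a * (norm x)\<^sup>2))" for x
      by (simp add: gaussfun_eq cis_mult inner_diff_left inner_commute algebra_simps)
    then show ?thesis by (simp only:) (rule integral_completion, measurable)
  qed
  then show ?thesis
    unfolding fourier_integral_def gaussian_fourier(2)[OF a] by (simp add: scaleR_conv_of_real)
qed

subsection \<open>Functions with a Fourier transform\<close>

text \<open>The definitions integrate over \<open>lebesgue\<close>, the estimates over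
  \<open>lborel\<close>. A Borel representative, built from the real and imaginary parts, connects
  the two.\<close>

lemma completion_ex_borel_measurable_complex:
  fixes g :: "'a \<Rightarrow> complex"
  assumes g: "g \<in> borel_measurable (completion M)"
  shows "\<exists>g'\<in>borel_measurable M. (AE x in M. g x = g' x)"
proof -
  have "(\<lambda>x. Re (g x)) \<in> borel_measurable (completion M)" "(\<lambda>x. Im (g x)) \<in> borel_measurable (completion M)"
    using g by auto
  then obtain r i where [measurable]: "r \<in> borel_measurable M" "i \<in> borel_measurable M"
    and r: "AE x in M. Re (g x) = r x" and i: "AE x in M. Im (g x) = i x"
    by (metis completion_ex_borel_measurable_real)
  show ?thesis
  proof (rule bexI[of _ "\<lambda>x. complex_of_real (r x) + \<i> * complex_of_real (i x)"])
    show "AE x in M. g x = complex_of_real (r x) + \<i> * complex_of_real (i x)"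
      using r i
    proof eventually_elim
      case (elim x)
      then show ?case by (metis complex_eq)
    qed
  qed measurable
qed

lemma
  fixes f f' :: "'a::euclidean_space \<Rightarrow> complex"
  assumes f: "f \<in> borel_measurable lebesgue" and f': "f' \<in> borel_measurable borel" and ae: "AE x in lborel. f x = f' x"
  shows integral_lebesgue_AE: "(\<integral>x. f x \<partial>lebesgue) = (\<integral>x. f' x \<partial>lborel)"
    and integrable_lebesgue_AE: "integrable lebesgue f \<longleftrightarrow> integrable lborel f'"
proof -
  have m: "f' \<in> borel_measurable lebesgue" using f' by (simp add: measurable_completion)
  have "(\<integral>x. f x \<partial>lebesgue) = (\<integral>x. f' x \<partial>lebesgue)"
    using f m AE_completion[OF ae] by (intro integral_cong_AE) auto
  then show "(\<integral>x. f x \<partial>lebesgue) = (\<integral>x. f' x \<partial>lborel)"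
    using f' by (simp add: integral_completion)
  have "integrable lebesgue f \<longleftrightarrow> integrable lebesgue f'"
    using f m AE_completion[OF ae] by (intro integrable_cong_AE) auto
  then show "integrable lebesgue f \<longleftrightarrow> integrable lborel f'"
    using f' by (simp add: integrable_completion)
qed

lemma measurable_gaussfun [measurable]: "gaussfun a w v \<in> borel_measurable borel"
proof -
  have "gaussfun a w v = (\<lambda>x. complex_of_real (exp (- a * (norm x)\<^sup>2 + w \<bullet> x)) * cis (v \<bullet> x))"
    by (rule ext) (rule gaussfun_eq)
  then show ?thesis by (simp only:) measurable
qed

lemma norm_diff_power2:
  fixes a b :: "'a::real_inner"
  shows "(norm (a - b))\<^sup>2 = (norm a)\<^sup>2 - 2 * (a \<bullet> b) + (norm b)\<^sup>2"
  by (simp add: power2_norm_eq_inner inner_diff inner_commute)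

lemma gauss_mean_gaussfun:
  fixes k :: "real^'n \<Rightarrow> complex"
  assumes k[measurable]: "k \<in> borel_measurable borel" and d: "d > 0"
  shows "gauss_mean d (\<lambda>y. k y * complex_of_real (exp (- (norm y)\<^sup>2))) x =
    (pi powr (- real CARD('n) / 2) / d ^ CARD('n) * exp (- (norm x)\<^sup>2 / d\<^sup>2)) *\<^sub>R 
      (\<integral>y. k y * gaussfun (1 + 1 / d\<^sup>2) ((2 / d\<^sup>2) *\<^sub>R x) 0 y \<partial>lborel)"
proof -
  let ?p = "pi powr (- real CARD('n) / 2)"
  let ?G = "gaussfun (1 + 1 / d\<^sup>2) ((2 / d\<^sup>2) *\<^sub>R x) 0"
  let ?f = "\<lambda>y. exp (- (norm x)\<^sup>2 / d\<^sup>2) *\<^sub>R (k y * ?G y)"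
  \<comment> \<open>Completing the square: the kernel centred at \<open>x\<close> times the damping
    is again a Gaussian in \<open>y\<close>, with sharper parameter \<open>1 + 1 / d^2\<close> and a
    real shift.\<close>
  have e: "exp (- (norm ((1 / d) *\<^sub>R (y - x)))\<^sup>2) * exp (- (norm y)\<^sup>2) = 
     exp (- (norm x)\<^sup>2 / d\<^sup>2) * exp (- (1 + 1 / d\<^sup>2) * (norm y)\<^sup>2 + ((2 / d\<^sup>2) *\<^sub>R x) \<bullet> y)" for y
  proof -
    have "(norm ((1 / d) *\<^sub>R (y - x)))\<^sup>2 = ((norm y)\<^sup>2 - 2 * (x \<bullet> y) + (norm x)\<^sup>2) / d\<^sup>2"
      using d by (simp add: power_divide norm_diff_power2 inner_commute)
    then show ?thesis unfolding exp_add[symmetric] by (simp add: field_simps add_divide_distrib diff_divide_distrib)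
  qed
  have "(\<integral>z. (?p * exp (- (norm z)\<^sup>2)) *\<^sub>R (k (x + d *\<^sub>R z) * complex_of_real (exp (- (norm (x + d *\<^sub>R z))\<^sup>2))) \<partial>lborel)
     = (\<integral>z. ?p *\<^sub>R ?f (x + d *\<^sub>R z) \<partial>lborel)"
  proof (rule Bochner_Integration.integral_cong[OF refl])
    fix z :: "real^'n"
    have "(1 / d) *\<^sub>R (x + d *\<^sub>R z - x) = z" using d by simp
    then have "exp (- (norm z)\<^sup>2) * exp (- (norm (x + d *\<^sub>R z))\<^sup>2) = 
      exp (- (norm x)\<^sup>2 / d\<^sup>2) * exp (- (1 + 1 / d\<^sup>2) * (norm (x + d *\<^sub>R z))\<^sup>2 + ((2 / d\<^sup>2) *\<^sub>R x) \<bullet> (x + d *\<^sub>R z))"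
      using e[of "x + d *\<^sub>R z"] by simp
    then have "complex_of_real (exp (- (norm z)\<^sup>2)) * complex_of_real (exp (- (norm (x + d *\<^sub>R z))\<^sup>2)) = 
      complex_of_real (exp (- (norm x)\<^sup>2 / d\<^sup>2)) * complex_of_real (exp (- (1 + 1 / d\<^sup>2) * (norm (x + d *\<^sub>R z))\<^sup>2 + ((2 / d\<^sup>2) *\<^sub>R x) \<bullet> (x + d *\<^sub>R z)))"
      by (simp only: of_real_mult[symmetric])
    then show "(?p * exp (- (norm z)\<^sup>2)) *\<^sub>R (k (x + d *\<^sub>R z) * complex_of_real (exp (- (norm (x + d *\<^sub>R z))\<^sup>2))) = ?p *\<^sub>R ?f (x + d *\<^sub>R z)"
      unfolding gaussfun_eq scaleR_conv_of_real by (simp add: mult_ac)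
  qed
  also have "... = ?p *\<^sub>R (\<integral>z. ?f (x + d *\<^sub>R z) \<partial>lborel)" by (rule integral_scaleR_right)
  also have "(\<integral>z. ?f (x + d *\<^sub>R z) \<partial>lborel) = (1 / d ^ CARD('n)) *\<^sub>R (\<integral>y. ?f y \<partial>lborel)"
  proof -
    have m: "?f \<in> borel_measurable borel" "(\<lambda>z. ?f (x + d *\<^sub>R z)) \<in> borel_measurable borel" by measurable
    have "(\<integral>y. ?f y \<partial>lborel) = d ^ CARD('n) *\<^sub>R (\<integral>z. ?f (x + d *\<^sub>R z) \<partial>lborel)"
      using integral_lebesgue_affine(1)[of d ?f x] d m by (simp add: integral_completion measurable_completion)
    then show ?thesis using d by simp
  qed
  also have "(\<integral>y. ?f y \<partial>lborel) = exp (- (norm x)\<^sup>2 / d\<^sup>2) *\<^sub>R (\<integral>y. k y * ?G y \<partial>lborel)"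
    by (rule integral_scaleR_right)
  finally show ?thesis by (simp add: gauss_mean_def mult_ac)
qed

text \<open>The difference \<open>k\<close> of two transforms pairs to 0 with every Gaussian, so all
  averages of \<open>k\<close> times \<open>exp (- |y|^2)\<close> vanish, and so does their limit.
  The damping supplies the integrability that \<open>k\<close> itself may lack.\<close>

theorem has_fourier_transform_unique:
  fixes u g g' :: "real^'n \<Rightarrow> complex"
  assumes g: "has_fourier_transform u g" and g': "has_fourier_transform u g'"
  shows "AE x in lebesgue. g x = g' x"
proof -
  have m: "g \<in> borel_measurable lebesgue" "g' \<in> borel_measurable lebesgue"
    using g g' by (auto simp: has_fourier_transform_def)
  have "(\<lambda>x. g x - g' x) \<in> borel_measurable lebesgue" using m by simp
  then obtain k where k[measurable]: "k \<in> borel_measurable borel" and ae: "AE x in lborel. g x - g' x = k x"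
    using completion_ex_borel_measurable_complex by force
  have phi: "integrable lborel (\<lambda>x. k x * \<phi> x) \<and> (\<integral>x. k x * \<phi> x \<partial>lborel) = 0" 
    if \<phi>: "\<phi> \<in> schwartz" and [measurable]: "\<phi> \<in> borel_measurable borel" for \<phi>
  proof -
    have i: "integrable lebesgue (\<lambda>x. g x * \<phi> x)" "integrable lebesgue (\<lambda>x. g' x * \<phi> x)"
      and e: "(\<integral>x. g x * \<phi> x \<partial>lebesgue) = (\<integral>x. g' x * \<phi> x \<partial>lebesgue)"
      using g g' \<phi> by (auto simp: has_fourier_transform_def)
    have d: "integrable lebesgue (\<lambda>x. g x * \<phi> x - g' x * \<phi> x)" using i by (rule Bochner_Integration.integrable_diff)
    have d0: "(\<integral>x. g x * \<phi> x - g' x * \<phi> x \<partial>lebesgue) = 0" using i e by simp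
    have "AE x in lborel. g x * \<phi> x - g' x * \<phi> x = k x * \<phi> x"
      using ae by eventually_elim (simp add: left_diff_distrib[symmetric])
    then show ?thesis
      using integral_lebesgue_AE[of "\<lambda>x. g x * \<phi> x - g' x * \<phi> x" "\<lambda>x. k x * \<phi> x"] 
        integrable_lebesgue_AE[of "\<lambda>x. g x * \<phi> x - g' x * \<phi> x" "\<lambda>x. k x * \<phi> x"] d d0 by auto
  qed
  let ?h = "\<lambda>y. k y * complex_of_real (exp (- (norm y)\<^sup>2))"
  have "integrable lborel ?h"
    using phi[OF gaussfun_schwartz[of 1 0 0]] by (simp add: gaussfun_eq)
  then obtain r where r: "AE x in lborel. (\<lambda>j. gauss_mean (1 / real (Suc (r j))) ?h x) \<longlonglongrightarrow> ?h x"
    using gauss_mean_tendsto_AE[of ?h] by blast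
  have z: "gauss_mean (1 / real (Suc j)) ?h x = 0" for j x
  proof -
    have "(\<integral>y. k y * gaussfun (1 + 1 / (1 / real (Suc j))\<^sup>2) ((2 / (1 / real (Suc j))\<^sup>2) *\<^sub>R x) 0 y \<partial>lborel) = 0"
      by (rule conjunct2[OF phi[OF gaussfun_schwartz measurable_gaussfun]]) (simp add: add_pos_nonneg)
    moreover have "0 < 1 / real (Suc j)" by simp
    ultimately show ?thesis unfolding gauss_mean_gaussfun[OF k \<open>0 < 1 / real (Suc j)\<close>] by (simp only: scaleR_zero_right)
  qed
  have "AE x in lborel. k x = 0"
    using r unfolding z by eventually_elim (simp add: LIMSEQ_const_iff)
  then have "AE x in lborel. g x = g' x" using ae by eventually_elim simp
  then show ?thesis by (rule AE_completion)
qed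

text \<open>The shifted Gaussian that expresses the average is, up to a constant, also the Fourier
  transform of a modulated Gaussian. Duality, used only through the pairings \<open>eq\<close>,
  therefore moves the integral from \<open>u\<close> to \<open>g\<close>.\<close>

lemma gauss_mean_eq_inv_fourier:
  fixes u g :: "real^'n \<Rightarrow> complex"
  assumes [measurable]: "u \<in> borel_measurable borel" "g \<in> borel_measurable borel"
    and eq: "\<And>b v. 0 < b \<Longrightarrow> (\<integral>y. u y * fourier_integral (gaussfun b 0 v) y \<partial>lborel) = (\<integral>\<xi>. g \<xi> * gaussfun b 0 v \<xi> \<partial>lborel)"
    and d: "0 < d"
  shows "gauss_mean d (\<lambda>y. u y * complex_of_real (exp (- (norm y)\<^sup>2))) x =
    ((1 + d\<^sup>2) powr (- real CARD('n) / 2) * exp (- (norm x)\<^sup>2 / (1 + d\<^sup>2))) *\<^sub>R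
      inv_fourier (\<lambda>\<xi>. g \<xi> * complex_of_real (exp (- (d\<^sup>2 / (4 * (1 + d\<^sup>2))) * (norm \<xi>)\<^sup>2))) ((1 / (1 + d\<^sup>2)) *\<^sub>R x)"
proof -
  define N where "N = real CARD('n)"
  define \<rho> where "\<rho> = 1 + d\<^sup>2"
  have \<rho>: "\<rho> > 0" unfolding \<rho>_def by (simp add: add_pos_nonneg)
  \<comment> \<open>\<open>b\<close> and \<open>v\<close> are found by matching exponents:
    \<open>1 / (4 * b) = 1 + 1 / d^2\<close> for the quadratic term and
    \<open>v / (2 * b) = 2 * x / d^2\<close> for the linear one.\<close>
  define b where "b = d\<^sup>2 / (4 * \<rho>)"
  have b: "b > 0" using d \<rho> by (simp add: b_def)
  define v where "v = (1 / \<rho>) *\<^sub>R x"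
  define K where "K = (2 * pi) powr (- N / 2) * (pi / b) powr (N / 2)"
  have K: "K > 0" using b by (simp add: K_def)
  have A: "1 + 1 / d\<^sup>2 = \<rho> / d\<^sup>2" using d by (simp add: \<rho>_def field_simps)
  have G: "gaussfun (1 + 1 / d\<^sup>2) ((2 / d\<^sup>2) *\<^sub>R x) 0 y = complex_of_real (exp ((norm x)\<^sup>2 / (d\<^sup>2 * \<rho>)) / K) * fourier_integral (gaussfun b 0 v) y" for y
  proof -
    have "(norm (v - y))\<^sup>2 = (norm x)\<^sup>2 / \<rho>\<^sup>2 - 2 * (x \<bullet> y) / \<rho> + (norm y)\<^sup>2"
      using \<rho> unfolding norm_diff_power2 by (simp add: v_def power_divide)
    moreover have "- (X / \<rho>\<^sup>2 - 2 * Z / \<rho> + Y) / (4 * b) = - X / (d\<^sup>2 * \<rho>) + (- (\<rho> / d\<^sup>2) * Y + 2 / d\<^sup>2 * Z)" for X Y Z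
      using \<rho> d by (simp add: b_def power2_eq_square field_simps)
    ultimately have "- (norm (v - y))\<^sup>2 / (4 * b) = - (norm x)\<^sup>2 / (d\<^sup>2 * \<rho>) + (- (\<rho> / d\<^sup>2) * (norm y)\<^sup>2 + ((2 / d\<^sup>2) *\<^sub>R x) \<bullet> y)"
      by (simp only: inner_scaleR_left)
    then have "exp (- (\<rho> / d\<^sup>2) * (norm y)\<^sup>2 + ((2 / d\<^sup>2) *\<^sub>R x) \<bullet> y) = exp ((norm x)\<^sup>2 / (d\<^sup>2 * \<rho>)) * exp (- (norm (v - y))\<^sup>2 / (4 * b))"
      unfolding exp_add[symmetric] by simp
    then show ?thesis
      unfolding fourier_integral_gaussfun[OF b] gaussfun_eq A K_def[symmetric] N_def[symmetric] using K by simp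
  qed
  have "(\<integral>y. u y * gaussfun (1 + 1 / d\<^sup>2) ((2 / d\<^sup>2) *\<^sub>R x) 0 y \<partial>lborel) = 
     (\<integral>y. (exp ((norm x)\<^sup>2 / (d\<^sup>2 * \<rho>)) / K) *\<^sub>R (u y * fourier_integral (gaussfun b 0 v) y) \<partial>lborel)"
    by (simp only: G) (simp add: scaleR_conv_of_real mult_ac)
  also have "... = (exp ((norm x)\<^sup>2 / (d\<^sup>2 * \<rho>)) / K) *\<^sub>R (\<integral>\<xi>. g \<xi> * gaussfun b 0 v \<xi> \<partial>lborel)"
    unfolding eq[OF b, symmetric] by (rule integral_scaleR_right)
  also have "(\<integral>\<xi>. g \<xi> * gaussfun b 0 v \<xi> \<partial>lborel) = (2 * pi) powr (N / 2) *\<^sub>R inv_fourier (\<lambda>\<xi>. g \<xi> * complex_of_real (exp (- b * (norm \<xi>)\<^sup>2))) v"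
  proof -
    have "(2 * pi) powr (N / 2) * (2 * pi) powr (- N / 2) = 1" by (simp flip: powr_add)
    then show ?thesis unfolding inv_fourier_def gaussfun_eq by (simp add: N_def mult_ac)
  qed
  finally have 1: "(\<integral>y. u y * gaussfun (1 + 1 / d\<^sup>2) ((2 / d\<^sup>2) *\<^sub>R x) 0 y \<partial>lborel) = 
     (exp ((norm x)\<^sup>2 / (d\<^sup>2 * \<rho>)) / K * (2 * pi) powr (N / 2)) *\<^sub>R inv_fourier (\<lambda>\<xi>. g \<xi> * complex_of_real (exp (- b * (norm \<xi>)\<^sup>2))) v"
    by simp
  \<comment> \<open>All constants collapse to a prefactor that tends to the damping
    \<open>exp (- |x|^2)\<close> as \<open>d\<close> tends to 0, so the damping cancels in the
    limit.\<close>
  have 2: "pi powr (- N / 2) / d ^ CARD('n) * exp (- (norm x)\<^sup>2 / d\<^sup>2) * (exp ((norm x)\<^sup>2 / (d\<^sup>2 * \<rho>)) / K * (2 * pi) powr (N / 2))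
     = \<rho> powr (- N / 2) * exp (- (norm x)\<^sup>2 / \<rho>)"
  proof -
    have e: "- (norm x)\<^sup>2 / d\<^sup>2 + (norm x)\<^sup>2 / (d\<^sup>2 * \<rho>) = - (norm x)\<^sup>2 / \<rho>"
    proof -
      have gen: "- X / D + X / (D * R) = (X * (1 - R)) / (D * R)" if "D \<noteq> 0" "R \<noteq> 0" for X D R :: real
        using that by (simp add: field_simps)
      have "- (norm x)\<^sup>2 / d\<^sup>2 + (norm x)\<^sup>2 / (d\<^sup>2 * \<rho>) = ((norm x)\<^sup>2 * (1 - \<rho>)) / (d\<^sup>2 * \<rho>)"
        by (rule gen) (use d \<rho> in auto)
      also have "1 - \<rho> = - d\<^sup>2" by (simp add: \<rho>_def)
      finally show ?thesis using d by simp
    qed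
    have dn: "d ^ CARD('n) = (d\<^sup>2) powr (N / 2)"
    proof -
      have "(d\<^sup>2) powr (N / 2) = (d powr 2) powr (N / 2)" using d by simp
      also have "... = d powr N" by (simp only: powr_powr) simp
      also have "... = d ^ CARD('n)" using d by (simp add: N_def powr_realpow)
      finally show ?thesis ..
    qed
    have pb: "pi / b = (2 * pi) * ((2 * \<rho>) / d\<^sup>2)" using d \<rho> by (simp add: b_def field_simps)
    have "(2 * pi) powr (N / 2) / K = ((2 * pi) powr (N / 2) / (2 * pi) powr (- N / 2)) / ((2 * pi) * ((2 * \<rho>) / d\<^sup>2)) powr (N / 2)"
      unfolding K_def pb by (rule divide_divide_eq_left[symmetric])
    also have "... = (2 * pi) powr (N / 2) / ((2 * \<rho>) / d\<^sup>2) powr (N / 2)"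
    proof -
      have gen: "(P / inverse P) / (P * Q) = P / Q" if "P \<noteq> 0" for P Q :: real using that by (simp add: field_simps)
      have pm: "(2 * pi) powr (- N / 2) = inverse ((2 * pi) powr (N / 2))" by (simp flip: powr_minus)
      show ?thesis unfolding powr_mult[of "2 * pi" "(2 * \<rho>) / d\<^sup>2"] pm by (rule gen) simp
    qed
    also have "... = pi powr (N / 2) * (d\<^sup>2) powr (N / 2) / \<rho> powr (N / 2)"
    proof -
      have gen: "(P * Q) / ((P * R) / S) = Q * S / R" if "P \<noteq> 0" for P Q R S :: real using that by (simp add: field_simps)
      show ?thesis unfolding powr_mult powr_divide by (rule gen) simp
    qed
    finally have KK: "(2 * pi) powr (N / 2) / K = pi powr (N / 2) * (d\<^sup>2) powr (N / 2) / \<rho> powr (N / 2)" .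
    have "pi powr (- N / 2) / d ^ CARD('n) * exp (- (norm x)\<^sup>2 / d\<^sup>2) * (exp ((norm x)\<^sup>2 / (d\<^sup>2 * \<rho>)) / K * (2 * pi) powr (N / 2))
      = pi powr (- N / 2) / (d\<^sup>2) powr (N / 2) * ((2 * pi) powr (N / 2) / K) * (exp (- (norm x)\<^sup>2 / d\<^sup>2) * exp ((norm x)\<^sup>2 / (d\<^sup>2 * \<rho>)))"
    proof -
      have gen: "A * E1 * (E2 / K * T) = A * (T / K) * (E1 * E2)" for A E1 E2 T :: real by simp
      show ?thesis unfolding dn by (rule gen)
    qed
    also have "exp (- (norm x)\<^sup>2 / d\<^sup>2) * exp ((norm x)\<^sup>2 / (d\<^sup>2 * \<rho>)) = exp (- (norm x)\<^sup>2 / \<rho>)"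
      unfolding exp_add[symmetric] e ..
    also have "pi powr (- N / 2) / (d\<^sup>2) powr (N / 2) * ((2 * pi) powr (N / 2) / K) = \<rho> powr (- N / 2)"
    proof -
      have gen: "inverse P / D * (P * D / R) = inverse R" if "P \<noteq> 0" "D \<noteq> 0" for P D R :: real
        using that by (simp add: field_simps)
      have pm: "p powr (- N / 2) = inverse (p powr (N / 2))" for p by (simp flip: powr_minus)
      show ?thesis unfolding KK pm by (rule gen) (use d in auto)
    qed
    finally show ?thesis .
  qed
  show ?thesis
    unfolding gauss_mean_gaussfun[OF assms(1) d] 1 scaleR_scaleR N_def[symmetric] 2
    unfolding b_def \<rho>_def v_def by (rule refl)
qed

text \<open>The Gaussian times the Borel representative \<open>k\<close> of \<open>g\<close> is
  integrable, because Gaussians are test functions, and its weighted integral is still at most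
  \<open>f\<close>. Hence the inequality for integrable transforms holds along the whole sequence
  with one constant, ready for Fatou.\<close>

theorem hardy_sobolev_fourier_transform:
  fixes s a q :: real
  assumes s: "0 < s" "s < 1" and a: "0 < a" "a < 2 * s" "2 * s < real CARD('n::finite)"
    and q: "q = 2 * (real CARD('n) - a) / (real CARD('n) - 2 * s)"
  obtains C where "0 < C"
    "\<And>(u :: real^'n \<Rightarrow> real) g f. has_fourier_transform (\<lambda>x. complex_of_real (u x)) g \<Longrightarrow> 0 \<le> f \<Longrightarrow>
       (\<integral>\<^sup>+\<xi>. ennreal (norm \<xi> powr (2 * s) * (norm (g \<xi>))\<^sup>2) \<partial>lebesgue) \<le> ennreal f \<Longrightarrow>
       (\<integral>\<^sup>+y. ennreal (\<bar>u y\<bar> powr q * norm y powr (- a)) \<partial>lebesgue) \<le> ennreal (C * f powr (q / 2))"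
proof -
  define N where "N = real CARD('n)"
  have Na: "0 < N - a" using a by (simp add: N_def)
  have q0: "q > 0" using a unfolding q by simp
  obtain C where C: "0 < C"
    "\<And>(H :: real^'n \<Rightarrow> complex) f. integrable lborel H \<Longrightarrow> 0 \<le> f \<Longrightarrow>
       (\<integral>\<^sup>+\<xi>. ennreal (norm \<xi> powr (2 * s) * (norm (H \<xi>))\<^sup>2) \<partial>lborel) \<le> ennreal f \<Longrightarrow>
       (\<integral>\<^sup>+y. ennreal (norm (inv_fourier H y) powr q * norm y powr (- a)) \<partial>lborel) \<le> ennreal (C * f powr (q / 2))"
    using hardy_sobolev_inv_fourier[of s a q, where 'a="real^'n"] s a q by auto
  have "(\<integral>\<^sup>+y. ennreal (\<bar>u y\<bar> powr q * norm y powr (- a)) \<partial>lebesgue) \<le> ennreal ((2 powr (N - a) * C) * f powr (q / 2))"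
    if ft: "has_fourier_transform (\<lambda>x. complex_of_real (u x)) g" and f: "0 \<le> f"
      and gf: "(\<integral>\<^sup>+\<xi>. ennreal (norm \<xi> powr (2 * s) * (norm (g \<xi>))\<^sup>2) \<partial>lebesgue) \<le> ennreal f"
    for u :: "real^'n \<Rightarrow> real" and g f
  proof -
    have um: "(\<lambda>x. complex_of_real (u x)) \<in> borel_measurable lebesgue" and gm: "g \<in> borel_measurable lebesgue"
      using ft by (auto simp: has_fourier_transform_def)
    obtain w where w[measurable]: "w \<in> borel_measurable borel" and uw: "AE x in lborel. complex_of_real (u x) = w x"
      using completion_ex_borel_measurable_complex[OF um] by auto
    obtain k where k[measurable]: "k \<in> borel_measurable borel" and gk: "AE x in lborel. g x = k x"
      using completion_ex_borel_measurable_complex[OF gm] by auto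
    have ft_eq: "(\<integral>y. w y * fourier_integral (gaussfun b 0 v) y \<partial>lborel) = (\<integral>\<xi>. k \<xi> * gaussfun b 0 v \<xi> \<partial>lborel)" (is ?E)
      and w_int: "integrable lborel (\<lambda>y. w y * fourier_integral (gaussfun b 0 v) y)" (is ?W)
      and k_int: "integrable lborel (\<lambda>\<xi>. k \<xi> * gaussfun b 0 v \<xi>)" (is ?K)
      if b: "0 < b" for b v
    proof -
      let ?\<phi> = "gaussfun b 0 v"
      have sch: "?\<phi> \<in> schwartz" using gaussfun_schwartz[OF b] .
      have i1: "integrable lebesgue (\<lambda>x. complex_of_real (u x) * fourier_integral ?\<phi> x)"
        and i2: "integrable lebesgue (\<lambda>x. g x * ?\<phi> x)"
        and e: "(\<integral>x. complex_of_real (u x) * fourier_integral ?\<phi> x \<partial>lebesgue) = (\<integral>x. g x * ?\<phi> x \<partial>lebesgue)"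
        using ft sch by (auto simp: has_fourier_transform_def)
      have m1: "(\<lambda>y. w y * fourier_integral ?\<phi> y) \<in> borel_measurable borel"
        unfolding fourier_integral_gaussfun[OF b] by measurable
      have m2: "(\<lambda>\<xi>. k \<xi> * ?\<phi> \<xi>) \<in> borel_measurable borel" by measurable
      have a1: "AE x in lborel. complex_of_real (u x) * fourier_integral ?\<phi> x = w x * fourier_integral ?\<phi> x"
        using uw by eventually_elim (rule arg_cong)
      have a2: "AE x in lborel. g x * ?\<phi> x = k x * ?\<phi> x" using gk by eventually_elim (rule arg_cong)
      note A1 = borel_measurable_integrable[OF i1] m1 a1
      note A2 = borel_measurable_integrable[OF i2] m2 a2
      show ?E using e unfolding integral_lebesgue_AE[OF A1] integral_lebesgue_AE[OF A2] .
      show ?W using i1 unfolding integrable_lebesgue_AE[OF A1] .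
      show ?K using i2 unfolding integrable_lebesgue_AE[OF A2] .
    qed
    have H: "integrable lborel (\<lambda>\<xi>. k \<xi> * complex_of_real (exp (- b * (norm \<xi>)\<^sup>2)))" if "0 < b" for b
      using k_int[OF that, of 0] by (simp add: gaussfun_eq)
    have kf: "(\<integral>\<^sup>+\<xi>. ennreal (norm \<xi> powr (2 * s) * (norm (k \<xi>))\<^sup>2) \<partial>lborel) \<le> ennreal f"
    proof -
      have "(\<integral>\<^sup>+\<xi>. ennreal (norm \<xi> powr (2 * s) * (norm (k \<xi>))\<^sup>2) \<partial>lborel) = (\<integral>\<^sup>+\<xi>. ennreal (norm \<xi> powr (2 * s) * (norm (g \<xi>))\<^sup>2) \<partial>lborel)"
      proof (rule nn_integral_cong_AE)
        show "AE \<xi> in lborel. ennreal (norm \<xi> powr (2 * s) * (norm (k \<xi>))\<^sup>2) = ennreal (norm \<xi> powr (2 * s) * (norm (g \<xi>))\<^sup>2)"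
          using gk by eventually_elim simp
      qed
      then show ?thesis using gf by (simp add: nn_integral_completion)
    qed
    have Hf: "(\<integral>\<^sup>+\<xi>. ennreal (norm \<xi> powr (2 * s) * (norm (k \<xi> * complex_of_real (exp (- b * (norm \<xi>)\<^sup>2))))\<^sup>2) \<partial>lborel) \<le> ennreal f" if b: "0 < b" for b
    proof (rule order_trans[OF nn_integral_mono kf])
      fix \<xi> :: "real^'n"
      have "norm (k \<xi> * complex_of_real (exp (- b * (norm \<xi>)\<^sup>2))) \<le> norm (k \<xi>)"
        using b by (simp add: norm_mult mult_left_le)
      then show "ennreal (norm \<xi> powr (2 * s) * (norm (k \<xi> * complex_of_real (exp (- b * (norm \<xi>)\<^sup>2))))\<^sup>2) \<le> ennreal (norm \<xi> powr (2 * s) * (norm (k \<xi>))\<^sup>2)"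
        by (intro ennreal_leI mult_left_mono power_mono) auto
    qed
    let ?h = "\<lambda>y. w y * complex_of_real (exp (- (norm y)\<^sup>2))"
    have "integrable lborel ?h"
    proof -
      \<comment> \<open>The parameter \<open>1 / 4\<close> is chosen because the transform of that
        Gaussian is \<open>K\<close> times exactly \<open>exp (- |y|^2)\<close>.\<close>
      define K where "K = (2 * pi) powr (- real CARD('n) / 2) * (pi / (1 / 4)) powr (real CARD('n) / 2)"
      have "K \<noteq> 0" by (simp add: K_def)
      have "integrable lborel (\<lambda>y. K *\<^sub>R ?h y)"
        using w_int[of "1 / 4" 0] unfolding fourier_integral_gaussfun[of "1/4", simplified] 
        by (simp add: K_def scaleR_conv_of_real mult_ac)
      then show ?thesis using integrable_scaleR_right_iff[OF \<open>K \<noteq> 0\<close>] by blast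
    qed
    then obtain r where r: "AE x in lborel. (\<lambda>j. gauss_mean (1 / real (Suc (r j))) ?h x) \<longlonglongrightarrow> ?h x" "strict_mono r"
      using gauss_mean_tendsto_AE[of ?h] by blast
    define d where "d j = 1 / real (Suc (r j))" for j
    define \<rho> where "\<rho> j = 1 + (d j)\<^sup>2" for j
    define b where "b j = (d j)\<^sup>2 / (4 * (1 + (d j)\<^sup>2))" for j
    have d: "0 < d j" "d j \<le> 1" for j by (auto simp: d_def)
    have \<rho>: "1 \<le> \<rho> j" "\<rho> j \<le> 2" for j using d[of j] by (auto simp: \<rho>_def power_le_one)
    have b: "0 < b j" for j using d[of j] by (simp add: b_def add_pos_nonneg)
    have dlim: "d \<longlonglongrightarrow> 0"
      unfolding d_def using LIMSEQ_subseq_LIMSEQ[OF LIMSEQ_Suc[OF lim_1_over_n] r(2)] by (simp add: o_def)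
    have \<rho>lim: "\<rho> \<longlonglongrightarrow> 1" unfolding \<rho>_def by (rule tendsto_eq_intros dlim refl | simp)+
    define G where "G j = inv_fourier (\<lambda>\<xi>. k \<xi> * complex_of_real (exp (- b j * (norm \<xi>)\<^sup>2)))" for j
    have [measurable]: "G j \<in> borel_measurable borel" for j unfolding G_def by measurable
    let ?D = "\<lambda>j x. ennreal (norm (G j ((1 / \<rho> j) *\<^sub>R x)) powr q * norm x powr (- a))"
    have mean: "gauss_mean (d j) ?h x = (\<rho> j powr (- N / 2) * exp (- (norm x)\<^sup>2 / \<rho> j)) *\<^sub>R G j ((1 / \<rho> j) *\<^sub>R x)" for j x
      unfolding G_def \<rho>_def b_def N_def by (rule gauss_mean_eq_inv_fourier[OF w k ft_eq d(1)])
    have lim: "AE x in lborel. (\<lambda>j. norm (G j ((1 / \<rho> j) *\<^sub>R x))) \<longlonglongrightarrow> norm (w x)"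
      using r(1)
    proof eventually_elim
      case (elim x)
      have "(\<lambda>j. norm (gauss_mean (d j) ?h x) * (\<rho> j powr (N / 2) * exp ((norm x)\<^sup>2 / \<rho> j))) \<longlonglongrightarrow> norm (?h x) * (1 powr (N / 2) * exp ((norm x)\<^sup>2 / 1))"
        using elim unfolding d_def[symmetric] by (intro tendsto_intros \<rho>lim) auto
      moreover have "norm (gauss_mean (d j) ?h x) * (\<rho> j powr (N / 2) * exp ((norm x)\<^sup>2 / \<rho> j)) = norm (G j ((1 / \<rho> j) *\<^sub>R x))" for j
      proof -
        have gen: "(A * E) * (B * F) = 1" if "A * B = 1" "E * F = 1" for A B E F :: real
        proof -
          have "(A * E) * (B * F) = (A * B) * (E * F)" by (simp only: mult_ac)
          then show ?thesis using that by simp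
        qed
        have "\<rho> j powr (- N / 2) * \<rho> j powr (N / 2) = 1" using \<rho>[of j] by (simp flip: powr_add)
        moreover have "exp (- (norm x)\<^sup>2 / \<rho> j) * exp ((norm x)\<^sup>2 / \<rho> j) = 1" by (simp flip: exp_add)
        ultimately have "(\<rho> j powr (- N / 2) * exp (- (norm x)\<^sup>2 / \<rho> j)) * (\<rho> j powr (N / 2) * exp ((norm x)\<^sup>2 / \<rho> j)) = 1"
          by (rule gen)
        then show ?thesis unfolding mean norm_scaleR by (simp add: abs_mult mult_ac)
      qed
      moreover have "norm (?h x) * (1 powr (N / 2) * exp ((norm x)\<^sup>2 / 1)) = norm (w x)"
        by (simp add: norm_mult mult.assoc flip: exp_add)
      ultimately show ?case by simp
    qed
    \<comment> \<open>Evaluating at \<open>x / \<rho> j\<close> costs \<open>\<rho> j powr N\<close>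
      in volume and regains \<open>\<rho> j powr (- a)\<close> from the weight. As
      \<open>\<rho> j\<close> lies between 1 and 2, this explains the constant
      \<open>2 powr (N - a)\<close>.\<close>
    have bound: "(\<integral>\<^sup>+x. ?D j x \<partial>lborel) \<le> ennreal (2 powr (N - a) * C * f powr (q / 2))" for j
    proof -
      have \<rho>0: "\<rho> j > 0" using \<rho>[of j] by simp
      let ?F = "\<lambda>y. ennreal (norm (G j y) powr q * norm y powr (- a))"
      have "(\<integral>\<^sup>+x. ?D j x \<partial>lborel)
        = (\<integral>\<^sup>+x. ennreal (\<rho> j powr (- a)) * ?F (0 + (1 / \<rho> j) *\<^sub>R x) \<partial>lborel)"
      proof (rule nn_integral_cong)
        fix x :: "real^'n"
        have "norm (0 + (1 / \<rho> j) *\<^sub>R x) powr (- a) = (1 / \<rho> j) powr (- a) * norm x powr (- a)"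
          using \<rho>0 by (simp add: powr_mult[symmetric])
        moreover have "\<rho> j powr (- a) * (1 / \<rho> j) powr (- a) = 1"
          using \<rho>0 by (simp add: powr_mult[symmetric])
        ultimately have "\<rho> j powr (- a) * norm (0 + (1 / \<rho> j) *\<^sub>R x) powr (- a) = norm x powr (- a)"
          by (simp add: mult.assoc[symmetric])
        then show "?D j x = ennreal (\<rho> j powr (- a)) * ?F (0 + (1 / \<rho> j) *\<^sub>R x)"
          by (simp add: mult_ac flip: ennreal_mult)
      qed
      also have "... = ennreal (\<rho> j powr (- a)) * (\<integral>\<^sup>+x. ?F (0 + (1 / \<rho> j) *\<^sub>R x) \<partial>lborel)"
        by (rule nn_integral_cmult) measurable
      also have "(\<integral>\<^sup>+x. ?F (0 + (1 / \<rho> j) *\<^sub>R x) \<partial>lborel) = ennreal (\<rho> j powr N) * (\<integral>\<^sup>+y. ?F y \<partial>lborel)"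
      proof -
        have "(\<integral>\<^sup>+y. ?F y \<partial>lborel) = ennreal (\<bar>1 / \<rho> j\<bar> ^ DIM(real^'n)) * (\<integral>\<^sup>+x. ?F (0 + (1 / \<rho> j) *\<^sub>R x) \<partial>lborel)"
          using \<rho>0 by (intro nn_integral_lborel_affine) auto
        then have "ennreal (\<rho> j powr N) * (\<integral>\<^sup>+y. ?F y \<partial>lborel) = (ennreal (\<rho> j powr N) * ennreal (\<bar>1 / \<rho> j\<bar> ^ DIM(real^'n))) * (\<integral>\<^sup>+x. ?F (0 + (1 / \<rho> j) *\<^sub>R x) \<partial>lborel)"
          by (simp only: mult.assoc)
        moreover have "ennreal (\<rho> j powr N) * ennreal (\<bar>1 / \<rho> j\<bar> ^ DIM(real^'n)) = 1"
          using \<rho>0 by (simp add: N_def powr_realpow power_one_over flip: ennreal_mult)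
        ultimately show ?thesis by simp
      qed
      also have "ennreal (\<rho> j powr (- a)) * (ennreal (\<rho> j powr N) * (\<integral>\<^sup>+y. ?F y \<partial>lborel)) = ennreal (\<rho> j powr (N - a)) * (\<integral>\<^sup>+y. ?F y \<partial>lborel)"
        by (simp add: mult.assoc[symmetric] add.commute flip: ennreal_mult powr_add)
      also have "... \<le> ennreal (2 powr (N - a)) * ennreal (C * f powr (q / 2))"
        unfolding G_def using \<rho>[of j] Na
        by (intro mult_mono ennreal_leI powr_mono2 C(2) H Hf f b) auto
      also have "... = ennreal (2 powr (N - a) * C * f powr (q / 2))"
        using C(1) by (simp add: mult.assoc flip: ennreal_mult)
      finally show ?thesis .
    qed
    have "(\<integral>\<^sup>+y. ennreal (\<bar>u y\<bar> powr q * norm y powr (- a)) \<partial>lebesgue) = (\<integral>\<^sup>+y. ennreal (\<bar>u y\<bar> powr q * norm y powr (- a)) \<partial>lborel)"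
      by (rule nn_integral_completion)
    also have "... = (\<integral>\<^sup>+x. liminf (\<lambda>j. ?D j x) \<partial>lborel)"
    proof (rule nn_integral_cong_AE)
      show "AE x in lborel. ennreal (\<bar>u x\<bar> powr q * norm x powr (- a)) = liminf (\<lambda>j. ?D j x)"
        using uw lim
      proof eventually_elim
        case (elim x)
        have "\<bar>u x\<bar> = norm (w x)" unfolding elim(1)[symmetric] by simp
        moreover have "(\<lambda>j. norm (G j ((1 / \<rho> j) *\<^sub>R x)) powr q * norm x powr (- a)) \<longlonglongrightarrow> norm (w x) powr q * norm x powr (- a)"
          using q0 by (intro tendsto_mult_right tendsto_powr2 elim tendsto_const) auto
        ultimately have "(\<lambda>j. ?D j x) \<longlonglongrightarrow> ennreal (\<bar>u x\<bar> powr q * norm x powr (- a))"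
          by (simp add: tendsto_ennrealI)
        then show ?case by (intro lim_imp_Liminf[symmetric]) auto
      qed
    qed
    also have "... \<le> liminf (\<lambda>j. \<integral>\<^sup>+x. ?D j x \<partial>lborel)"
      by (rule nn_integral_liminf) measurable
    also have "... \<le> liminf (\<lambda>j. ennreal (2 powr (N - a) * C * f powr (q / 2)))"
      by (intro Liminf_mono always_eventually allI bound)
    also have "... = ennreal (2 powr (N - a) * C * f powr (q / 2))"
      by (simp add: Liminf_const)
    finally show ?thesis .
  qed
  then show ?thesis using that[of "2 powr (N - a) * C"] C(1) by simp
qed

subsection \<open>Norms and the embedding into the Morrey space\<close>

lemma ennreal_rpow_ennreal: "0 \<le> x \<Longrightarrow> ennreal_rpow (ennreal x) a = ennreal (x powr a)"
  by (simp add: ennreal_rpow_def)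

lemma ennreal_rpow_mono:
  assumes "x \<le> y" "0 \<le> a"
  shows "ennreal_rpow x a \<le> ennreal_rpow y a"
proof (cases "y = \<infinity>")
  case False
  then have "y < top" by (simp add: top.not_eq_extremum)
  then have "enn2real x \<le> enn2real y" by (rule enn2real_mono[OF assms(1)])
  moreover have "x \<noteq> \<infinity>" using False assms(1) by (auto simp: top_unique)
  ultimately show ?thesis using False assms(2) by (auto simp: ennreal_rpow_def intro!: ennreal_leI powr_mono2)
qed (simp add: ennreal_rpow_def)

lemma ennreal_rpow_less_top_iff: "ennreal_rpow x a < \<infinity> \<longleftrightarrow> x < \<infinity>"
  by (auto simp: ennreal_rpow_def top.not_eq_extremum)

section \<open>Hoelder's inequality on sets of finite measure\<close>

text \<open>The right side is the tangent at \<open>m\<close> of a concave power; the inequality is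
  Young's, divided by \<open>m powr (1 - \<theta>)\<close>.\<close>

lemma powr_le_tangent:
  fixes x m \<theta> :: real
  assumes "0 \<le> x" "0 < m" "0 < \<theta>" "\<theta> < 1"
  shows "x powr \<theta> \<le> \<theta> * m powr (\<theta> - 1) * x + (1 - \<theta>) * m powr \<theta>"
proof (cases "x = 0")
  case False
  have "x powr \<theta> * m powr (1 - \<theta>) \<le> \<theta> * x + (1 - \<theta>) * m"
    using assms False by (intro Youngs_inequality_0) auto
  then have "x powr \<theta> * m powr (1 - \<theta>) * m powr (\<theta> - 1) \<le> (\<theta> * x + (1 - \<theta>) * m) * m powr (\<theta> - 1)"
    by (intro mult_right_mono) auto
  moreover have "m powr (1 - \<theta>) * m powr (\<theta> - 1) = 1" using assms by (simp flip: powr_add)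
  moreover have "m * m powr (\<theta> - 1) = m powr \<theta>" using assms powr_add[of m 1 "\<theta> - 1"] by simp
  ultimately show ?thesis by (simp add: algebra_simps)
qed (use assms in auto)

text \<open>Hoelder against the indicator of \<open>B\<close>, obtained by integrating the tangent
  bound, which keeps the whole computation linear in \<open>f\<close>.\<close>

lemma set_nn_integral_powr_le:
  fixes f :: "'a \<Rightarrow> real" and \<theta> i :: real
  assumes [measurable]: "f \<in> borel_measurable M" "B \<in> sets M" and f: "\<And>x. 0 \<le> f x"
    and \<theta>: "0 < \<theta>" "\<theta> < 1" and i: "(\<integral>\<^sup>+x. ennreal (f x) \<partial>M) \<le> ennreal i" "0 \<le> i"
    and B: "emeasure M B = ennreal v" "0 < v"
  shows "(\<integral>\<^sup>+x\<in>B. ennreal (f x powr \<theta>) \<partial>M) \<le> ennreal (i powr \<theta> * v powr (1 - \<theta>))"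
proof (cases "i = 0")
  case True
  then have "(\<integral>\<^sup>+x. ennreal (f x) \<partial>M) = 0" using i by simp
  then have "AE x in M. ennreal (f x) = 0" by (subst (asm) nn_integral_0_iff_AE) auto
  then have "AE x in M. ennreal (f x powr \<theta>) * indicator B x = 0"
    by eventually_elim (use f in \<open>auto simp: ennreal_eq_0_iff order_antisym\<close>)
  then have "(\<integral>\<^sup>+x\<in>B. ennreal (f x powr \<theta>) \<partial>M) = 0" by (subst nn_integral_0_iff_AE) auto
  then show ?thesis by simp
next
  case False
  then have i0: "i > 0" using i by simp
  \<comment> \<open>The optimal point of tangency, namely the mean of \<open>f\<close> allowed by
    the bound \<open>i\<close> on a set of measure \<open>v\<close>. It has to be positive, hence
    the separate case \<open>i = 0\<close>.\<close>
  define m where "m = i / v"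
  have m: "m > 0" using i0 B by (simp add: m_def)
  have "(\<integral>\<^sup>+x\<in>B. ennreal (f x powr \<theta>) \<partial>M) \<le> (\<integral>\<^sup>+x. ennreal (\<theta> * m powr (\<theta> - 1)) * ennreal (f x) + ennreal ((1 - \<theta>) * m powr \<theta>) * indicator B x \<partial>M)"
  proof (rule nn_integral_mono)
    fix x
    have "ennreal (f x powr \<theta>) \<le> ennreal (\<theta> * m powr (\<theta> - 1) * f x + (1 - \<theta>) * m powr \<theta>)"
      by (intro ennreal_leI powr_le_tangent f m \<theta>)
    also have "... = ennreal (\<theta> * m powr (\<theta> - 1)) * ennreal (f x) + ennreal ((1 - \<theta>) * m powr \<theta>)"
      using \<theta> f by (simp add: ennreal_mult)
    finally show "ennreal (f x powr \<theta>) * indicator B x \<le> ennreal (\<theta> * m powr (\<theta> - 1)) * ennreal (f x) + ennreal ((1 - \<theta>) * m powr \<theta>) * indicator B x"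
      by (auto simp: indicator_def)
  qed
  also have "... = ennreal (\<theta> * m powr (\<theta> - 1)) * (\<integral>\<^sup>+x. ennreal (f x) \<partial>M) + ennreal ((1 - \<theta>) * m powr \<theta>) * ennreal v"
    by (simp add: nn_integral_add nn_integral_cmult B)
  also have "... \<le> ennreal (\<theta> * m powr (\<theta> - 1)) * ennreal i + ennreal ((1 - \<theta>) * m powr \<theta>) * ennreal v"
    by (intro add_right_mono mult_left_mono i) auto
  also have "... = ennreal (\<theta> * m powr (\<theta> - 1) * i + (1 - \<theta>) * m powr \<theta> * v)"
    using \<theta> i0 B by (simp add: ennreal_mult)
  also have "\<theta> * m powr (\<theta> - 1) * i + (1 - \<theta>) * m powr \<theta> * v = i powr \<theta> * v powr (1 - \<theta>)"
  proof -
    have "m powr (\<theta> - 1) * i = i powr \<theta> * v powr (1 - \<theta>)"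
      using i0 B powr_add[of i 1 "\<theta> - 1"] powr_minus[of v "\<theta> - 1"] by (simp add: m_def powr_divide field_simps)
    moreover have "m powr \<theta> * v = i powr \<theta> * v powr (1 - \<theta>)"
      using i0 B by (simp add: m_def powr_divide powr_diff)
    ultimately show ?thesis by (simp add: mult.assoc algebra_simps)
  qed
  finally show ?thesis .
qed

lemma weighted_Lp_norm_eq:
  assumes "u \<in> weighted_Lp_space q l"
  obtains i where "0 \<le> i" "(\<integral>\<^sup>+ y. ennreal (\<bar>u y\<bar> powr q * norm y powr (- l)) \<partial>lebesgue) = ennreal i"
    "weighted_Lp_norm q l u = ennreal (i powr (1 / q))"
proof -
  have "(\<integral>\<^sup>+ y. ennreal (\<bar>u y\<bar> powr q * norm y powr (- l)) \<partial>lebesgue) < top"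
    using assms by (simp add: weighted_Lp_space_def weighted_Lp_norm_def ennreal_rpow_less_top_iff[simplified])
  then obtain i where "0 \<le> i" "(\<integral>\<^sup>+ y. ennreal (\<bar>u y\<bar> powr q * norm y powr (- l)) \<partial>lebesgue) = ennreal i"
    by (cases "\<integral>\<^sup>+ y. ennreal (\<bar>u y\<bar> powr q * norm y powr (- l)) \<partial>lebesgue") auto
  then show ?thesis using that by (simp add: weighted_Lp_norm_def ennreal_rpow_ennreal)
qed

text \<open>Because \<open>l * q = \<alpha> * p\<close>, the Morrey integrand is the power
  \<open>\<theta> = p / q\<close> of the weighted one. Hoelder on a ball leaves the volume to the
  power \<open>1 - \<theta>\<close>, and \<open>m = N * \<theta>\<close> is the exponent for which
  all powers of \<open>R\<close> cancel.\<close>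

theorem weighted_Lp_embeds_morrey:
  fixes p q \<alpha> m l :: real
  assumes p: "1 \<le> p" "p < q" and m: "m = real CARD('n::finite) * p / q" and l: "l * q = \<alpha> * p"
  shows "continuous_embedding (weighted_Lp_space q \<alpha> :: (real^'n \<Rightarrow> real) set) (weighted_Lp_norm q \<alpha>)
      (morrey_space p m l) (morrey_norm p m l)"
proof -
  define N where "N = real CARD('n)"
  define V where "V = unit_ball_vol N"
  define \<theta> where "\<theta> = p / q"
  have V: "V > 0" by (simp add: V_def N_def)
  have q: "q > 0" using p by simp
  have \<theta>: "0 < \<theta>" "\<theta> < 1" using p by (auto simp: \<theta>_def)
  define C where "C = V powr ((1 - \<theta>) / p)"
  have C: "C > 0" using V by (simp add: C_def)
  have main: "morrey_norm p m l u \<le> ennreal C * weighted_Lp_norm q \<alpha> u" if u: "u \<in> weighted_Lp_space q \<alpha>" for u :: "real^'n \<Rightarrow> real"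
  proof -
    have [measurable]: "u \<in> borel_measurable lebesgue" using u by (simp add: weighted_Lp_space_def)
    have nm[measurable]: "norm \<in> borel_measurable (lebesgue :: (real^'n) measure)"
      by (simp add: measurable_completion)
    obtain i where i: "0 \<le> i" "(\<integral>\<^sup>+ y. ennreal (\<bar>u y\<bar> powr q * norm y powr (- \<alpha>)) \<partial>lebesgue) = ennreal i"
      "weighted_Lp_norm q \<alpha> u = ennreal (i powr (1 / q))"
      using weighted_Lp_norm_eq[OF u] by blast
    have "ennreal_rpow (ennreal (R powr (m - real CARD('n))) * (\<integral>\<^sup>+ y \<in> ball x R. ennreal (\<bar>u y\<bar> powr p / norm y powr l) \<partial>lebesgue)) (1 / p)
      \<le> ennreal C * ennreal (i powr (1 / q))" if R: "R > 0" for R x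
    proof -
      have eq: "\<bar>u y\<bar> powr p / norm y powr l = (\<bar>u y\<bar> powr q * norm y powr (- \<alpha>)) powr \<theta>" for y
      proof -
        have "q * \<theta> = p" "(- \<alpha>) * \<theta> = - l" using q l by (auto simp: \<theta>_def field_simps)
        then show ?thesis unfolding powr_mult powr_powr by (simp add: powr_minus divide_inverse)
      qed
      have "(\<integral>\<^sup>+ y \<in> ball x R. ennreal (\<bar>u y\<bar> powr p / norm y powr l) \<partial>lebesgue) \<le> ennreal (i powr \<theta> * (V * R powr N) powr (1 - \<theta>))"
        unfolding eq
      proof (rule set_nn_integral_powr_le)
        have "emeasure lborel (ball x R) = ennreal (V * R ^ CARD('n))" using R by (simp add: emeasure_ball V_def N_def)
        then show "emeasure lebesgue (ball x R) = ennreal (V * R powr N)" using R by (simp add: N_def powr_realpow)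
      qed (use \<theta> i V R in auto)
      then have "ennreal (R powr (m - real CARD('n))) * (\<integral>\<^sup>+ y \<in> ball x R. ennreal (\<bar>u y\<bar> powr p / norm y powr l) \<partial>lebesgue)
         \<le> ennreal (R powr (m - real CARD('n))) * ennreal (i powr \<theta> * (V * R powr N) powr (1 - \<theta>))"
        by (rule mult_left_mono) simp
      also have "... = ennreal (i powr \<theta> * V powr (1 - \<theta>) * (R powr (m - N) * R powr (N * (1 - \<theta>))))"
        by (simp add: N_def powr_mult powr_powr mult_ac flip: ennreal_mult)
      also have "R powr (m - N) * R powr (N * (1 - \<theta>)) = 1"
      proof -
        have "m - N + N * (1 - \<theta>) = 0" by (simp add: m \<theta>_def N_def algebra_simps)
        then show ?thesis using R by (simp flip: powr_add)
      qed
      finally have "ennreal_rpow (ennreal (R powr (m - real CARD('n))) * (\<integral>\<^sup>+ y \<in> ball x R. ennreal (\<bar>u y\<bar> powr p / norm y powr l) \<partial>lebesgue)) (1 / p)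
         \<le> ennreal_rpow (ennreal (i powr \<theta> * V powr (1 - \<theta>))) (1 / p)"
        using p by (intro ennreal_rpow_mono) auto
      also have "... = ennreal ((i powr \<theta> * V powr (1 - \<theta>)) powr (1 / p))"
        by (rule ennreal_rpow_ennreal) simp
      also have "(i powr \<theta> * V powr (1 - \<theta>)) powr (1 / p) = C * i powr (1 / q)"
      proof -
        have "\<theta> * (1 / p) = 1 / q" "(1 - \<theta>) * (1 / p) = (1 - \<theta>) / p" using p by (auto simp: \<theta>_def)
        then show ?thesis unfolding powr_mult powr_powr C_def by simp
      qed
      finally show ?thesis using C by (simp add: ennreal_mult)
    qed
    then show ?thesis unfolding morrey_norm_def i(3) by (intro SUP_least) auto
  qed
  have "weighted_Lp_space q \<alpha> \<subseteq> (morrey_space p m l :: (real^'n \<Rightarrow> real) set)"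
  proof
    fix u :: "real^'n \<Rightarrow> real" assume u: "u \<in> weighted_Lp_space q \<alpha>"
    have "ennreal C * weighted_Lp_norm q \<alpha> u < \<infinity>" using u by (simp add: weighted_Lp_space_def ennreal_mult_less_top)
    then show "u \<in> morrey_space p m l" using u main[OF u] by (auto simp: morrey_space_def weighted_Lp_space_def intro: le_less_trans)
  qed
  then show ?thesis unfolding continuous_embedding_def using C main by blast
qed

subsection \<open>Dilation invariance\<close>

lemma nn_integral_dilation:
  fixes F :: "real^'n \<Rightarrow> ennreal"
  assumes "0 < t" "F \<in> borel_measurable lebesgue"
  shows "(\<integral>\<^sup>+x. F (t *\<^sub>R x) \<partial>lebesgue) = ennreal (t powr (- real CARD('n))) * (\<integral>\<^sup>+x. F x \<partial>lebesgue)"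
proof -
  have "(\<integral>\<^sup>+x. F x \<partial>lebesgue) = ennreal (t powr real CARD('n)) * (\<integral>\<^sup>+x. F (t *\<^sub>R x) \<partial>lebesgue)"
    using nn_integral_lebesgue_affine[of t F 0] assms by (simp add: powr_realpow)
  then have "ennreal (t powr (- real CARD('n))) * (\<integral>\<^sup>+x. F x \<partial>lebesgue) = 
    (ennreal (t powr (- real CARD('n))) * ennreal (t powr real CARD('n))) * (\<integral>\<^sup>+x. F (t *\<^sub>R x) \<partial>lebesgue)"
    by (simp only: mult.assoc)
  also have "ennreal (t powr (- real CARD('n))) * ennreal (t powr real CARD('n)) = 1"
    using assms by (simp flip: ennreal_mult powr_add)
  finally show ?thesis by simp
qed

lemma borel_measurable_dilation:
  assumes "u \<in> borel_measurable lebesgue" "0 < t"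
  shows "dilation a t u \<in> borel_measurable lebesgue"
  using integral_lebesgue_affine(3)[of t u 0] assms by (auto simp: dilation_def)

lemma dilation_invariantI:
  assumes "\<And>t u. 0 < t \<Longrightarrow> u \<in> borel_measurable lebesgue \<Longrightarrow> N (dilation a t u) = N u"
  shows "dilation_invariant a {u \<in> borel_measurable lebesgue. N u < \<infinity>} N"
  unfolding dilation_invariant_def using assms borel_measurable_dilation by auto

text \<open>The amplitude gives \<open>a * q\<close> powers of \<open>t\<close> and the weight gives
  \<open>l\<close>; the hypothesis makes them cancel the Jacobian. The case \<open>l = 0\<close>
  serves the Lebesgue exponent in the Sobolev space.\<close>

lemma weighted_Lp_norm_dilation:
  fixes u :: "real^'n \<Rightarrow> real"
  assumes aq: "a * q = real CARD('n) - l" and t: "0 < t" and u: "u \<in> borel_measurable lebesgue"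
  shows "weighted_Lp_norm q l (dilation a t u) = weighted_Lp_norm q l u"
proof -
  have [measurable]: "u \<in> borel_measurable lebesgue" by fact
  have [measurable]: "norm \<in> borel_measurable (lebesgue :: (real^'n) measure)"
    by (simp add: measurable_completion)
  let ?F = "\<lambda>y. ennreal (t powr real CARD('n)) * ennreal (\<bar>u y\<bar> powr q * norm y powr (- l))"
  have "(\<integral>\<^sup>+ y. ennreal (\<bar>dilation a t u y\<bar> powr q * norm y powr (- l)) \<partial>lebesgue) = (\<integral>\<^sup>+ y. ?F (t *\<^sub>R y) \<partial>lebesgue)"
  proof (rule nn_integral_cong)
    fix y :: "real^'n"
    have "\<bar>dilation a t u y\<bar> powr q * norm y powr (- l) = t powr (a * q) * (\<bar>u (t *\<^sub>R y)\<bar> powr q * norm y powr (- l))"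
      by (simp add: dilation_def abs_mult powr_mult powr_powr)
    also have "t powr (a * q) = t powr real CARD('n) * t powr (- l)" by (simp add: aq flip: powr_add)
    also have "t powr real CARD('n) * t powr (- l) * (\<bar>u (t *\<^sub>R y)\<bar> powr q * norm y powr (- l)) = 
       t powr real CARD('n) * (\<bar>u (t *\<^sub>R y)\<bar> powr q * norm (t *\<^sub>R y) powr (- l))"
      using t by (simp add: powr_mult mult_ac)
    finally show "ennreal (\<bar>dilation a t u y\<bar> powr q * norm y powr (- l)) = ?F (t *\<^sub>R y)"
      by (simp flip: ennreal_mult)
  qed
  also have "... = ennreal (t powr (- real CARD('n))) * (\<integral>\<^sup>+ y. ?F y \<partial>lebesgue)"
    by (rule nn_integral_dilation[OF t]) measurable
  also have "... = (ennreal (t powr (- real CARD('n))) * ennreal (t powr real CARD('n))) * (\<integral>\<^sup>+ y. ennreal (\<bar>u y\<bar> powr q * norm y powr (- l)) \<partial>lebesgue)"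
    by (subst nn_integral_cmult) (auto simp: mult.assoc)
  also have "ennreal (t powr (- real CARD('n))) * ennreal (t powr real CARD('n)) = 1"
    using t by (simp flip: ennreal_mult powr_add)
  finally show ?thesis by (simp add: weighted_Lp_norm_def)
qed

lemma weighted_Lp_dilation_invariant:
  assumes "a * q = real CARD('n) - l"
  shows "dilation_invariant a (weighted_Lp_space q l :: (real^'n \<Rightarrow> real) set) (weighted_Lp_norm q l)"
  unfolding weighted_Lp_space_def by (rule dilation_invariantI) (rule weighted_Lp_norm_dilation[OF assms])

text \<open>Invariance holds term by term: the dilate on the ball of radius \<open>R\<close> at
  \<open>x\<close> matches \<open>u\<close> on the ball of radius \<open>t * R\<close> at
  \<open>t x\<close>, and this relabelling is a bijection of the index set of the supremum.\<close>

lemma morrey_norm_dilation: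
  fixes u :: "real^'n \<Rightarrow> real"
  assumes m: "a * p = m - l" and t: "0 < t" and u: "u \<in> borel_measurable lebesgue"
  shows "morrey_norm p m l (dilation a t u) = morrey_norm p m l u"
proof -
  have [measurable]: "u \<in> borel_measurable lebesgue" by fact
  let ?J = "\<lambda>R x. (\<integral>\<^sup>+ y \<in> ball (t *\<^sub>R x) (t * R). ennreal (\<bar>u y\<bar> powr p / norm y powr l) \<partial>lebesgue)"
  have [measurable]: "norm \<in> borel_measurable (lebesgue :: (real^'n) measure)"
    by (simp add: measurable_completion)
  define T where "T w R x = ennreal (R powr (m - real CARD('n))) * (\<integral>\<^sup>+ y \<in> ball x R. ennreal (\<bar>w y\<bar> powr p / norm y powr l) \<partial>lebesgue)"
    for w :: "real^'n \<Rightarrow> real" and R x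
  have T: "T (dilation a t u) R x = T u (t * R) (t *\<^sub>R x)" if R: "0 < R" for R x
  proof -
    have Fm: "(\<lambda>y. ennreal (\<bar>u y\<bar> powr p / norm y powr l) * indicator (ball (t *\<^sub>R x) (t * R)) y) \<in> borel_measurable lebesgue"
      by (intro borel_measurable_times_ennreal borel_measurable_indicator measurable_ennreal borel_measurable_divide
          powr_real_measurable borel_measurable_abs measurable_compose[OF _ measurable_ennreal]) (auto simp: u measurable_completion)
    let ?F = "\<lambda>y. ennreal (t powr m) * (ennreal (\<bar>u y\<bar> powr p / norm y powr l) * indicator (ball (t *\<^sub>R x) (t * R)) y)"
    have "(\<integral>\<^sup>+ y \<in> ball x R. ennreal (\<bar>dilation a t u y\<bar> powr p / norm y powr l) \<partial>lebesgue) = (\<integral>\<^sup>+ y. ?F (t *\<^sub>R y) \<partial>lebesgue)"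
    proof (rule nn_integral_cong)
      fix y :: "real^'n"
      have "dist (t *\<^sub>R x) (t *\<^sub>R y) = t * dist x y"
        using t by (simp add: dist_norm flip: scaleR_diff_right)
      then have ball: "indicator (ball x R) y = (indicator (ball (t *\<^sub>R x) (t * R)) (t *\<^sub>R y) :: ennreal)"
        using t by (simp add: indicator_def)
      have "\<bar>dilation a t u y\<bar> powr p / norm y powr l = t powr (a * p) * (\<bar>u (t *\<^sub>R y)\<bar> powr p / norm y powr l)"
        by (simp add: dilation_def abs_mult powr_mult powr_powr)
      also have "t powr (a * p) = t powr m / t powr l" by (simp add: m powr_diff)
      also have "t powr m / t powr l * (\<bar>u (t *\<^sub>R y)\<bar> powr p / norm y powr l) = t powr m * (\<bar>u (t *\<^sub>R y)\<bar> powr p / norm (t *\<^sub>R y) powr l)"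
        using t by (simp add: powr_mult)
      finally have eq: "\<bar>dilation a t u y\<bar> powr p / norm y powr l = t powr m * (\<bar>u (t *\<^sub>R y)\<bar> powr p / norm (t *\<^sub>R y) powr l)" .
      show "ennreal (\<bar>dilation a t u y\<bar> powr p / norm y powr l) * indicator (ball x R) y = ?F (t *\<^sub>R y)"
        unfolding ball eq by (simp only: ennreal_mult'[OF powr_ge_zero] mult.assoc)
    qed
    also have "... = ennreal (t powr (- real CARD('n))) * (\<integral>\<^sup>+ y. ?F y \<partial>lebesgue)"
      by (rule nn_integral_dilation[OF t borel_measurable_times_ennreal[OF borel_measurable_const Fm]])
    also have "(\<integral>\<^sup>+ y. ?F y \<partial>lebesgue) = ennreal (t powr m) * ?J R x"
      by (rule nn_integral_cmult[OF Fm])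
    finally have I: "(\<integral>\<^sup>+ y \<in> ball x R. ennreal (\<bar>dilation a t u y\<bar> powr p / norm y powr l) \<partial>lebesgue) =
      ennreal (t powr (- real CARD('n))) * (ennreal (t powr m) * ?J R x)" .
    have gen: "ennreal A * (ennreal B * (ennreal C * J)) = ennreal (A * (C * B)) * J" if "0 \<le> A" "0 \<le> B" "0 \<le> C" for A B C J
      using that by (simp add: ennreal_mult mult_ac)
    have "T (dilation a t u) R x = ennreal (R powr (m - real CARD('n)) * (t powr m * t powr (- real CARD('n)))) * ?J R x"
      unfolding T_def I by (rule gen) auto
    also have "R powr (m - real CARD('n)) * (t powr m * t powr (- real CARD('n))) = (t * R) powr (m - real CARD('n))"
    proof -
      have "t powr m * t powr (- real CARD('n)) = t powr (m - real CARD('n))" by (simp flip: powr_add)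
      then show ?thesis unfolding powr_mult by (simp only: mult.commute)
    qed
    finally show ?thesis by (simp add: T_def)
  qed
  have im: "(\<lambda>(R, x). (t * R, t *\<^sub>R x)) ` ({0<..} \<times> (UNIV :: (real^'n) set)) = {0<..} \<times> UNIV"
  proof (intro subset_antisym subsetI)
    fix z :: "real \<times> (real^'n)" assume z: "z \<in> {0<..} \<times> UNIV"
    show "z \<in> (\<lambda>(R, x). (t * R, t *\<^sub>R x)) ` ({0<..} \<times> UNIV)"
      by (rule image_eqI[of _ _ "(fst z / t, (1 / t) *\<^sub>R snd z)"]) (use z t in \<open>auto simp: prod_eq_iff\<close>)
  qed (use t in auto)
  have "morrey_norm p m l u = (SUP (R, x) \<in> {0<..} \<times> UNIV. ennreal_rpow (T u R x) (1 / p))"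
    by (simp add: morrey_norm_def T_def)
  also have "... = (SUP z \<in> {0<..} \<times> UNIV. ennreal_rpow (T u (t * fst z) (t *\<^sub>R snd z)) (1 / p))"
    by (subst im[symmetric]) (simp add: image_image case_prod_beta)
  also have "... = (SUP (R, x) \<in> {0<..} \<times> UNIV. ennreal_rpow (T (dilation a t u) R x) (1 / p))"
    by (rule SUP_cong) (auto simp: T)
  also have "... = morrey_norm p m l (dilation a t u)"
    by (simp add: morrey_norm_def T_def)
  finally show ?thesis ..
qed

lemma morrey_dilation_invariant:
  assumes "a * p = m - l"
  shows "dilation_invariant a (morrey_space p m l :: (real^'n \<Rightarrow> real) set) (morrey_norm p m l)"
  unfolding morrey_space_def by (rule dilation_invariantI) (rule morrey_norm_dilation[OF assms])

section \<open>Dilations and the Fourier transform\<close>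

lemma schwartz_borel_measurable:
  assumes "\<phi> \<in> schwartz"
  shows "\<phi> \<in> borel_measurable lebesgue"
proof -
  have "iterated_partial [] \<phi> differentiable at x" for x
    using assms unfolding schwartz_def by blast
  then have "continuous_on UNIV \<phi>"
    by (auto intro!: differentiable_imp_continuous_within continuous_at_imp_continuous_on)
  then show ?thesis by (intro measurable_completion) (simp add: borel_measurable_continuous_onI)
qed

lemma integral_dilation:
  fixes F :: "real^'n \<Rightarrow> complex"
  assumes "0 < t" "F \<in> borel_measurable lebesgue"
  shows "(\<integral>x. F (t *\<^sub>R x) \<partial>lebesgue) = t powr (- real CARD('n)) *\<^sub>R (\<integral>x. F x \<partial>lebesgue)"
    and "integrable lebesgue (\<lambda>x. F (t *\<^sub>R x)) \<longleftrightarrow> integrable lebesgue F"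
  using integral_lebesgue_affine(1,2)[of t F 0] assms by (auto simp: powr_minus powr_realpow)

lemma fourier_integral_dilation:
  fixes \<phi> :: "real^'n \<Rightarrow> complex"
  assumes t: "0 < t" and m: "\<phi> \<in> borel_measurable lebesgue"
  shows "fourier_integral (\<lambda>x. \<phi> (t *\<^sub>R x)) (t *\<^sub>R y) = t powr (- real CARD('n)) *\<^sub>R fourier_integral \<phi> y"
proof -
  have [measurable]: "(\<lambda>x. cis (- (x \<bullet> y))) \<in> borel_measurable (lebesgue :: (real^'n) measure)"
    by (intro measurable_completion) measurable
  have "(\<integral>x. cis (- (x \<bullet> t *\<^sub>R y)) * \<phi> (t *\<^sub>R x) \<partial>lebesgue) = (\<integral>x. cis (- ((t *\<^sub>R x) \<bullet> y)) * \<phi> (t *\<^sub>R x) \<partial>lebesgue)"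
    by simp
  also have "... = t powr (- real CARD('n)) *\<^sub>R (\<integral>x. cis (- (x \<bullet> y)) * \<phi> x \<partial>lebesgue)"
    using m by (intro integral_dilation(1)[OF t]) measurable
  finally show ?thesis by (simp add: fourier_integral_def)
qed

text \<open>Dilation is moved onto the test function, which stays in the Schwartz class. The
  exponent \<open>a - n\<close> combines the amplitude with the Jacobian of the dilation.\<close>

lemma has_fourier_transform_dilation:
  fixes u :: "real^'n \<Rightarrow> real"
  assumes ft: "has_fourier_transform (\<lambda>x. complex_of_real (u x)) g" and t: "0 < t"
  shows "has_fourier_transform (\<lambda>x. complex_of_real (dilation a t u x)) (\<lambda>\<xi>. t powr (a - real CARD('n)) *\<^sub>R g ((1 / t) *\<^sub>R \<xi>))"
  unfolding has_fourier_transform_def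
proof (intro conjI ballI)
  let ?n = "real CARD('n)"
  have um: "(\<lambda>x. complex_of_real (u x)) \<in> borel_measurable lebesgue" and gm: "g \<in> borel_measurable lebesgue"
    using ft by (auto simp: has_fourier_transform_def)
  have t': "0 < 1 / t" using t by simp
  have "u \<in> borel_measurable lebesgue" using measurable_compose[OF um borel_measurable_Re] by simp
  then show "(\<lambda>x. complex_of_real (dilation a t u x)) \<in> borel_measurable lebesgue"
    using borel_measurable_dilation[OF _ t, of u a] by simp
  have gm': "(\<lambda>\<xi>. g ((1 / t) *\<^sub>R \<xi>)) \<in> borel_measurable lebesgue"
    using integral_lebesgue_affine(3)[of "1 / t" g 0] gm t by simp
  then show "(\<lambda>\<xi>. t powr (a - ?n) *\<^sub>R g ((1 / t) *\<^sub>R \<xi>)) \<in> borel_measurable lebesgue"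
    by measurable
  fix \<phi> :: "real^'n \<Rightarrow> complex" assume \<phi>: "\<phi> \<in> schwartz"
  \<comment> \<open>Testing the dilate with \<phi> corresponds to testing \<open>u\<close> with this
    function.\<close>
  let ?\<psi> = "\<lambda>x. \<phi> (t *\<^sub>R x)"
  have \<psi>: "?\<psi> \<in> schwartz" using schwartz_scaleR[OF \<phi>] t by simp
  have \<phi>m: "\<phi> \<in> borel_measurable lebesgue" by (rule schwartz_borel_measurable[OF \<phi>])
  let ?F = "\<lambda>x. complex_of_real (u x) * fourier_integral ?\<psi> x"
  let ?G = "\<lambda>\<xi>. g \<xi> * ?\<psi> \<xi>"
  have i: "integrable lebesgue ?F" "integrable lebesgue ?G" "(\<integral>x. ?F x \<partial>lebesgue) = (\<integral>x. ?G x \<partial>lebesgue)"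
    using ft \<psi> by (auto simp: has_fourier_transform_def)
  have Feq: "complex_of_real (dilation a t u x) * fourier_integral \<phi> x = t powr (a + ?n) *\<^sub>R ?F (t *\<^sub>R x)" for x
  proof -
    have "t powr (a + ?n) * t powr (- ?n) = t powr a" by (simp flip: powr_add)
    then have "t powr (a + ?n) *\<^sub>R ?F (t *\<^sub>R x) = t powr a *\<^sub>R (complex_of_real (u (t *\<^sub>R x)) * fourier_integral \<phi> x)"
      unfolding fourier_integral_dilation[OF t \<phi>m] by (simp only: mult_scaleR_right scaleR_scaleR)
    then show ?thesis
      by (simp only: dilation_def of_real_mult scaleR_conv_of_real mult.assoc)
  qed
  have Geq: "t powr (a - ?n) *\<^sub>R g ((1 / t) *\<^sub>R x) * \<phi> x = t powr (a - ?n) *\<^sub>R ?G ((1 / t) *\<^sub>R x)" for x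
    using t by simp
  note F = integral_dilation[OF t borel_measurable_integrable[OF i(1)]]
  note G = integral_dilation[OF t' borel_measurable_integrable[OF i(2)]]
  show "integrable lebesgue (\<lambda>x. complex_of_real (dilation a t u x) * fourier_integral \<phi> x)"
    unfolding Feq using F(2) i(1) by (intro integrable_scaleR_right) blast
  show "integrable lebesgue (\<lambda>\<xi>. t powr (a - ?n) *\<^sub>R g ((1 / t) *\<^sub>R \<xi>) * \<phi> \<xi>)"
    unfolding Geq using G(2) i(2) by (intro integrable_scaleR_right) blast
  have "(\<integral>x. complex_of_real (dilation a t u x) * fourier_integral \<phi> x \<partial>lebesgue) = t powr (a + ?n) *\<^sub>R t powr (- ?n) *\<^sub>R (\<integral>x. ?F x \<partial>lebesgue)"
    unfolding Feq by (subst integral_scaleR_right) (simp only: F(1))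
  moreover have "(\<integral>\<xi>. t powr (a - ?n) *\<^sub>R g ((1 / t) *\<^sub>R \<xi>) * \<phi> \<xi> \<partial>lebesgue) = t powr (a - ?n) *\<^sub>R (1 / t) powr (- ?n) *\<^sub>R (\<integral>x. ?G x \<partial>lebesgue)"
    unfolding Geq by (subst integral_scaleR_right) (simp only: G(1))
  moreover have "t powr (a + ?n) * t powr (- ?n) = t powr (a - ?n) * (1 / t) powr (- ?n)"
  proof -
    have "(1 / t) powr (- ?n) = t powr ?n" using t by (simp add: powr_divide powr_minus)
    then show ?thesis by (simp flip: powr_add)
  qed
  ultimately show "(\<integral>x. complex_of_real (dilation a t u x) * fourier_integral \<phi> x \<partial>lebesgue) = (\<integral>\<xi>. t powr (a - ?n) *\<^sub>R g ((1 / t) *\<^sub>R \<xi>) * \<phi> \<xi> \<partial>lebesgue)"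
    using i(3) by (simp only: scaleR_scaleR)
qed


lemma has_fourier_transform_fourier_transform:
  assumes "has_fourier_transform (\<lambda>x. complex_of_real (u x)) g"
  shows "has_fourier_transform (\<lambda>x. complex_of_real (u x)) (fourier_transform u)"
  unfolding fourier_transform_def by (rule someI[of "has_fourier_transform (\<lambda>x. complex_of_real (u x))", OF assms])

lemma hom_sobolev_norm_eq_Lp_norm:
  "hom_sobolev_norm s u = Lp_norm 2 (\<lambda>\<xi>. norm \<xi> powr s *\<^sub>R fourier_transform u \<xi>)"
proof -
  have "norm (norm \<xi> powr s *\<^sub>R fourier_transform u \<xi>) powr 2 = norm \<xi> powr (2 * s) * (norm (fourier_transform u \<xi>))\<^sup>2" for \<xi>
    by (simp add: powr_mult powr_powr mult.commute)
  then show ?thesis by (simp add: hom_sobolev_norm_def Lp_norm_def)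
qed

text \<open>The integrands differ at the origin, since \<open>0 powr 0 = 0\<close>.\<close>

lemma Lp_norm_eq_weighted_Lp_norm:
  fixes u :: "real^'n \<Rightarrow> real"
  shows "Lp_norm q u = weighted_Lp_norm q 0 u"
proof -
  have "AE y in lebesgue. y \<noteq> (0 :: real^'n)" by (intro AE_completion AE_lborel_singleton)
  then have "AE y in lebesgue. ennreal (norm (u y) powr q) = ennreal (\<bar>u y\<bar> powr q * norm y powr (- 0))"
    by eventually_elim simp
  then show ?thesis unfolding Lp_norm_def weighted_Lp_norm_def by (intro arg_cong2[where f=ennreal_rpow] nn_integral_cong_AE refl)
qed

text \<open>\<open>fourier_transform\<close> is an arbitrary choice, so its value at the dilate need
  not be the rescaled transform of \<open>u\<close>. Uniqueness makes the two agree almost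
  everywhere, and the norm sees nothing more.\<close>

lemma hom_sobolev_dilation_invariant:
  fixes s :: real
  assumes s: "2 * s < real CARD('n::finite)"
  shows "dilation_invariant ((real CARD('n) - 2 * s) / 2) (hom_sobolev_space s :: (real^'n \<Rightarrow> real) set) (hom_sobolev_norm s)"
  unfolding dilation_invariant_def
proof (intro allI impI ballI)
  fix t :: real and u :: "real^'n \<Rightarrow> real"
  assume t: "0 < t" and u: "u \<in> hom_sobolev_space s"
  define n where "n = real CARD('n)"
  define a where "a = (n - 2 * s) / 2"
  let ?q = "2 * n / (n - 2 * s)"
  have um: "u \<in> borel_measurable lebesgue" and uL: "Lp_norm ?q u < \<infinity>"
    using u by (auto simp: hom_sobolev_space_def Lp_space_def n_def)
  obtain g where "has_fourier_transform (\<lambda>x. complex_of_real (u x)) g"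
    using u by (auto simp: hom_sobolev_space_def)
  then have ft: "has_fourier_transform (\<lambda>x. complex_of_real (u x)) (fourier_transform u)"
    by (rule has_fourier_transform_fourier_transform)
  let ?v = "dilation a t u"
  let ?g = "fourier_transform u"
  let ?G = "\<lambda>\<xi>. t powr (a - n) *\<^sub>R ?g ((1 / t) *\<^sub>R \<xi>)"
  have ftG: "has_fourier_transform (\<lambda>x. complex_of_real (?v x)) ?G"
    unfolding n_def by (rule has_fourier_transform_dilation[OF ft t])
  have ftv: "has_fourier_transform (\<lambda>x. complex_of_real (?v x)) (fourier_transform ?v)"
    by (rule has_fourier_transform_fourier_transform[OF ftG])
  have ae: "AE \<xi> in lebesgue. fourier_transform ?v \<xi> = ?G \<xi>"
    by (rule has_fourier_transform_unique[OF ftv ftG])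
  have gm: "?g \<in> borel_measurable lebesgue" and vm: "fourier_transform ?v \<in> borel_measurable lebesgue"
    using ft ftv by (auto simp: has_fourier_transform_def)
  have nm: "(\<lambda>\<xi>. norm \<xi> powr b) \<in> borel_measurable (lebesgue :: (real^'n) measure)" for b
    by (intro measurable_completion) simp
  have Fm: "(\<lambda>\<eta>. ennreal (norm \<eta> powr (2 * s) * (norm (?g \<eta>))\<^sup>2)) \<in> borel_measurable lebesgue"
    by (intro measurable_compose[OF _ measurable_ennreal] borel_measurable_times nm borel_measurable_power measurable_compose[OF gm borel_measurable_norm])
  let ?F = "\<lambda>\<eta>. ennreal (t powr (- n)) * ennreal (norm \<eta> powr (2 * s) * (norm (?g \<eta>))\<^sup>2)"
  have "(\<integral>\<^sup>+ \<xi>. ennreal (norm \<xi> powr (2 * s) * (norm (fourier_transform ?v \<xi>))\<^sup>2) \<partial>lebesgue) = (\<integral>\<^sup>+ \<xi>. ?F ((1 / t) *\<^sub>R \<xi>) \<partial>lebesgue)"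
  proof (rule nn_integral_cong_AE)
    show "AE \<xi> in lebesgue. ennreal (norm \<xi> powr (2 * s) * (norm (fourier_transform ?v \<xi>))\<^sup>2) = ?F ((1 / t) *\<^sub>R \<xi>)"
      using ae
    proof eventually_elim
      case (elim \<xi>)
      have e: "norm \<xi> powr (2 * s) = t powr (2 * s) * norm ((1 / t) *\<^sub>R \<xi>) powr (2 * s)"
        using t by (simp flip: powr_mult)
      \<comment> \<open>The weight contributes \<open>2 * s\<close> and the squared amplitude
        \<open>2 * a - 2 * n\<close>; by the choice of \<open>a\<close> the sum is
        \<open>- n\<close>, which the Jacobian of \<open>\<xi> / t\<close> compensates.\<close>
      have "(t powr (a - n))\<^sup>2 = t powr (2 * a - 2 * n)" by (simp add: power2_eq_square flip: powr_add)
      moreover have "2 * s + (2 * a - 2 * n) = - n" by (simp add: a_def field_simps)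
      ultimately have t2: "t powr (2 * s) * (t powr (a - n))\<^sup>2 = t powr (- n)" by (simp only: powr_add[symmetric])
      have "norm \<xi> powr (2 * s) * (norm (fourier_transform ?v \<xi>))\<^sup>2 =
        (t powr (2 * s) * (t powr (a - n))\<^sup>2) * (norm ((1 / t) *\<^sub>R \<xi>) powr (2 * s) * (norm (?g ((1 / t) *\<^sub>R \<xi>)))\<^sup>2)"
        unfolding elim norm_scaleR[of "t powr (a - n)"] power_mult_distrib e by (simp only: abs_of_nonneg[OF powr_ge_zero] mult_ac)
      then show ?case unfolding t2 by (simp only: ennreal_mult'[OF powr_ge_zero])
    qed
  qed
  also have "... = ennreal ((1 / t) powr (- n)) * (\<integral>\<^sup>+ \<eta>. ?F \<eta> \<partial>lebesgue)"
    unfolding n_def using t by (intro nn_integral_dilation borel_measurable_times_ennreal borel_measurable_const Fm) simp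
  also have "(\<integral>\<^sup>+ \<eta>. ?F \<eta> \<partial>lebesgue) = ennreal (t powr (- n)) * (\<integral>\<^sup>+ \<eta>. ennreal (norm \<eta> powr (2 * s) * (norm (?g \<eta>))\<^sup>2) \<partial>lebesgue)"
    by (rule nn_integral_cmult[OF Fm])
  also have "ennreal ((1 / t) powr (- n)) * (ennreal (t powr (- n)) * (\<integral>\<^sup>+ \<eta>. ennreal (norm \<eta> powr (2 * s) * (norm (?g \<eta>))\<^sup>2) \<partial>lebesgue))
     = (\<integral>\<^sup>+ \<eta>. ennreal (norm \<eta> powr (2 * s) * (norm (?g \<eta>))\<^sup>2) \<partial>lebesgue)"
  proof -
    have "(1 / t) powr (- n) * t powr (- n) = 1" using t by (simp flip: powr_mult)
    then have "ennreal ((1 / t) powr (- n)) * ennreal (t powr (- n)) = 1" by (simp flip: ennreal_mult)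
    then show ?thesis by (simp only: mult.assoc[symmetric] mult_1_left)
  qed
  finally have N: "hom_sobolev_norm s ?v = hom_sobolev_norm s u" by (simp only: hom_sobolev_norm_def)
  have "a * ?q = real CARD('n) - 0" using s by (simp add: a_def n_def)
  then have "Lp_norm ?q ?v = Lp_norm ?q u"
    unfolding Lp_norm_eq_weighted_Lp_norm by (intro weighted_Lp_norm_dilation t um)
  then have "?v \<in> Lp_space ?q"
    using uL borel_measurable_dilation[OF um t] by (simp add: Lp_space_def)
  moreover have "(\<lambda>\<xi>. norm \<xi> powr s *\<^sub>R fourier_transform ?v \<xi>) \<in> Lp_space 2"
  proof -
    have "Lp_norm 2 (\<lambda>\<xi>. norm \<xi> powr s *\<^sub>R ?g \<xi>) < \<infinity>"
      using u by (simp add: hom_sobolev_space_def Lp_space_def)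
    then have "Lp_norm 2 (\<lambda>\<xi>. norm \<xi> powr s *\<^sub>R fourier_transform ?v \<xi>) < \<infinity>"
      using N by (simp add: hom_sobolev_norm_eq_Lp_norm)
    then show ?thesis by (simp add: Lp_space_def borel_measurable_scaleR[OF nm vm])
  qed
  ultimately have "?v \<in> hom_sobolev_space s"
    using ftv by (auto simp: hom_sobolev_space_def n_def)
  then show "dilation ((real CARD('n) - 2 * s) / 2) t u \<in> hom_sobolev_space s \<and>
      hom_sobolev_norm s (dilation ((real CARD('n) - 2 * s) / 2) t u) = hom_sobolev_norm s u"
    using N by (simp add: a_def n_def)
qed

subsection \<open>Main theorem\<close>

text \<open>The \<open>q\<close>-th root of \<open>C * f powr (q / 2)\<close> is
  \<open>C powr (1 / q)\<close> times the square root of \<open>f\<close>, and for \<open>f\<close>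
  the Sobolev integral that root is the Sobolev norm.\<close>

theorem hom_sobolev_embeds_weighted_Lp:
  fixes s \<alpha> q :: real
  assumes s: "0 < s" "s < 1" and \<alpha>: "0 < \<alpha>" "\<alpha> < 2 * s" "2 * s < real CARD('n::finite)"
    and q: "q = 2 * (real CARD('n) - \<alpha>) / (real CARD('n) - 2 * s)"
  shows "continuous_embedding (hom_sobolev_space s :: (real^'n \<Rightarrow> real) set) (hom_sobolev_norm s)
       (weighted_Lp_space q \<alpha>) (weighted_Lp_norm q \<alpha>)"
proof -
  have q0: "0 < q" using \<alpha> unfolding q by simp
  obtain C where C: "0 < C"
    "\<And>(u :: real^'n \<Rightarrow> real) g f. has_fourier_transform (\<lambda>x. complex_of_real (u x)) g \<Longrightarrow> 0 \<le> f \<Longrightarrow>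
       (\<integral>\<^sup>+\<xi>. ennreal (norm \<xi> powr (2 * s) * (norm (g \<xi>))\<^sup>2) \<partial>lebesgue) \<le> ennreal f \<Longrightarrow>
       (\<integral>\<^sup>+y. ennreal (\<bar>u y\<bar> powr q * norm y powr (- \<alpha>)) \<partial>lebesgue) \<le> ennreal (C * f powr (q / 2))"
    using hardy_sobolev_fourier_transform[OF s \<alpha> q] by blast
  have main: "weighted_Lp_norm q \<alpha> u \<le> ennreal (C powr (1 / q)) * hom_sobolev_norm s u \<and> hom_sobolev_norm s u < \<infinity>"
    if u: "u \<in> hom_sobolev_space s" for u :: "real^'n \<Rightarrow> real"
  proof -
    obtain g where "has_fourier_transform (\<lambda>x. complex_of_real (u x)) g"
      using u by (auto simp: hom_sobolev_space_def)
    then have ft: "has_fourier_transform (\<lambda>x. complex_of_real (u x)) (fourier_transform u)"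
      by (rule has_fourier_transform_fourier_transform)
    have fin: "hom_sobolev_norm s u < \<infinity>"
      using u by (simp add: hom_sobolev_space_def Lp_space_def hom_sobolev_norm_eq_Lp_norm)
    let ?I = "\<integral>\<^sup>+ \<xi>. ennreal (norm \<xi> powr (2 * s) * (norm (fourier_transform u \<xi>))\<^sup>2) \<partial>lebesgue"
    have "?I < \<infinity>" using fin unfolding hom_sobolev_norm_def ennreal_rpow_less_top_iff .
    then obtain f where f: "0 \<le> f" "?I = ennreal f" by (cases ?I) auto
    have "weighted_Lp_norm q \<alpha> u \<le> ennreal_rpow (ennreal (C * f powr (q / 2))) (1 / q)"
      unfolding weighted_Lp_norm_def using q0 f by (intro ennreal_rpow_mono C(2)[OF ft]) auto
    also have "... = ennreal ((C * f powr (q / 2)) powr (1 / q))"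
      using C(1) by (intro ennreal_rpow_ennreal) simp
    also have "(C * f powr (q / 2)) powr (1 / q) = C powr (1 / q) * f powr (1 / 2)"
      using q0 by (simp add: powr_mult powr_powr)
    also have "ennreal (C powr (1 / q) * f powr (1 / 2)) = ennreal (C powr (1 / q)) * hom_sobolev_norm s u"
      unfolding hom_sobolev_norm_def f(2) ennreal_rpow_ennreal[OF f(1)] by (rule ennreal_mult') simp
    finally show ?thesis using fin by blast
  qed
  have "hom_sobolev_space s \<subseteq> (weighted_Lp_space q \<alpha> :: (real^'n \<Rightarrow> real) set)"
  proof
    fix u :: "real^'n \<Rightarrow> real" assume u: "u \<in> hom_sobolev_space s"
    have "ennreal (C powr (1 / q)) * hom_sobolev_norm s u < \<infinity>"
      using main[OF u] by (simp add: ennreal_mult_less_top)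
    then have "weighted_Lp_norm q \<alpha> u < \<infinity>"
      using main[OF u] by (auto intro: le_less_trans)
    then show "u \<in> weighted_Lp_space q \<alpha>"
      using u by (simp add: weighted_Lp_space_def hom_sobolev_space_def Lp_space_def)
  qed
  moreover have "0 < C powr (1 / q)" using C(1) by simp
  ultimately show ?thesis unfolding continuous_embedding_def using main by blast
qed

theorem mainTheorem4:
  fixes s \<alpha> n q r p :: real
  assumes n: "n = real CARD('n::finite)"
    and s: "0 < s" "s < 1"
    and \<alpha>: "0 < \<alpha>" "\<alpha> < 2 * s" "2 * s < n"
    and q: "q = 2 * (n - \<alpha>) / (n - 2 * s)"
    and r: "r = \<alpha> / q"
    and p: "1 \<le> p" "p < q"
  shows
    "continuous_embedding
       (hom_sobolev_space s :: (real^'n \<Rightarrow> real) set) (hom_sobolev_norm s)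
       (weighted_Lp_space q \<alpha>) (weighted_Lp_norm q \<alpha>) \<and>
     continuous_embedding
       (weighted_Lp_space q \<alpha> :: (real^'n \<Rightarrow> real) set) (weighted_Lp_norm q \<alpha>)
       (morrey_space p ((n - 2 * s) / 2 * p + p * r) (p * r))
       (morrey_norm p ((n - 2 * s) / 2 * p + p * r) (p * r)) \<and>
     dilation_invariant ((n - 2 * s) / 2)
       (hom_sobolev_space s :: (real^'n \<Rightarrow> real) set) (hom_sobolev_norm s) \<and>
     dilation_invariant ((n - 2 * s) / 2)
       (weighted_Lp_space q \<alpha> :: (real^'n \<Rightarrow> real) set) (weighted_Lp_norm q \<alpha>) \<and>
     dilation_invariant ((n - 2 * s) / 2)
       (morrey_space p ((n - 2 * s) / 2 * p + p * r) (p * r) :: (real^'n \<Rightarrow> real) set)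
       (morrey_norm p ((n - 2 * s) / 2 * p + p * r) (p * r))"
proof (intro conjI)
  have s2: "2 * s < real CARD('n)" using \<alpha>(3) unfolding n .
  have q': "q = 2 * (real CARD('n) - \<alpha>) / (real CARD('n) - 2 * s)" unfolding q n ..
  have n2: "0 < n - 2 * s" "0 < n - \<alpha>" using \<alpha> by auto
  have q0: "0 < q" using p by simp
  have qa: "(n - 2 * s) / 2 * q = n - \<alpha>" 
  proof -
    have gen: "D / 2 * (2 * E / D) = E" if "D \<noteq> 0" for D E :: real using that by simp
    show ?thesis unfolding q by (rule gen) (use n2 in simp)
  qed
  show "continuous_embedding
       (hom_sobolev_space s :: (real^'n \<Rightarrow> real) set) (hom_sobolev_norm s)
       (weighted_Lp_space q \<alpha>) (weighted_Lp_norm q \<alpha>)"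
    by (rule hom_sobolev_embeds_weighted_Lp[OF s \<alpha>(1,2) s2 q'])
  have rq: "r * q = \<alpha>" using q0 unfolding r by simp
  \<comment> \<open>The Morrey exponent is \<open>n * p / q\<close> in disguise: the scaling
    relation \<open>qa\<close> and \<open>r * q = \<alpha>\<close> add up to \<open>n\<close>. This
    is the form in which Hoelder's inequality uses it.\<close>
  have "((n - 2 * s) / 2 * p + p * r) * q = p * ((n - 2 * s) / 2 * q + r * q)" by (simp only: algebra_simps)
  also have "... = p * n" unfolding qa rq by simp
  finally have "(n - 2 * s) / 2 * p + p * r = real CARD('n) * p / q" using q0 unfolding n by (simp add: field_simps)
  moreover have "p * r * q = \<alpha> * p" unfolding mult.assoc rq by (rule mult.commute)
  ultimately show "continuous_embedding
       (weighted_Lp_space q \<alpha> :: (real^'n \<Rightarrow> real) set) (weighted_Lp_norm q \<alpha>)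
       (morrey_space p ((n - 2 * s) / 2 * p + p * r) (p * r))
       (morrey_norm p ((n - 2 * s) / 2 * p + p * r) (p * r))"
    by (rule weighted_Lp_embeds_morrey[OF p])
  show "dilation_invariant ((n - 2 * s) / 2)
       (hom_sobolev_space s :: (real^'n \<Rightarrow> real) set) (hom_sobolev_norm s)"
    unfolding n by (rule hom_sobolev_dilation_invariant[OF s2])
  show "dilation_invariant ((n - 2 * s) / 2)
       (weighted_Lp_space q \<alpha> :: (real^'n \<Rightarrow> real) set) (weighted_Lp_norm q \<alpha>)"
    using qa unfolding n by (rule weighted_Lp_dilation_invariant)
  show "dilation_invariant ((n - 2 * s) / 2)
       (morrey_space p ((n - 2 * s) / 2 * p + p * r) (p * r) :: (real^'n \<Rightarrow> real) set)
       (morrey_norm p ((n - 2 * s) / 2 * p + p * r) (p * r))"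
    by (rule morrey_dilation_invariant) simp
qed

end
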